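(* Let $a,b,c,\mu\in\mathbb{C}$ with $\operatorname{Re}\mu>2$. Consider any one of the eight cases (1)–(8) listed in the context, with the data $(a',b',c')$, $x_0$, $w$, $v$, $w_2$, $v_2$, $J$ given there. Let $f\in C^2(J)$ be a complex-valued function such that the three functions of $y$ $$f''(y)\,y(1-y)\,w(y)w_2(y)(1+|y|)^{\operatorname{Re}\mu-1},\qquad f'(y)\,w(y)w_2(y)(1+|y|)^{\operatorname{Re}\mu},\qquad f(y)\,w(y)(1+|y|)^{\operatorname{Re}\mu-1}$$ are $L^1$ at $y=x_0$ (i.e. Lebesgue integrable on the intersection of $J$ with some neighbourhood of $x_0$; for $x_0=-\infty$, on $(-\infty,-r)$ for some $r>0$). For $x\in J$ let $I_x$ be the open interval with endpoints $x_0$ and $x$. Then for all $x\in J$ $$L_{a',b',c';x}\left(\int_{I_x}f(y)\,\frac{w(y)}{v(x)}\,|x-y|^{\mu-1}\,dy\right)=\int_{I_x}(L_{a,b,c}f)(y)\,\frac{w(y)\,w_2(y)}{v(x)\,v_2(x)}\,|x-y|^{\mu-1}\,dy.$$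
   Context: For complex $a,b,c$ the hypergeometric differential operator in a real variable $z$ is $$L_{a,b,c;z}(f(z))=(L_{a,b,c}f)(z):=z(1-z)f''(z)+(c-(a+b+1)z)f'(z)-ab\,f(z).$$ All integrals are Lebesgue integrals with respect to positively oriented Lebesgue measure. The eight cases: (1) $(a',b',c')=(a,b,c+\mu)$, $x_0=0$, $w(y)=|y|^{c-1}$, $v(x)=|x|^{c+\mu-1}$, $w_2=v_2=1$, $J=(-\infty,0)\cup(0,1)$. (2) $(a',b',c')=(a+\mu,b,c+\mu)$, $x_0=0$, $w(y)=|y|^{c-1}(1-y)^{b-c-\mu}$, $v(x)=|x|^{c+\mu-1}(1-x)^{b-c}$, $w_2(y)=1-y$, $v_2(x)=1-x$, $J=(-\infty,0)\cup(0,1)$. (3) $(a',b',c')=(a+\mu,b+\mu,c+\mu)$, $x_0=0$, $w(y)=|y|^{c-1}(1-y)^{a+b-c}$, $v(x)=|x|^{c+\mu-1}(1-x)^{a+b-c+\mu}$, $w_2=v_2=1$, $J=(-\infty,0)\cup(0,1)$. (4) $(a',b',c')=(a-\mu,b,c)$, $x_0=0$, $w(y)=|y|^{a-\mu-1}$, $v(x)=|x|^{a-1}$, $w_2(y)=|y|$, $v_2(x)=|x|$, $J=(-\infty,0)\cup(0,1)$. (5) $(a',b',c')=(a+\mu,b,c)$, $x_0=0$, $w(y)=|y|^{c-a-\mu-1}(1-y)^{a+b-c}$, $v(x)=|x|^{c-a-1}(1-x)^{a+b-c+\mu}$, $w_2(y)=|y|$, $v_2(x)=|x|$, $J=(-\infty,0)\cup(0,1)$.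 (6) $(a',b',c')=(a-\mu,b-\mu,c-\mu)$, $x_0=-\infty$, $w=v=1$, $w_2=v_2=1$, $J=(-\infty,1)$. (7) $(a',b',c')=(a-\mu,b,c-\mu)$, $x_0=1$, $w(y)=(1-y)^{a-\mu-1}$, $v(x)=(1-x)^{a-1}$, $w_2(y)=1-y$, $v_2(x)=1-x$, $J=(-\infty,1)$. (8) $(a',b',c')=(a,b,c-\mu)$, $x_0=-\infty$, $w(y)=(1-y)^{a+b-c}$, $v(x)=(1-x)^{a+b-c+\mu}$, $w_2=v_2=1$, $J=(-\infty,1)$. *)

theory Defs
  imports "HOL-Analysis.Analysis"
begin

definition D1 :: "(real \<Rightarrow> complex) \<Rightarrow> real \<Rightarrow> complex" where
  "D1 f = (\<lambda>t. vector_derivative f (at t))"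

definition D2 :: "(real \<Rightarrow> complex) \<Rightarrow> real \<Rightarrow> complex" where
  "D2 f = D1 (D1 f)"

text \<open>For an open set \<open>S\<close> this is the class \<open>C\<^sup>2(S)\<close>.\<close>

definition C2_on :: "real set \<Rightarrow> (real \<Rightarrow> complex) \<Rightarrow> bool" where
  "C2_on S f \<longleftrightarrow> f C1_differentiable_on S \<and> D1 f C1_differentiable_on S"

definition twice_differentiable_at :: "(real \<Rightarrow> complex) \<Rightarrow> real \<Rightarrow> bool" where
  "twice_differentiable_at f z \<longleftrightarrow>
     (\<forall>\<^sub>F t in nhds z. f differentiable (at t)) \<and> D1 f differentiable (at z)"

definition hypergeom_op ::
    "complex \<Rightarrow> complex \<Rightarrow> complex \<Rightarrow> (real \<Rightarrow> complex) \<Rightarrow> real \<Rightarrow> complex" where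
  "hypergeom_op a b c f z =
     of_real (z * (1 - z)) * D2 f z + (c - (a + b + 1) * of_real z) * D1 f z - a * b * f z"

text \<open>Neighbourhoods are taken in the extended reals; those of \<open>-\<infinity>\<close> are the sets
  containing some \<open>[-\<infinity>, -r)\<close>, so the finite and the infinite base point are treated alike.\<close>

definition L1_at :: "ereal \<Rightarrow> real set \<Rightarrow> (real \<Rightarrow> complex) \<Rightarrow> bool" where
  "L1_at x0 J g \<longleftrightarrow>
     (\<exists>U. open U \<and> x0 \<in> U \<and> set_integrable lebesgue (J \<inter> {y. ereal y \<in> U}) g)"

definition interval_between :: "ereal \<Rightarrow> real \<Rightarrow> real set" where
  "interval_between x0 x = einterval (min x0 (ereal x)) (max x0 (ereal x))"

text \<open>\<open>cpow t s\<close> is used for \<open>t > 0\<close> only, where it is \<open>exp (s * ln t)\<close> with the real logarithm.\<close>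

abbreviation cpow :: "real \<Rightarrow> complex \<Rightarrow> complex" where
  "cpow t s \<equiv> complex_of_real t powr s"

record transmutation =
  tr_a :: complex
  tr_b :: complex
  tr_c :: complex
  tr_x0 :: ereal
  tr_w :: "real \<Rightarrow> complex"
  tr_v :: "real \<Rightarrow> complex"
  tr_w2 :: "real \<Rightarrow> real"
  tr_v2 :: "real \<Rightarrow> real"
  tr_J :: "real set"

definition transmutations ::
    "complex \<Rightarrow> complex \<Rightarrow> complex \<Rightarrow> complex \<Rightarrow> transmutation set" where
  "transmutations a b c \<mu> =
   {\<lparr> tr_a = a, tr_b = b, tr_c = c + \<mu>, tr_x0 = 0,
      tr_w = (\<lambda>y. cpow \<bar>y\<bar> (c - 1)),
      tr_v = (\<lambda>x. cpow \<bar>x\<bar> (c + \<mu> - 1)),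
      tr_w2 = (\<lambda>y. 1), tr_v2 = (\<lambda>x. 1),
      tr_J = {..<0} \<union> {0<..<1} \<rparr>,
    \<lparr> tr_a = a + \<mu>, tr_b = b, tr_c = c + \<mu>, tr_x0 = 0,
      tr_w = (\<lambda>y. cpow \<bar>y\<bar> (c - 1) * cpow (1 - y) (b - c - \<mu>)),
      tr_v = (\<lambda>x. cpow \<bar>x\<bar> (c + \<mu> - 1) * cpow (1 - x) (b - c)),
      tr_w2 = (\<lambda>y. 1 - y), tr_v2 = (\<lambda>x. 1 - x),
      tr_J = {..<0} \<union> {0<..<1} \<rparr>,
    \<lparr> tr_a = a + \<mu>, tr_b = b + \<mu>, tr_c = c + \<mu>, tr_x0 = 0,
      tr_w = (\<lambda>y. cpow \<bar>y\<bar> (c - 1) * cpow (1 - y) (a + b - c)),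
      tr_v = (\<lambda>x. cpow \<bar>x\<bar> (c + \<mu> - 1) * cpow (1 - x) (a + b - c + \<mu>)),
      tr_w2 = (\<lambda>y. 1), tr_v2 = (\<lambda>x. 1),
      tr_J = {..<0} \<union> {0<..<1} \<rparr>,
    \<lparr> tr_a = a - \<mu>, tr_b = b, tr_c = c, tr_x0 = 0,
      tr_w = (\<lambda>y. cpow \<bar>y\<bar> (a - \<mu> - 1)),
      tr_v = (\<lambda>x. cpow \<bar>x\<bar> (a - 1)),
      tr_w2 = (\<lambda>y. \<bar>y\<bar>), tr_v2 = (\<lambda>x. \<bar>x\<bar>),
      tr_J = {..<0} \<union> {0<..<1} \<rparr>,
    \<lparr> tr_a = a + \<mu>, tr_b = b, tr_c = c, tr_x0 = 0,
      tr_w = (\<lambda>y. cpow \<bar>y\<bar> (c - a - \<mu> - 1) * cpow (1 - y) (a + b - c)),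
      tr_v = (\<lambda>x. cpow \<bar>x\<bar> (c - a - 1) * cpow (1 - x) (a + b - c + \<mu>)),
      tr_w2 = (\<lambda>y. \<bar>y\<bar>), tr_v2 = (\<lambda>x. \<bar>x\<bar>),
      tr_J = {..<0} \<union> {0<..<1} \<rparr>,
    \<lparr> tr_a = a - \<mu>, tr_b = b - \<mu>, tr_c = c - \<mu>, tr_x0 = -\<infinity>,
      tr_w = (\<lambda>y. 1),
      tr_v = (\<lambda>x. 1),
      tr_w2 = (\<lambda>y. 1), tr_v2 = (\<lambda>x. 1),
      tr_J = {..<1} \<rparr>,
    \<lparr> tr_a = a - \<mu>, tr_b = b, tr_c = c - \<mu>, tr_x0 = 1,
      tr_w = (\<lambda>y. cpow (1 - y) (a - \<mu> - 1)),
      tr_v = (\<lambda>x. cpow (1 - x) (a - 1)),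
      tr_w2 = (\<lambda>y. 1 - y), tr_v2 = (\<lambda>x. 1 - x),
      tr_J = {..<1} \<rparr>,
    \<lparr> tr_a = a, tr_b = b, tr_c = c - \<mu>, tr_x0 = -\<infinity>,
      tr_w = (\<lambda>y. cpow (1 - y) (a + b - c)),
      tr_v = (\<lambda>x. cpow (1 - x) (a + b - c + \<mu>)),
      tr_w2 = (\<lambda>y. 1), tr_v2 = (\<lambda>x. 1),
      tr_J = {..<1} \<rparr>}"

definition lhs_integrand ::
    "transmutation \<Rightarrow> complex \<Rightarrow> (real \<Rightarrow> complex) \<Rightarrow> real \<Rightarrow> real \<Rightarrow> complex" where
  "lhs_integrand T \<mu> f x y = f y * (tr_w T y / tr_v T x) * cpow \<bar>x - y\<bar> (\<mu> - 1)"

definition rhs_integrand ::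
    "transmutation \<Rightarrow> complex \<Rightarrow> (real \<Rightarrow> complex) \<Rightarrow> real \<Rightarrow> real \<Rightarrow> complex" where
  "rhs_integrand T \<mu> g x y =
     g y * (tr_w T y * of_real (tr_w2 T y) / (tr_v T x * of_real (tr_v2 T x)))
         * cpow \<bar>x - y\<bar> (\<mu> - 1)"

end

theory Submission
  imports Defs
begin

text \<open>
  Write the integral operator as \<open>1 / v x\<close> times the Riemann-Liouville integral \<open>\<integral> f w \<bar>x - y\<bar>\<^bsup>\<mu> - 1\<^esup>\<close>. By Fubini
  the integral of order \<open>\<nu>\<close> is \<open>\<nu> - 1\<close> times a primitive of the one of order \<open>\<nu> - 1\<close>, so for
  \<open>Re \<mu> > 2\<close> it may be differentiated twice under the integral sign, the exponent \<open>\<mu> - 3\<close> being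
  integrable. In all eight cases the kernel satisfies a rational identity: the operator
  with parameters \<open>(a', b', c')\<close> acting in \<open>x\<close> equals the adjoint of the one with parameters \<open>(a, b, c)\<close>
  acting in \<open>y\<close> on the kernel with the additional factor \<open>w2 y / v2 x\<close>. Integrating by parts, it
  remains to see that the boundary terms vanish. At \<open>y = x\<close> this follows from \<open>Re \<mu> > 2\<close>. At \<open>x0\<close> the
  boundary term has a limit, because its derivative is integrable, and its quotient by a function \<open>l\<close>
  (\<open>\<bar>y\<bar>\<close> or \<open>1 - y\<close>) is integrable although \<open>1 / l\<close> is not; hence the limit is \<open>0\<close>.
\<close>

section \<open>Riemann-Liouville integrals\<close>

text \<open>For 2 < Re \<mu> < 3 the second x-derivative of the kernel is unbounded at y = x. This
  singularity moves with x, so no common dominating function justifies differentiating under the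
  integral directly; hence the detour through a primitive and its continuity. If x0 is infinite, the
  kernel grows like |y| to the power Re \<mu> - 1: the powers of 1 + |y| in the hypotheses pay for
  this, with one power more for f' because its coefficient in the operator is affine in y. Nothing
  is assumed about limits of f or f' at x0, so the vanishing of the boundary terms must be extracted
  from integrability alone. The base point may lie on either side of x; the analytic lemmas treat x0
  < x first and obtain the other side from y -> -y. Integrability and twofold differentiability
  belong to the claim because integrals and derivatives that do not exist have default values, about
  which the equation would say nothing. Case (1) is the operator of Bateman's fractional integral,
  which carries 2F1(a, b; c) to a multiple of 2F1(a, b; c + \<mu>).\<close>

definition rl_kernel :: "complex \<Rightarrow> real \<Rightarrow> complex" where
  "rl_kernel \<nu> u = (if u > 0 then cpow u (\<nu> - 1) else 0)"

lemma cpow_eq_exp: "t > 0 \<Longrightarrow> cpow t s = exp (s * of_real (ln t))"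
  by (simp add: powr_def Ln_of_real)

lemma norm_cpow: "t > 0 \<Longrightarrow> norm (cpow t s) = t powr Re s"
  by (simp add: norm_powr_real_powr)

lemma norm_rl_kernel: "norm (rl_kernel \<nu> u) = (if u > 0 then u powr (Re \<nu> - 1) else 0)"
  by (simp add: rl_kernel_def norm_cpow)

lemma borel_measurable_rl_kernel [measurable]: "rl_kernel \<nu> \<in> borel_measurable borel"
proof -
  have "rl_kernel \<nu> = (\<lambda>u. if u > 0 then exp ((\<nu> - 1) * of_real (ln u)) else 0)"
    by (auto simp: rl_kernel_def cpow_eq_exp fun_eq_iff)
  also have "\<dots> \<in> borel_measurable borel" by measurable
  finally show ?thesis .
qed

lemma has_vector_derivative_cpow:
  assumes "t > 0"
  shows "((\<lambda>t. cpow t s) has_vector_derivative s * cpow t (s - 1)) (at t)"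
proof -
  have "((\<lambda>z. z powr s) has_field_derivative s * of_real t powr (s - 1)) (at (of_real t))"
    using assms by (intro has_field_derivative_powr) (auto simp: complex_nonpos_Reals_iff)
  then show ?thesis
    using has_vector_derivative_real_field by blast
qed

lemma isCont_cpow: "t > 0 \<Longrightarrow> isCont (\<lambda>t. cpow t s) t"
  using has_vector_derivative_cpow has_vector_derivative_continuous by blast

lemma isCont_rl_kernel_pos:
  assumes "u > 0" shows "isCont (rl_kernel \<nu>) u"
proof -
  have "\<forall>\<^sub>F t in nhds u. rl_kernel \<nu> t = cpow t (\<nu> - 1)"
    using eventually_nhds_in_open[of "{0<..}" u] assms
    by (auto elim!: eventually_mono simp: rl_kernel_def)
  then show ?thesis
    using isCont_cpow[OF assms] isCont_cong by fast
qed

lemma continuous_rl_kernel: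
  assumes "Re \<nu> > 1"
  shows "isCont (rl_kernel \<nu>) u"
proof (cases u "0::real" rule: linorder_cases)
  case less
  have "\<forall>\<^sub>F t in nhds u. rl_kernel \<nu> t = 0"
    using eventually_nhds_in_open[of "{..<0}" u] less
    by (auto elim!: eventually_mono simp: rl_kernel_def)
  then show ?thesis by (subst isCont_cong) auto
next
  case equal
  have "((\<lambda>u::real. \<bar>u\<bar> powr (Re \<nu> - 1)) \<longlongrightarrow> 0) (at 0)"
    using assms by (auto intro!: tendsto_eq_intros)
  then have "((\<lambda>u. rl_kernel \<nu> u) \<longlongrightarrow> 0) (at 0)"
    by (rule Lim_null_comparison[rotated]) (auto simp: norm_rl_kernel)
  moreover have "rl_kernel \<nu> 0 = 0" by (simp add: rl_kernel_def)
  ultimately show ?thesis by (simp add: equal isCont_def)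
next
  case greater then show ?thesis by (rule isCont_rl_kernel_pos)
qed

lemma set_integrable_powr_from_0:
  assumes "r > (-1::real)"
  shows "set_integrable lborel {0<..<c} (\<lambda>x. x powr r)"
proof (cases "c \<ge> 0")
  case True
  have "(\<lambda>x. x powr r) absolutely_integrable_on {0..c}"
    using has_integral_powr_from_0[OF assms True]
    by (intro nonnegative_absolutely_integrable_1) (auto simp: integrable_on_def)
  then have "set_integrable lebesgue {0<..<c} (\<lambda>x. x powr r)"
    by (rule set_integrable_subset) auto
  then show ?thesis
    unfolding set_integrable_def
    by (subst (asm) integrable_completion) measurable
next
  case False
  then have "{0<..<c} = {}" by auto
  then show ?thesis by (simp add: set_integrable_def)
qed

lemma rl_kernel_integrable:
  assumes "Re \<nu> > 0"
  shows "integrable lborel (\<lambda>u. indicator {..<c} u *\<^sub>R rl_kernel \<nu> u)"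
proof (rule Bochner_Integration.integrable_bound)
  show "integrable lborel (\<lambda>x. indicator {0<..<c} x *\<^sub>R (x powr (Re \<nu> - 1)))"
    using set_integrable_powr_from_0[of "Re \<nu> - 1" c] assms by (simp add: set_integrable_def)
qed (auto simp: indicator_def norm_rl_kernel)

text \<open>The formula that raises the order by one in the Fubini argument. Both sides are 0 for c
  \<le> 0, so after a shift by y no distinction between y < s and y \<ge> s is needed.\<close>

lemma integral_rl_kernel:
  assumes "Re \<nu> > 0"
  shows "(LINT u|lborel. indicator {..<c} u *\<^sub>R rl_kernel \<nu> u) = rl_kernel (\<nu> + 1) c / \<nu>"
proof (cases "c > 0")
  case True
  have nz: "\<nu> \<noteq> 0" using assms by auto
  \<comment> \<open>For Re \<nu> < 1 the integrand is unbounded at 0; therefore the version of the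
    fundamental theorem is taken that asks the primitive only to be continuous at the
    endpoints.\<close>
  have 1: "(rl_kernel \<nu> has_integral (rl_kernel (\<nu> + 1) c / \<nu> - rl_kernel (\<nu> + 1) 0 / \<nu>)) {0..c}"
  proof (rule fundamental_theorem_of_calculus_interior)
    show "continuous_on {0..c} (\<lambda>u. rl_kernel (\<nu> + 1) u / \<nu>)"
      using continuous_rl_kernel[of "\<nu> + 1"] assms nz
      by (intro continuous_at_imp_continuous_on ballI continuous_intros) auto
    fix x assume x: "x \<in> {0<..<c}"
    have "((\<lambda>u. cpow u \<nu> / \<nu>) has_vector_derivative \<nu> * cpow x (\<nu> - 1) / \<nu>) (at x)"
      using x by (intro has_vector_derivative_divide has_vector_derivative_cpow) auto
    then have "((\<lambda>u. cpow u \<nu> / \<nu>) has_vector_derivative rl_kernel \<nu> x) (at x)"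
      using x nz by (simp add: rl_kernel_def)
    then show "((\<lambda>u. rl_kernel (\<nu> + 1) u / \<nu>) has_vector_derivative rl_kernel \<nu> x) (at x)"
      by (rule has_vector_derivative_transform_within_open[of _ _ _ "{0<..}"])
         (use x in \<open>auto simp: rl_kernel_def\<close>)
  qed (use True in auto)
  have si: "set_integrable lborel {0..c} (rl_kernel \<nu>)"
    unfolding set_integrable_def
    by (rule Bochner_Integration.integrable_bound[OF rl_kernel_integrable[OF assms, of "c + 1"]])
       (auto simp: indicator_def)
  have "(LINT u|lborel. indicator {..<c} u *\<^sub>R rl_kernel \<nu> u) = (LINT u:{0..c}|lborel. rl_kernel \<nu> u)"
    unfolding set_lebesgue_integral_def
  proof (rule integral_cong_AE)
    show "AE u in lborel. indicator {..<c} u *\<^sub>R rl_kernel \<nu> u = indicator {0..c} u *\<^sub>R rl_kernel \<nu> u"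
      using AE_lborel_singleton[of c]
      by eventually_elim (auto simp: indicator_def rl_kernel_def)
  qed measurable
  also have "\<dots> = integral {0..c} (rl_kernel \<nu>)"
    using set_borel_integral_eq_integral(2)[OF si] .
  also have "\<dots> = rl_kernel (\<nu> + 1) c / \<nu>"
    using integral_unique[OF 1] by (simp add: rl_kernel_def)
  finally show ?thesis .
next
  case False
  then have "(\<lambda>u. indicator {..<c} u *\<^sub>R rl_kernel \<nu> u) = (\<lambda>u. 0)"
    by (auto simp: indicator_def rl_kernel_def fun_eq_iff)
  then show ?thesis using False by (simp add: rl_kernel_def)
qed

lemma integral_rl_kernel_shift:
  assumes "Re \<nu> > 0"
  shows "integrable lborel (\<lambda>t. indicator {..<s} t *\<^sub>R rl_kernel \<nu> (t - y))"
    and "(LINT t|lborel. indicator {..<s} t *\<^sub>R rl_kernel \<nu> (t - y)) = rl_kernel (\<nu> + 1) (s - y) / \<nu>"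
proof -
  have *: "indicator {..<s} t = indicator {..<s - y} (-y + 1 * t)" for t :: real
    by (auto simp: indicator_def)
  show "integrable lborel (\<lambda>t. indicator {..<s} t *\<^sub>R rl_kernel \<nu> (t - y))"
    using lborel_integrable_real_affine[OF rl_kernel_integrable[OF assms], of 1 "s - y" "-y"]
    by (simp add: * algebra_simps)
  have "(LINT t|lborel. indicator {..<s} t *\<^sub>R rl_kernel \<nu> (t - y)) =
     (LINT u|lborel. indicator {..<s - y} u *\<^sub>R rl_kernel \<nu> u)"
    by (subst lborel_integral_real_affine[of 1 _ "-y"]) (auto simp: * algebra_simps)
  then show "(LINT t|lborel. indicator {..<s} t *\<^sub>R rl_kernel \<nu> (t - y)) = rl_kernel (\<nu> + 1) (s - y) / \<nu>"
    by (simp add: integral_rl_kernel[OF assms])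
qed

text \<open>From |s - y| \<le> (1 + |s|) (1 + |y|). The product form separates s from y, so a weight
  in y alone dominates the growth of the kernel.\<close>

lemma powr_dist_le:
  fixes s y :: real
  assumes "0 \<le> r"
  shows "\<bar>s - y\<bar> powr r \<le> (1 + \<bar>s\<bar>) powr r * (1 + \<bar>y\<bar>) powr r"
proof -
  have "0 \<le> \<bar>s\<bar> * \<bar>y\<bar>" by simp
  moreover have "(1 + \<bar>s\<bar>) * (1 + \<bar>y\<bar>) = 1 + \<bar>s\<bar> + \<bar>y\<bar> + \<bar>s\<bar> * \<bar>y\<bar>"
    by (simp add: algebra_simps)
  ultimately have "\<bar>s - y\<bar> \<le> (1 + \<bar>s\<bar>) * (1 + \<bar>y\<bar>)" by linarith
  then have "\<bar>s - y\<bar> powr r \<le> ((1 + \<bar>s\<bar>) * (1 + \<bar>y\<bar>)) powr r"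
    using assms by (intro powr_mono2) auto
  then show ?thesis by (simp add: powr_mult)
qed

text \<open>The two summands of the constant serve the two signs of Re \<nu> - 1: a decreasing power
  is largest at distance \<delta>, a growing one is controlled by the separated weight.\<close>

lemma norm_rl_kernel_le_far:
  assumes "Re \<nu> - 1 \<le> M" "0 \<le> M" "0 < \<delta>" "\<delta> \<le> s - y"
  shows "norm (rl_kernel \<nu> (s - y)) \<le> (\<delta> powr (Re \<nu> - 1) + (1 + \<bar>s\<bar>) powr M) * (1 + \<bar>y\<bar>) powr M"
proof (cases "Re \<nu> - 1 \<ge> 0")
  case True
  have "norm (rl_kernel \<nu> (s - y)) = \<bar>s - y\<bar> powr (Re \<nu> - 1)"
    using assms by (simp add: norm_rl_kernel)
  also have "\<dots> \<le> (1 + \<bar>s\<bar>) powr (Re \<nu> - 1) * (1 + \<bar>y\<bar>) powr (Re \<nu> - 1)"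
    by (rule powr_dist_le[OF True])
  also have "\<dots> \<le> (1 + \<bar>s\<bar>) powr M * (1 + \<bar>y\<bar>) powr M"
    using assms by (intro mult_mono powr_mono) auto
  also have "\<dots> \<le> (\<delta> powr (Re \<nu> - 1) + (1 + \<bar>s\<bar>) powr M) * (1 + \<bar>y\<bar>) powr M"
    by (intro mult_right_mono) auto
  finally show ?thesis .
next
  case False
  have "norm (rl_kernel \<nu> (s - y)) = (s - y) powr (Re \<nu> - 1)"
    using assms by (simp add: norm_rl_kernel)
  also have "\<dots> \<le> \<delta> powr (Re \<nu> - 1)"
    using False assms by (intro powr_mono2') auto
  also have "\<dots> \<le> (\<delta> powr (Re \<nu> - 1) + (1 + \<bar>s\<bar>) powr M) * 1" by simp
  also have "\<dots> \<le> (\<delta> powr (Re \<nu> - 1) + (1 + \<bar>s\<bar>) powr M) * (1 + \<bar>y\<bar>) powr M"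
    using assms by (intro mult_left_mono ge_one_powr_ge_zero) auto
  finally show ?thesis .
qed

text \<open>As \<open>rl_kernel\<close> vanishes for nonpositive arguments, the moving endpoint s
  sits inside the kernel and the domain of integration is fixed.\<close>

definition rl_conv :: "complex \<Rightarrow> (real \<Rightarrow> complex) \<Rightarrow> real \<Rightarrow> complex" where
  "rl_conv \<nu> g s = (LINT y|lborel. g y * rl_kernel \<nu> (s - y))"

section \<open>Integrability, continuity and differentiation of the convolution\<close>

context
  fixes g :: "real \<Rightarrow> complex" and M p b :: real
  assumes g_meas [measurable]: "g \<in> borel_measurable borel"
    and g_int: "integrable lborel (\<lambda>y. (1 + \<bar>y\<bar>) powr M *\<^sub>R g y)"
    and g_cont: "continuous_on {p..b} g"
    and M_nonneg: "0 \<le> M"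
begin

lemma rl_conv_bound:
  obtains N where "N \<ge> 0" "\<And>y. y \<in> {p..b} \<Longrightarrow> norm (g y) \<le> N"
proof -
  have "bounded (g ` {p..b})"
    using g_cont by (intro compact_imp_bounded compact_continuous_image) auto
  then obtain N where "\<And>y. y \<in> {p..b} \<Longrightarrow> norm (g y) \<le> N" unfolding bounded_iff by blast
  then show ?thesis by (intro that[of "max 0 N"]) (auto simp: le_max_iff_disj)
qed

text \<open>Split at p. Below p the kernel is at most a constant times the weight; between p and t
  the function g is bounded and the kernel is integrable in spite of its singularity; above t the
  kernel is 0.\<close>

lemma rl_conv_integrable:
  assumes t: "t \<in> {p<..b}" and \<eta>: "0 < Re \<eta>" "Re \<eta> - 1 \<le> M"
  shows "integrable lborel (\<lambda>y. g y * rl_kernel \<eta> (t - y))"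
proof -
  obtain N where N: "N \<ge> 0" "\<And>y. y \<in> {p..b} \<Longrightarrow> norm (g y) \<le> N" using rl_conv_bound by blast
  define C where "C = (t - p) powr (Re \<eta> - 1) + (1 + \<bar>t\<bar>) powr M"
  define k where "k = (\<lambda>y. indicator {..<b - p} (t - y) *\<^sub>R rl_kernel \<eta> (t - y))"
  have k: "integrable lborel k"
    using lborel_integrable_real_affine[OF rl_kernel_integrable[OF \<eta>(1), of "b - p"], of "-1" t]
    by (simp add: k_def)
  show ?thesis
  proof (rule Bochner_Integration.integrable_bound)
    show "integrable lborel (\<lambda>y. C * norm ((1 + \<bar>y\<bar>) powr M *\<^sub>R g y) + N * norm (k y))"
      by (intro Bochner_Integration.integrable_add integrable_mult_right integrable_norm k g_int)
    show "AE y in lborel. norm (g y * rl_kernel \<eta> (t - y))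
      \<le> norm (C * norm ((1 + \<bar>y\<bar>) powr M *\<^sub>R g y) + N * norm (k y))"
    proof (rule AE_I2)
      fix y
      have C0: "C \<ge> 0" by (simp add: C_def)
      consider "y \<le> p" | "p < y" "y < t" | "t \<le> y" by linarith
      then have "norm (g y * rl_kernel \<eta> (t - y)) \<le> C * norm ((1 + \<bar>y\<bar>) powr M *\<^sub>R g y) + N * norm (k y)"
      proof cases
        case 1
        then have "norm (rl_kernel \<eta> (t - y)) \<le> C * (1 + \<bar>y\<bar>) powr M"
          unfolding C_def using t \<eta> M_nonneg by (intro norm_rl_kernel_le_far) auto
        then have "norm (g y) * norm (rl_kernel \<eta> (t - y)) \<le> norm (g y) * (C * (1 + \<bar>y\<bar>) powr M)"
          by (intro mult_left_mono) auto
        moreover have "0 \<le> N * norm (k y)" using N by simp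
        ultimately show ?thesis by (simp add: norm_mult algebra_simps)
      next
        case 2
        then have "norm (g y) * norm (rl_kernel \<eta> (t - y)) \<le> N * norm (k y)"
          using N t by (auto simp: k_def indicator_def intro!: mult_right_mono)
        moreover have "0 \<le> C * norm ((1 + \<bar>y\<bar>) powr M *\<^sub>R g y)" using C0 by simp
        ultimately show ?thesis unfolding norm_mult by linarith
      next
        case 3
        then show ?thesis using C0 N by (simp add: rl_kernel_def)
      qed
      then show "norm (g y * rl_kernel \<eta> (t - y))
         \<le> norm (C * norm ((1 + \<bar>y\<bar>) powr M *\<^sub>R g y) + N * norm (k y))" by simp
    qed
  qed measurable
qed

text \<open>The kernel is cut at distance \<delta>. In the near part the substitution u = t - y
  fixes the singularity at u = 0 and moves t into the continuous function g. In the far part t stays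
  in the kernel, which is there dominated by the weight. Both parts then yield to dominated
  convergence.\<close>

lemma rl_conv_continuous:
  assumes lr: "p < l" "r < b" and \<eta>: "0 < Re \<eta>" "Re \<eta> - 1 \<le> M"
  shows "continuous_on {l..r} (rl_conv \<eta> g)"
proof -
  obtain N where N: "N \<ge> 0" "\<And>y. y \<in> {p..b} \<Longrightarrow> norm (g y) \<le> N" using rl_conv_bound by blast
  \<comment> \<open>For t \<ge> l and 0 < u < \<delta> the point t - u stays above p, so g is
    evaluated only where it is continuous and bounded.\<close>
  define \<delta> where "\<delta> = (l - p) / 2"
  have \<delta>: "\<delta> > 0" using lr by (simp add: \<delta>_def)
  define near where "near = (\<lambda>u. indicator {..<\<delta>} u *\<^sub>R rl_kernel \<eta> u)"
  define far where "far = (\<lambda>u. indicator {\<delta>..} u *\<^sub>R rl_kernel \<eta> u)"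
  have [measurable]: "near \<in> borel_measurable borel" "far \<in> borel_measurable borel"
    by (simp_all add: near_def far_def)
  have near_int: "integrable lborel near" unfolding near_def by (rule rl_kernel_integrable[OF \<eta>(1)])
  have split: "rl_kernel \<eta> u = near u + far u" for u
    by (simp add: near_def far_def indicator_def)
  have far_le: "norm (far u) \<le> norm (rl_kernel \<eta> u)" and near_le: "norm (near u) \<le> norm (rl_kernel \<eta> u)" for u
    by (auto simp: near_def far_def indicator_def)
  have eq: "rl_conv \<eta> g t = (LINT u|lborel. g (t - u) * near u) + (LINT y|lborel. g y * far (t - y))"
    if t: "t \<in> {l..r}" for t
  proof -
    have int: "integrable lborel (\<lambda>y. g y * rl_kernel \<eta> (t - y))"
      using t lr by (intro rl_conv_integrable \<eta>) auto
    have i1: "integrable lborel (\<lambda>y. g y * near (t - y))"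
      by (rule Bochner_Integration.integrable_bound[OF int])
         (auto simp: norm_mult intro!: mult_left_mono near_le)
    have i2: "integrable lborel (\<lambda>y. g y * far (t - y))"
      by (rule Bochner_Integration.integrable_bound[OF int])
         (auto simp: norm_mult intro!: mult_left_mono far_le)
    have "rl_conv \<eta> g t = (LINT y|lborel. g y * near (t - y)) + (LINT y|lborel. g y * far (t - y))"
      unfolding rl_conv_def split ring_distribs using i1 i2 by (rule Bochner_Integration.integral_add)
    also have "(LINT y|lborel. g y * near (t - y)) = (LINT u|lborel. g (t - u) * near u)"
      by (subst lborel_integral_real_affine[of "-1" _ t]) auto
    finally show ?thesis .
  qed
  have c1: "continuous_on {l..r} (\<lambda>t. LINT u|lborel. g (t - u) * near u)"
    unfolding continuous_on_sequentially comp_def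
  proof safe
    fix x :: "nat \<Rightarrow> real" and s assume s: "s \<in> {l..r}" and x: "\<forall>n. x n \<in> {l..r}" "x \<longlonglongrightarrow> s"
    show "(\<lambda>n. LINT u|lborel. g (x n - u) * near u) \<longlonglongrightarrow> (LINT u|lborel. g (s - u) * near u)"
    proof (rule integral_dominated_convergence[where w = "\<lambda>u. N * norm (near u)"])
      show "integrable lborel (\<lambda>u. N * norm (near u))"
        by (intro integrable_mult_right integrable_norm near_int)
      have rng: "t - u \<in> {p..b}" if "t \<in> {l..r}" "near u \<noteq> 0" for t u
        using that lr \<delta> by (auto simp: near_def rl_kernel_def \<delta>_def indicator_def field_simps split: if_splits)
      show "AE u in lborel. norm (g (x n - u) * near u) \<le> N * norm (near u)" for n
      proof (rule AE_I2)
        fix u show "norm (g (x n - u) * near u) \<le> N * norm (near u)"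
          using N rng[of "x n" u] x(1) by (cases "near u = 0") (auto simp: norm_mult intro!: mult_right_mono)
      qed
      show "AE u in lborel. (\<lambda>n. g (x n - u) * near u) \<longlonglongrightarrow> g (s - u) * near u"
      proof (rule AE_I2)
        fix u show "(\<lambda>n. g (x n - u) * near u) \<longlonglongrightarrow> g (s - u) * near u"
        proof (cases "near u = 0")
          case False
          have "(\<lambda>n. g (x n - u)) \<longlonglongrightarrow> g (s - u)"
            using rng[OF _ False] s x
            by (intro continuous_on_tendsto_compose[OF g_cont] tendsto_intros) auto
          then show ?thesis by (intro tendsto_intros)
        qed simp
      qed
    qed measurable
  qed
  define C where "C = \<delta> powr (Re \<eta> - 1) + (1 + \<bar>l\<bar> + \<bar>r\<bar>) powr M"
  have C0: "C \<ge> 0" by (simp add: C_def)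
  have c2: "continuous_on {l..r} (\<lambda>t. LINT y|lborel. g y * far (t - y))"
    unfolding continuous_on_sequentially comp_def
  proof safe
    fix x :: "nat \<Rightarrow> real" and s assume s: "s \<in> {l..r}" and x: "\<forall>n. x n \<in> {l..r}" "x \<longlonglongrightarrow> s"
    show "(\<lambda>n. LINT y|lborel. g y * far (x n - y)) \<longlonglongrightarrow> (LINT y|lborel. g y * far (s - y))"
    proof (rule integral_dominated_convergence[where w = "\<lambda>y. C * norm ((1 + \<bar>y\<bar>) powr M *\<^sub>R g y)"])
      show "integrable lborel (\<lambda>y. C * norm ((1 + \<bar>y\<bar>) powr M *\<^sub>R g y))"
        by (intro integrable_mult_right integrable_norm g_int)
      show "AE y in lborel. norm (g y * far (x n - y)) \<le> C * norm ((1 + \<bar>y\<bar>) powr M *\<^sub>R g y)" for n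
      proof (rule AE_I2)
        fix y
        have "norm (far (x n - y)) \<le> C * (1 + \<bar>y\<bar>) powr M"
        proof (cases "\<delta> \<le> x n - y")
          case True
          have "norm (far (x n - y)) \<le> norm (rl_kernel \<eta> (x n - y))" by (rule far_le)
          also have "\<dots> \<le> (\<delta> powr (Re \<eta> - 1) + (1 + \<bar>x n\<bar>) powr M) * (1 + \<bar>y\<bar>) powr M"
            using True \<delta> \<eta> M_nonneg by (intro norm_rl_kernel_le_far) auto
          also have "\<dots> \<le> C * (1 + \<bar>y\<bar>) powr M"
          proof -
            have "x n \<in> {l..r}" using x by auto
            then have "(1 + \<bar>x n\<bar>) powr M \<le> (1 + \<bar>l\<bar> + \<bar>r\<bar>) powr M"
              using M_nonneg by (intro powr_mono2) auto
            then show ?thesis unfolding C_def by (intro mult_right_mono) auto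
          qed
          finally show ?thesis .
        next
          case False
          then show ?thesis using C0 by (simp add: far_def)
        qed
        then have "norm (g y) * norm (far (x n - y)) \<le> norm (g y) * (C * (1 + \<bar>y\<bar>) powr M)"
          by (intro mult_left_mono) auto
        then show "norm (g y * far (x n - y)) \<le> C * norm ((1 + \<bar>y\<bar>) powr M *\<^sub>R g y)"
          by (simp add: norm_mult algebra_simps)
      qed
      \<comment> \<open>The cut makes \<open>far\<close> discontinuous at \<delta>, which concerns
        the single point y = s - \<delta>.\<close>
      show "AE y in lborel. (\<lambda>n. g y * far (x n - y)) \<longlonglongrightarrow> g y * far (s - y)"
        using AE_lborel_singleton[of "s - \<delta>"]
      proof eventually_elim
        case (elim y)
        have "isCont far (s - y)"
        proof (cases "s - y < \<delta>")
          case True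
          have "\<forall>\<^sub>F u in nhds (s - y). far u = 0"
            using eventually_nhds_in_open[of "{..<\<delta>}" "s - y"] True
            by (auto elim!: eventually_mono simp: far_def)
          then show ?thesis by (subst isCont_cong) auto
        next
          case False
          with elim have "s - y > \<delta>" by auto
          then have "\<forall>\<^sub>F u in nhds (s - y). far u = rl_kernel \<eta> u"
            using eventually_nhds_in_open[of "{\<delta><..}" "s - y"]
            by (auto elim!: eventually_mono simp: far_def)
          then show ?thesis using isCont_rl_kernel_pos[of "s - y" \<eta>] \<open>s - y > \<delta>\<close> \<delta>
            by (subst isCont_cong) auto
        qed
        then have "(\<lambda>n. far (x n - y)) \<longlonglongrightarrow> far (s - y)"
          by (rule isCont_tendsto_compose) (intro tendsto_intros x)
        then show ?case by (intro tendsto_intros)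
      qed
    qed measurable
  qed
  show ?thesis
    using continuous_on_add[OF c1 c2] by (rule continuous_on_cong[THEN iffD1, rotated -1]) (auto simp: eq)
qed

text \<open>Write the kernel of order \<nu> as \<nu> - 1 times the integral over t < s of the kernel
  of order \<nu> - 1 and exchange the integrals. The first claim makes the integral down to
  -infinity meaningful.\<close>

lemma rl_conv_primitive:
  assumes s: "s \<in> {p<..b}" and \<nu>: "1 < Re \<nu>" "Re \<nu> - 1 \<le> M"
  shows "integrable lborel (\<lambda>t. indicator {..<s} t *\<^sub>R rl_conv (\<nu> - 1) g t)"
    and "rl_conv \<nu> g s = (\<nu> - 1) * (LINT t|lborel. indicator {..<s} t *\<^sub>R rl_conv (\<nu> - 1) g t)"
proof -
  define h where "h = (\<lambda>(y, t). g y * (indicator {..<s} t *\<^sub>R rl_kernel (\<nu> - 1) (t - y)))"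
  have [measurable]: "h \<in> borel_measurable (lborel \<Otimes>\<^sub>M lborel)"
    unfolding h_def by measurable
  have \<nu>': "Re (\<nu> - 1) > 0" using \<nu> by simp
  have hint: "integrable lborel (\<lambda>t. h (y, t))" for y
    unfolding h_def prod.case by (intro integrable_mult_right integral_rl_kernel_shift(1)[OF \<nu>'])
  \<comment> \<open>The norm of a kernel is the kernel whose order is the real part. The integral of
    the norms is therefore evaluated by the same formula with a real order, which supplies the
    hypothesis of Fubini's theorem.\<close>
  have norm_h: "(LINT t|lborel. norm (h (y, t))) = norm (g y * rl_kernel \<nu> (s - y)) / (Re \<nu> - 1)" for y
  proof -
    have re: "Re (complex_of_real (Re \<nu> - 1)) > 0" using \<nu> by simp
    have *: "complex_of_real (norm (rl_kernel \<xi> u)) = rl_kernel (of_real (Re \<xi>)) u" for \<xi> u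
      unfolding norm_rl_kernel using powr_of_real[of u "Re \<xi> - 1"] by (simp add: rl_kernel_def)
    have "complex_of_real (LINT t|lborel. norm (h (y, t))) =
          (LINT t|lborel. complex_of_real (norm (h (y, t))))"
      by (rule integral_complex_of_real[symmetric])
    also have "\<dots> = (LINT t|lborel. of_real (norm (g y)) * (indicator {..<s} t *\<^sub>R rl_kernel (of_real (Re \<nu> - 1)) (t - y)))"
      unfolding h_def using *[of "\<nu> - 1"]
      by (intro Bochner_Integration.integral_cong) (auto simp: norm_mult indicator_def)
    also have "\<dots> = of_real (norm (g y)) * (rl_kernel (of_real (Re \<nu> - 1) + 1) (s - y) / of_real (Re \<nu> - 1))"
      by (simp only: integral_mult_right_zero integral_rl_kernel_shift(2)[OF re])
    also have "rl_kernel (of_real (Re \<nu> - 1) + 1) (s - y) = of_real (norm (rl_kernel \<nu> (s - y)))"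
      using *[of \<nu> "s - y"] by simp
    also have "of_real (norm (g y)) * (of_real (norm (rl_kernel \<nu> (s - y))) / of_real (Re \<nu> - 1))
        = complex_of_real (norm (g y * rl_kernel \<nu> (s - y)) / (Re \<nu> - 1))"
      by (simp add: norm_mult)
    finally show ?thesis unfolding of_real_eq_iff .
  qed
  have h: "integrable (lborel \<Otimes>\<^sub>M lborel) h"
  proof (rule lborel_pair.Fubini_integrable)
    show "integrable lborel (\<lambda>y. LINT t|lborel. norm (h (y, t)))"
      unfolding norm_h using s \<nu> by (intro integrable_divide integrable_norm rl_conv_integrable) auto
  qed (auto intro: hint)
  have inner: "(LINT y|lborel. h (y, t)) = indicator {..<s} t *\<^sub>R rl_conv (\<nu> - 1) g t" for t
    by (auto simp: h_def rl_conv_def indicator_def)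
  have h': "integrable (lborel \<Otimes>\<^sub>M lborel) (\<lambda>(y, t). h (y, t))" using h by simp
  show "integrable lborel (\<lambda>t. indicator {..<s} t *\<^sub>R rl_conv (\<nu> - 1) g t)"
    using lborel_pair.integrable_snd[OF h'] by (simp add: inner)
  have "(LINT t|lborel. indicator {..<s} t *\<^sub>R rl_conv (\<nu> - 1) g t) = (LINT t|lborel. LINT y|lborel. h (y, t))"
    by (simp add: inner)
  also have "\<dots> = (LINT y|lborel. LINT t|lborel. h (y, t))"
    using lborel_pair.Fubini_integral[OF h'] by simp
  also have "\<dots> = (LINT y|lborel. g y * (rl_kernel \<nu> (s - y) / (\<nu> - 1)))"
    unfolding h_def prod.case integral_mult_right_zero integral_rl_kernel_shift(2)[OF \<nu>'] by simp
  also have "\<dots> = rl_conv \<nu> g s / (\<nu> - 1)"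
    by (simp add: rl_conv_def)
  finally show "rl_conv \<nu> g s = (\<nu> - 1) * (LINT t|lborel. indicator {..<s} t *\<^sub>R rl_conv (\<nu> - 1) g t)"
    using \<nu> by auto
qed

text \<open>Subtracting the primitive formula at a point l < s leaves an integral over the compact
  interval [l, t], on which the integrand is continuous, so the fundamental theorem of calculus
  applies at s.\<close>

lemma rl_conv_derivative:
  assumes s: "s \<in> {p<..<b}" and \<nu>: "1 < Re \<nu>" "Re \<nu> - 1 \<le> M"
  shows "(rl_conv \<nu> g has_vector_derivative (\<nu> - 1) * rl_conv (\<nu> - 1) g s) (at s)"
proof -
  define l where "l = (p + s) / 2"
  define r where "r = (s + b) / 2"
  define K where "K = rl_conv (\<nu> - 1) g"
  have lr: "p < l" "l < s" "s < r" "r < b" using s by (auto simp: l_def r_def)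
  have K: "continuous_on {l..r} K"
    unfolding K_def using lr \<nu> M_nonneg by (intro rl_conv_continuous) auto
  have eq: "rl_conv \<nu> g t = rl_conv \<nu> g l + (\<nu> - 1) * integral {l..t} K" if t: "t \<in> {l..r}" for t
  proof -
    have il: "integrable lborel (\<lambda>t. indicator {..<l} t *\<^sub>R K t)"
      unfolding K_def using lr \<nu> by (intro rl_conv_primitive) auto
    have it: "integrable lborel (\<lambda>u. indicator {..<t} u *\<^sub>R K u)"
      unfolding K_def using lr \<nu> t by (intro rl_conv_primitive) auto
    have si: "set_integrable lborel {l..t} K"
      using continuous_on_subset[OF K, of "{l..t}"] t by (intro borel_integrable_atLeastAtMost') auto
    have "(LINT u|lborel. indicator {..<t} u *\<^sub>R K u) =
        (LINT u|lborel. indicator {..<l} u *\<^sub>R K u + indicator {l..t} u *\<^sub>R K u)"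
    proof (rule integral_cong_AE)
      show "AE u in lborel. indicator {..<t} u *\<^sub>R K u = indicator {..<l} u *\<^sub>R K u + indicator {l..t} u *\<^sub>R K u"
        using AE_lborel_singleton[of t] by eventually_elim (use t in \<open>auto simp: indicator_def\<close>)
    qed (use it il si in \<open>auto simp: set_integrable_def\<close>)
    also have "\<dots> = (LINT u|lborel. indicator {..<l} u *\<^sub>R K u) + (LINT u:{l..t}|lborel. K u)"
      using il si by (simp add: set_integrable_def set_lebesgue_integral_def)
    also have "(LINT u:{l..t}|lborel. K u) = integral {l..t} K"
      using si by (rule set_borel_integral_eq_integral)
    finally have "(\<nu> - 1) * (LINT u|lborel. indicator {..<t} u *\<^sub>R K u) =
       (\<nu> - 1) * (LINT u|lborel. indicator {..<l} u *\<^sub>R K u) + (\<nu> - 1) * integral {l..t} K"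
      by (simp add: ring_distribs)
    then show ?thesis
      using rl_conv_primitive(2)[of t \<nu>] rl_conv_primitive(2)[of l \<nu>] lr t \<nu> by (simp add: K_def)
  qed
  have "((\<lambda>t. integral {l..t} K) has_vector_derivative K s) (at s within {l..r})"
    using lr by (intro integral_has_vector_derivative K) auto
  then have "((\<lambda>t. integral {l..t} K) has_vector_derivative K s) (at s)"
    using lr by (simp add: at_within_Icc_at)
  then have "((\<lambda>t. rl_conv \<nu> g l + (\<nu> - 1) * integral {l..t} K) has_vector_derivative (\<nu> - 1) * K s) (at s)"
    by (auto intro!: derivative_eq_intros)
  then have "(rl_conv \<nu> g has_vector_derivative (\<nu> - 1) * K s) (at s)"

    by (rule has_vector_derivative_transform_within_open[of _ _ _ "{l<..<r}"])
       (use lr in \<open>auto simp: eq[symmetric]\<close>)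
  then show ?thesis by (simp only: K_def)
qed

end

section \<open>Intervals with an extended real base point, and reflection of the line\<close>

lemma in_interval_between:
  "y \<in> interval_between x0 x \<longleftrightarrow> (x0 < ereal y \<and> y < x) \<or> (x < y \<and> ereal y < x0)"
  by (cases x0) (auto simp: interval_between_def einterval_iff min_def max_def)

lemma open_interval_between [simp, measurable]:
  "open (interval_between x0 x)" "interval_between x0 x \<in> sets borel"
  by (simp_all add: interval_between_def)

lemma interval_between_reflect:
  "- y \<in> interval_between (- x0) (- x) \<longleftrightarrow> y \<in> interval_between x0 x"
  by (cases x0) (auto simp: in_interval_between)

lemma interval_between_reflect':
  "y \<in> interval_between (- x0) (- x) \<longleftrightarrow> - y \<in> interval_between x0 x"
  using interval_between_reflect[of "-y"] by simp

lemma set_integrable_reflect_interval_between: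
  fixes h :: "real \<Rightarrow> 'a::{banach, second_countable_topology}"
  assumes "set_integrable lborel (interval_between x0 x) h"
  shows "set_integrable lborel (interval_between (- x0) (- x)) (\<lambda>y. h (- y))"
  using lborel_integrable_real_affine[OF assms[unfolded set_integrable_def], of "-1" 0]
  by (simp add: set_integrable_def indicator_def interval_between_reflect')

lemma set_integral_reflect_interval_between:
  fixes h :: "real \<Rightarrow> 'a::{banach, second_countable_topology}"
  shows "(LINT y:interval_between (- x0) (- x)|lborel. h (- y)) = (LINT y:interval_between x0 x|lborel. h y)"
  unfolding set_lebesgue_integral_def
  by (subst (2) lborel_integral_real_affine[of "-1" _ 0]) (auto simp: indicator_def interval_between_reflect')

definition rl_int :: "ereal \<Rightarrow> complex \<Rightarrow> (real \<Rightarrow> complex) \<Rightarrow> real \<Rightarrow> complex" where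
  "rl_int x0 \<nu> g s = (LINT y:interval_between x0 s|lborel. g y * cpow \<bar>s - y\<bar> (\<nu> - 1))"

lemma rl_int_reflect: "rl_int (- x0) \<nu> (\<lambda>y. g (- y)) (- s) = rl_int x0 \<nu> g s"
  using set_integral_reflect_interval_between[of x0 s "\<lambda>y. g y * cpow \<bar>s - y\<bar> (\<nu> - 1)"]
  by (simp add: rl_int_def abs_minus_commute add.commute)

text \<open>Extend g by 0 outside (x0, x + e). For every s near x, on either side of x, the product
  with the cut-off kernel is then the integrand on (x0, s), so one function h on the whole line
  represents the integral in a neighbourhood of x.\<close>

lemma rl_int_as_conv:
  assumes J: "open J" "x \<in> J" "interval_between x0 x \<subseteq> J" and x0: "x0 < ereal x"
    and g: "continuous_on J g"
    and gi: "set_integrable lborel (interval_between x0 x) (\<lambda>y. (1 + \<bar>y\<bar>) powr M *\<^sub>R g y)"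
  obtains h p b where "p < x" "x < b" "x0 < ereal p" "h \<in> borel_measurable borel"
    "integrable lborel (\<lambda>y. (1 + \<bar>y\<bar>) powr M *\<^sub>R h y)" "continuous_on {p..b} h"
    "\<And>s y \<nu>. s \<in> {p<..<b} \<Longrightarrow> h y * rl_kernel \<nu> (s - y) =
        indicator (interval_between x0 s) y *\<^sub>R (g y * cpow \<bar>s - y\<bar> (\<nu> - 1))"
proof -
  obtain e0 where e0: "e0 > 0" "cball x e0 \<subseteq> J" using J open_contains_cball by blast
  obtain z where z: "x0 < ereal z" "z < x" using ereal_dense2[OF x0] by auto
  \<comment> \<open>Small enough for [x - e, x + e] to lie in J and for x - e \<ge> z to stay above
    x0. The radius e / 2 used below keeps the closed interval inside the set where h = g.\<close>
  define e where "e = min e0 (x - z)"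
  have e: "e > 0" "{x-e..x+e} \<subseteq> J" "x0 < ereal (x - e)"
  proof -
    show "e > 0" using e0 z by (simp add: e_def)
    show "{x-e..x+e} \<subseteq> J" using e0 by (auto simp: e_def subset_iff cball_def dist_real_def)
    have "ereal z \<le> ereal (x - e)" by (simp add: e_def)
    then show "x0 < ereal (x - e)" using z by (metis less_le_trans)
  qed
  define S where "S = {y. x0 < ereal y \<and> y < x + e}"
  have S_eq: "S = einterval x0 (ereal (x + e))" by (auto simp: S_def einterval_iff)
  have [measurable]: "S \<in> sets borel" by (simp add: S_eq)
  have SJ: "S \<subseteq> J"
  proof
    fix y assume "y \<in> S"
    then show "y \<in> J" using e J(3) by (cases "y < x") (auto simp: S_def in_interval_between)
  qed
  define h where "h = (\<lambda>y. indicator S y *\<^sub>R g y)"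
  have hm: "h \<in> borel_measurable borel"
    unfolding h_def using continuous_on_subset[OF g SJ]
    by (intro borel_measurable_continuous_on_indicator) auto
  have inS: "s \<in> {x - e..<x+e} \<Longrightarrow> s \<in> S" for s
    using e by (auto simp: S_def intro: less_le_trans)
  show ?thesis
  proof (rule that[of "x - e/2" "x + e/2" h])
    have "ereal (x - e) \<le> ereal (x - e/2)" using e by simp
    then show "x0 < ereal (x - e/2)" using e by (metis less_le_trans)
    show "integrable lborel (\<lambda>y. (1 + \<bar>y\<bar>) powr M *\<^sub>R h y)"
    proof (rule Bochner_Integration.integrable_bound)
      have c: "continuous_on {x..x+e} (\<lambda>y. (1 + \<bar>y\<bar>) powr M *\<^sub>R g y)"
        using e by (intro continuous_intros continuous_on_subset[OF g]) auto
      show "integrable lborel (\<lambda>y. norm (indicator (interval_between x0 x) y *\<^sub>R ((1 + \<bar>y\<bar>) powr M *\<^sub>R g y))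
            + norm (indicator {x..x+e} y *\<^sub>R ((1 + \<bar>y\<bar>) powr M *\<^sub>R g y)))"
        using gi borel_integrable_atLeastAtMost'[OF c]
        by (intro Bochner_Integration.integrable_add integrable_norm) (auto simp: set_integrable_def)
      show "AE y in lborel. norm ((1 + \<bar>y\<bar>) powr M *\<^sub>R h y) \<le>
          norm (norm (indicator (interval_between x0 x) y *\<^sub>R ((1 + \<bar>y\<bar>) powr M *\<^sub>R g y))
            + norm (indicator {x..x+e} y *\<^sub>R ((1 + \<bar>y\<bar>) powr M *\<^sub>R g y)))"
        by (auto simp: h_def S_def indicator_def in_interval_between)
    qed (use hm in measurable)
    have "continuous_on {x-e/2..x+e/2} g"
      using e by (intro continuous_on_subset[OF g]) auto
    then show "continuous_on {x-e/2..x+e/2} h"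
      by (rule continuous_on_cong[THEN iffD1, rotated -1]) (use e in \<open>auto simp: h_def inS\<close>)
    fix s y \<nu> assume s: "s \<in> {x-e/2<..<x+e/2}"
    then have "x0 < ereal s" using inS[of s] e by (auto simp: S_def)
    then have "y \<in> interval_between x0 s \<longleftrightarrow> y \<in> S \<and> y < s"
      using s e by (auto simp: in_interval_between S_def dest: less_trans)
    then show "h y * rl_kernel \<nu> (s - y) =
        indicator (interval_between x0 s) y *\<^sub>R (g y * cpow \<bar>s - y\<bar> (\<nu> - 1))"
      by (auto simp: h_def rl_kernel_def indicator_def)
  qed (use e hm in auto)
qed

lemma rl_int_right:
  assumes J: "open J" "x \<in> J" "interval_between x0 x \<subseteq> J" and x0: "x0 < ereal x"
    and g: "continuous_on J g"
    and gi: "set_integrable lborel (interval_between x0 x) (\<lambda>y. (1 + \<bar>y\<bar>) powr M *\<^sub>R g y)"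
    and M: "0 \<le> M" "Re \<nu> - 1 \<le> M"
  shows "0 < Re \<nu> \<Longrightarrow> set_integrable lborel (interval_between x0 x) (\<lambda>y. g y * cpow \<bar>x - y\<bar> (\<nu> - 1))"
    and "1 < Re \<nu> \<Longrightarrow> (rl_int x0 \<nu> g has_vector_derivative (\<nu> - 1) * rl_int x0 (\<nu> - 1) g x) (at x)"
proof -
  obtain h p b where h: "p < x" "x < b" "x0 < ereal p" "h \<in> borel_measurable borel"
    "integrable lborel (\<lambda>y. (1 + \<bar>y\<bar>) powr M *\<^sub>R h y)" "continuous_on {p..b} h"
    and eq: "\<And>s y \<nu>. s \<in> {p<..<b} \<Longrightarrow> h y * rl_kernel \<nu> (s - y) =
        indicator (interval_between x0 s) y *\<^sub>R (g y * cpow \<bar>s - y\<bar> (\<nu> - 1))"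
    by (rule rl_int_as_conv[OF J x0 g gi], rule that)
  have conv: "rl_conv \<xi> h s = rl_int x0 \<xi> g s" if "s \<in> {p<..<b}" for s \<xi>
    by (simp only: rl_conv_def rl_int_def set_lebesgue_integral_def eq[OF that])
  show "set_integrable lborel (interval_between x0 x) (\<lambda>y. g y * cpow \<bar>x - y\<bar> (\<nu> - 1))" if "0 < Re \<nu>"
    using rl_conv_integrable[OF h(4-6) M(1), of x \<nu>] h(1,2) that M(2)
    by (simp add: set_integrable_def eq)
  show "(rl_int x0 \<nu> g has_vector_derivative (\<nu> - 1) * rl_int x0 (\<nu> - 1) g x) (at x)" if "1 < Re \<nu>"
  proof -
    have "(rl_conv \<nu> h has_vector_derivative (\<nu> - 1) * rl_conv (\<nu> - 1) h x) (at x)"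
      using rl_conv_derivative[OF h(4-6) M(1), of x \<nu>] h(1,2) that M(2) by simp
    then have "(rl_int x0 \<nu> g has_vector_derivative (\<nu> - 1) * rl_conv (\<nu> - 1) h x) (at x)"
      by (rule has_vector_derivative_transform_within_open[of _ _ _ "{p<..<b}"]) (use h conv in auto)
    then show ?thesis using conv h by simp
  qed
qed

text \<open>For x0 above x reflect by y -> -y, which preserves the even weight 1 + |y|. The chain
  rule produces the factor -1.\<close>

lemma
  assumes J: "open J" "x \<in> J" "interval_between x0 x \<subseteq> J" and x0: "x0 \<noteq> ereal x"
    and g: "continuous_on J g"
    and gi: "set_integrable lborel (interval_between x0 x) (\<lambda>y. (1 + \<bar>y\<bar>) powr M *\<^sub>R g y)"
    and M: "0 \<le> M" "Re \<nu> - 1 \<le> M"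
  shows rl_int_integrable:
      "0 < Re \<nu> \<Longrightarrow> set_integrable lborel (interval_between x0 x) (\<lambda>y. g y * cpow \<bar>x - y\<bar> (\<nu> - 1))"
    and rl_int_derivative:
      "1 < Re \<nu> \<Longrightarrow> (rl_int x0 \<nu> g has_vector_derivative
         (if x0 < ereal x then 1 else - 1) * ((\<nu> - 1) * rl_int x0 (\<nu> - 1) g x)) (at x)"
proof -
  have "(0 < Re \<nu> \<longrightarrow> set_integrable lborel (interval_between x0 x) (\<lambda>y. g y * cpow \<bar>x - y\<bar> (\<nu> - 1)))
    \<and> (1 < Re \<nu> \<longrightarrow> (rl_int x0 \<nu> g has_vector_derivative
         (if x0 < ereal x then 1 else - 1) * ((\<nu> - 1) * rl_int x0 (\<nu> - 1) g x)) (at x))"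
  proof (cases "x0 < ereal x")
    case True
    then show ?thesis using rl_int_right[OF J True g gi M] by simp
  next
    case False
    define gr where "gr = (\<lambda>y. g (- y))"
    have J': "open (uminus ` J)" "- x \<in> uminus ` J" "interval_between (- x0) (- x) \<subseteq> uminus ` J"
    proof -
      show "open (uminus ` J)" using J(1) by (rule open_negations)
      show "- x \<in> uminus ` J" using J(2) by simp
      show "interval_between (- x0) (- x) \<subseteq> uminus ` J"
      proof
        fix y assume "y \<in> interval_between (- x0) (- x)"
        then have "- y \<in> J" using J(3) by (auto simp: interval_between_reflect')
        then show "y \<in> uminus ` J" by (metis image_eqI minus_minus)
      qed
    qed
    have x0': "- x0 < ereal (- x)" using False x0 by (cases x0) auto
    have g': "continuous_on (uminus ` J) gr"
      unfolding gr_def by (rule continuous_on_compose2[OF g]) (auto intro!: continuous_intros)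
    have gi': "set_integrable lborel (interval_between (- x0) (- x)) (\<lambda>y. (1 + \<bar>y\<bar>) powr M *\<^sub>R gr y)"
      using set_integrable_reflect_interval_between[OF gi] by (simp add: gr_def)
    note R = rl_int_right[OF J' x0' g' gi' M]
    have "set_integrable lborel (interval_between x0 x) (\<lambda>y. g y * cpow \<bar>x - y\<bar> (\<nu> - 1))" if "0 < Re \<nu>"
      using set_integrable_reflect_interval_between[OF R(1)[OF that]]
      by (simp add: gr_def abs_minus_commute add.commute)
    moreover have "(rl_int x0 \<nu> g has_vector_derivative (- 1) * ((\<nu> - 1) * rl_int x0 (\<nu> - 1) g x)) (at x)"
      if "1 < Re \<nu>"
    proof -
      have eq: "rl_int (- x0) \<xi> gr (- s) = rl_int x0 \<xi> g s" for \<xi> s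
        unfolding gr_def by (rule rl_int_reflect)
      have "((\<lambda>s. rl_int (- x0) \<nu> gr (- s)) has_vector_derivative (- 1) *\<^sub>R ((\<nu> - 1) * rl_int (- x0) (\<nu> - 1) gr (- x))) (at x)"
        using vector_diff_chain_at[of uminus "- 1" x, OF _ R(2)[OF that]]
        by (simp add: o_def has_vector_derivative_minus[OF has_vector_derivative_id, simplified])
      then show ?thesis by (simp add: eq)
    qed
    ultimately show ?thesis using False by simp
  qed
  then show "0 < Re \<nu> \<Longrightarrow> set_integrable lborel (interval_between x0 x) (\<lambda>y. g y * cpow \<bar>x - y\<bar> (\<nu> - 1))"
    "1 < Re \<nu> \<Longrightarrow> (rl_int x0 \<nu> g has_vector_derivative
         (if x0 < ereal x then 1 else - 1) * ((\<nu> - 1) * rl_int x0 (\<nu> - 1) g x)) (at x)"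
    by blast+
qed

section \<open>Vanishing of boundary terms\<close>

lemma set_borel_measurable_continuous:
  fixes h :: "real \<Rightarrow> 'a::real_normed_vector"
  assumes "S \<in> sets borel" "continuous_on S h"
  shows "set_borel_measurable lborel S h"
  using borel_measurable_continuous_on_indicator[OF assms] by (simp add: set_borel_measurable_def)

text \<open>Let S be the integral. Integration from t to x, where B tends to 0, shows that S + B t
  is the integral of B' over (x0, t), which is small for t near x0. If S were nonzero, |B| would
  stay above |S| / 2 near x0, and 1 / l would be dominated there by a multiple of |B / l|.\<close>

lemma integral_derivative_eq_0_right:
  fixes B B' :: "real \<Rightarrow> complex" and l :: "real \<Rightarrow> real" and x0 :: ereal and x :: real
  defines "I \<equiv> interval_between x0 x"
  assumes x0: "x0 < ereal x"
    and B: "\<And>y. y \<in> I \<Longrightarrow> (B has_vector_derivative B' y) (at y)"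
    and B'_cont: "continuous_on I B'"
    and B'_int: "set_integrable lborel I B'"
    and B_lim: "(B \<longlongrightarrow> 0) (at x within I)"
    and l: "continuous_on I l" "\<And>y. y \<in> I \<Longrightarrow> l y > 0"
    and Bl: "set_integrable lborel I (\<lambda>y. B y / l y)"
    and non_int: "\<And>t. t \<in> I \<Longrightarrow> \<not> set_integrable lborel (interval_between x0 t) (\<lambda>y. 1 / l y)"
  shows "(LINT y:I|lborel. B' y) = 0"
proof (rule ccontr)
  define S where "S = (LINT y:I|lborel. B' y)"
  assume "\<not> ?thesis"
  then have S: "norm S > 0" by (simp add: S_def)
  have I_iff: "y \<in> I \<longleftrightarrow> x0 < ereal y \<and> y < x" for y
    using x0 by (cases x0) (auto simp: I_def in_interval_between)
  have [simp]: "open I" and [measurable]: "I \<in> sets borel" by (simp_all add: I_def)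
  have sub: "interval_between x0 t \<subseteq> I" if "t \<in> I" for t
    using that by (cases x0) (auto simp: I_iff in_interval_between)
  have tail: "(LINT y:interval_between x0 t|lborel. B' y) = S + B t" if t: "t \<in> I" for t
  proof -
    have t': "x0 < ereal t" "t < x" using t by (simp_all add: I_iff)
    have sub2: "einterval t x \<subseteq> I"
      using t' by (cases x0) (auto simp: einterval_iff I_iff)
    have lim: "(B \<longlongrightarrow> 0) (at_left x)"
    proof -
      have "I \<inter> {t<..} - {x} = {..<x} \<inter> {t<..} - {x}" using t' by (cases x0) (auto simp: I_iff)
      then have "at x within I = at_left x" using t' by (intro at_within_nhd[of x "{t<..}"]) auto
      then show ?thesis using B_lim by simp
    qed
    have int2: "set_integrable lborel (einterval t x) B'"
      using B'_int by (rule set_integrable_subset) (use sub2 in auto)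
    have "(LBINT y=t..x. B' y) = 0 - B t"
    proof (rule interval_integral_FTC_integrable)
      fix y assume "ereal t < ereal y" "ereal y < ereal x"
      then have "y \<in> I" using sub2 by (auto simp: einterval_iff)
      then show "(B has_vector_derivative B' y) (at y)" "isCont B' y"
        using B B'_cont by (auto simp: continuous_on_eq_continuous_at)
    next
      have "isCont B t" using B[OF t] has_vector_derivative_continuous by blast
      then have "(B \<longlongrightarrow> B t) (at_right t)" by (simp add: continuous_at_imp_continuous_at_within continuous_within[symmetric])
      then show "((B \<circ> real_of_ereal) \<longlongrightarrow> B t) (at_right (ereal t))"
        by (simp add: ereal_tendsto_simps)
      show "((B \<circ> real_of_ereal) \<longlongrightarrow> 0) (at_left (ereal x))"
        using lim by (simp add: ereal_tendsto_simps)
    qed (use t' int2 in auto)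
    then have eq2: "(LINT y:einterval t x|lborel. B' y) = - B t"
      using t' by (simp add: interval_lebesgue_integral_def)
    have "(LINT y:interval_between x0 t \<union> einterval t x|lborel. B' y) =
        (LINT y:interval_between x0 t|lborel. B' y) + (LINT y:einterval t x|lborel. B' y)"
    proof (intro set_integral_Un set_integrable_subset[OF B'_int] int2)
      show "interval_between x0 t \<inter> einterval t x = {}"
        using t' by (cases x0) (auto simp: einterval_iff in_interval_between)
    qed (use sub[OF t] sub2 in auto)
    moreover have "(LINT y:interval_between x0 t \<union> einterval t x|lborel. B' y) = S"
      unfolding S_def set_lebesgue_integral_def
    proof (rule integral_cong_AE)
      show "AE y in lborel. indicator (interval_between x0 t \<union> einterval t x) y *\<^sub>R B' y = indicator I y *\<^sub>R B' y"
        using AE_lborel_singleton[of t]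
      proof eventually_elim
        case (elim y)
        then have "y \<in> interval_between x0 t \<union> einterval t x \<longleftrightarrow> y \<in> I"
          using t' by (cases x0) (auto simp: einterval_iff in_interval_between I_iff)
        then show ?case by (simp only: indicator_def)
      qed
      have 1: "set_integrable lborel (interval_between x0 t \<union> einterval t x) B'"
        using B'_int by (rule set_integrable_subset) (use sub2 sub[OF t] in auto)
      show "(\<lambda>y. indicator (interval_between x0 t \<union> einterval t x) y *\<^sub>R B' y) \<in> borel_measurable lborel"
        using 1 unfolding set_integrable_def by (rule borel_measurable_integrable)
      show "(\<lambda>y. indicator I y *\<^sub>R B' y) \<in> borel_measurable lborel"
        using B'_int unfolding set_integrable_def by (rule borel_measurable_integrable)
    qed
    ultimately show ?thesis using eq2 by (simp add: algebra_simps)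
  qed
  obtain u t :: "nat \<Rightarrow> real" where approx: "decseq t" "\<And>i. t i < u i" "\<And>i. x0 < ereal (t i)"
      "\<And>i. ereal (u i) < ereal x" "(\<lambda>i. ereal (t i)) \<longlonglongrightarrow> x0"
    by (rule einterval_Icc_approximation[OF x0]) blast
  have tI: "t n \<in> I" for n using approx(2-4)[of n] by (simp add: I_iff)
  have B'_norm: "set_integrable lborel I (\<lambda>y. norm (B' y))"
    using B'_int by (rule set_integrable_norm)
  \<comment> \<open>Absolute continuity of the integral, for a finite or infinite x0 alike: the
    intervals (x0, t n) shrink to the empty set, so their indicators tend to 0 pointwise.\<close>
  have "(\<lambda>n. LINT y|lborel. indicator (interval_between x0 (t n)) y *\<^sub>R norm (B' y)) \<longlonglongrightarrow> (LINT y|(lborel :: real measure). (0::real))"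
  proof (rule integral_dominated_convergence[where w = "\<lambda>y. indicator I y *\<^sub>R norm (B' y)"])
    show "integrable lborel (\<lambda>y. indicator I y *\<^sub>R norm (B' y))" using B'_norm by (simp add: set_integrable_def)
    show "AE y in lborel. norm (indicator (interval_between x0 (t n)) y *\<^sub>R norm (B' y)) \<le> indicator I y *\<^sub>R norm (B' y)" for n
      using sub[OF tI[of n]] by (auto simp: indicator_def)
    show "AE y in lborel. (\<lambda>n. indicator (interval_between x0 (t n)) y *\<^sub>R norm (B' y)) \<longlonglongrightarrow> 0"
    proof (rule AE_I2)
      fix y
      show "(\<lambda>n. indicator (interval_between x0 (t n)) y *\<^sub>R norm (B' y)) \<longlonglongrightarrow> 0"
      proof (cases "x0 < ereal y")
        case True
        have "\<forall>\<^sub>F n in sequentially. ereal (t n) < ereal y"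
          using approx(5) True by (rule order_tendstoD(2))
        then have "\<forall>\<^sub>F n in sequentially. indicator (interval_between x0 (t n)) y *\<^sub>R norm (B' y) = 0"
          by eventually_elim (use True in \<open>auto simp: indicator_def in_interval_between\<close>)
        then show ?thesis by (rule tendsto_eventually)
      next
        case False
        then have "y \<notin> interval_between x0 (t n)" for n
          using sub[OF tI[of n]] by (auto simp: I_iff)
        then show ?thesis by simp
      qed
    qed
    have "set_integrable lborel (interval_between x0 (t n)) (\<lambda>y. norm (B' y))" for n
      using B'_norm by (rule set_integrable_subset) (use sub[OF tI[of n]] in auto)
    then show "(\<lambda>y. indicator (interval_between x0 (t n)) y *\<^sub>R norm (B' y)) \<in> borel_measurable lborel" for n
      unfolding set_integrable_def by (rule borel_measurable_integrable)
  qed simp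
  then have "\<forall>\<^sub>F n in sequentially. (LINT y|lborel. indicator (interval_between x0 (t n)) y *\<^sub>R norm (B' y)) < norm S / 2"
    by (rule order_tendstoD) (use S in auto)
  then obtain n where n: "(LINT y:interval_between x0 (t n)|lborel. norm (B' y)) < norm S / 2"
    unfolding set_lebesgue_integral_def using eventually_happens by fastforce
  define t0 where "t0 = t n"
  have t0: "t0 \<in> I" using tI by (simp add: t0_def)
  have B_ge: "norm S / 2 \<le> norm (B y)" if y: "y \<in> interval_between x0 t0" for y
  proof -
    have yI: "y \<in> I" using y sub[OF t0] by auto
    have yt: "y < t0" using y yI t0 by (auto simp: in_interval_between I_iff)
    have "norm (S + B y) = norm (LINT u:interval_between x0 y|lborel. B' u)" using tail[OF yI] by simp
    also have "\<dots> \<le> (LINT u:interval_between x0 y|lborel. norm (B' u))"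
      using sub[OF yI] by (intro set_integral_norm_bound set_integrable_subset[OF B'_int]) auto
    also have "\<dots> \<le> (LINT u:interval_between x0 t0|lborel. norm (B' u))"
      unfolding set_lebesgue_integral_def
    proof (rule integral_mono)
      show "integrable lborel (\<lambda>u. indicator (interval_between x0 t0) u *\<^sub>R norm (B' u))"
        using set_integrable_subset[OF B'_norm _ sub[OF t0]] by (simp add: set_integrable_def)
      show "integrable lborel (\<lambda>u. indicator (interval_between x0 y) u *\<^sub>R norm (B' u))"
        using set_integrable_subset[OF B'_norm _ sub[OF yI]] by (simp add: set_integrable_def)
      have "interval_between x0 y \<subseteq> interval_between x0 t0"
        using yI yt by (cases x0) (auto simp: in_interval_between I_iff)
      then show "indicator (interval_between x0 y) u *\<^sub>R norm (B' u) \<le> indicator (interval_between x0 t0) u *\<^sub>R norm (B' u)" for u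
        by (auto simp: indicator_def)
    qed
    also have "\<dots> < norm S / 2" using n by (simp add: t0_def)
    finally have "norm (S + B y) < norm S / 2" .
    moreover have "norm S \<le> norm (S + B y) + norm (B y)"
      using norm_triangle_ineq4[of "S + B y" "B y"] by simp
    ultimately show ?thesis by linarith
  qed
  have "set_integrable lborel (interval_between x0 t0) (\<lambda>y. 1 / l y)"
  proof (rule set_integrable_bound)
    have "set_integrable lborel (interval_between x0 t0) (\<lambda>y. B y / l y)"
      using Bl by (rule set_integrable_subset) (use sub[OF t0] in auto)
    then show "set_integrable lborel (interval_between x0 t0) (\<lambda>y. of_real (2 / norm S) * (B y / l y))"
      by (intro set_integrable_mult_right) auto
    have "continuous_on (interval_between x0 t0) (\<lambda>y. 1 / l y)"
      using l sub[OF t0] by (intro continuous_intros continuous_on_subset[OF l(1)]) force+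
    then show "set_borel_measurable lborel (interval_between x0 t0) (\<lambda>y. 1 / l y)"
      by (intro set_borel_measurable_continuous) auto
    show "AE y in lborel. y \<in> interval_between x0 t0 \<longrightarrow> norm (1 / l y) \<le> norm (of_real (2 / norm S) * (B y / l y))"
    proof (intro AE_I2 impI)
      fix y assume y: "y \<in> interval_between x0 t0"
      then have lp: "l y > 0" using l(2) sub[OF t0] by auto
      show "norm (1 / l y) \<le> norm (of_real (2 / norm S) * (B y / l y))"
        using B_ge[OF y] lp S by (simp add: norm_mult norm_divide field_simps)
    qed
  qed
  then show False using non_int[OF t0] by blast
qed

lemma integral_derivative_eq_0:
  fixes B B' :: "real \<Rightarrow> complex" and l :: "real \<Rightarrow> real" and x0 :: ereal and x :: real
  defines "I \<equiv> interval_between x0 x"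
  assumes x0: "x0 \<noteq> ereal x"
    and B: "\<And>y. y \<in> I \<Longrightarrow> (B has_vector_derivative B' y) (at y)"
    and B'_cont: "continuous_on I B'"
    and B'_int: "set_integrable lborel I B'"
    and B_lim: "(B \<longlongrightarrow> 0) (at x within I)"
    and l: "continuous_on I l" "\<And>y. y \<in> I \<Longrightarrow> l y > 0"
    and Bl: "set_integrable lborel I (\<lambda>y. B y / l y)"
    and non_int: "\<And>t. t \<in> I \<Longrightarrow> \<not> set_integrable lborel (interval_between x0 t) (\<lambda>y. 1 / l y)"
  shows "(LINT y:I|lborel. B' y) = 0"
proof (cases "x0 < ereal x")
  case True
  then show ?thesis using integral_derivative_eq_0_right[of x0 x B B' l] assms by blast
next
  case False
  let ?I = "interval_between (- x0) (- x)"
  have neg: "- y \<in> I \<longleftrightarrow> y \<in> ?I" for y by (simp add: I_def interval_between_reflect')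
  have "(LINT y:?I|lborel. - B' (- y)) = 0"
  proof (rule integral_derivative_eq_0_right[where B = "\<lambda>y. B (- y)" and l = "\<lambda>y. l (- y)"])
    show "- x0 < ereal (- x)" using False x0 by (cases x0) auto
    show "((\<lambda>y. B (- y)) has_vector_derivative - B' (- y)) (at y)" if "y \<in> ?I" for y
      using vector_diff_chain_at[of uminus "- 1" y, OF _ B[of "- y"]] that
      by (simp add: o_def has_vector_derivative_minus[OF has_vector_derivative_id, simplified] neg)
    show "continuous_on ?I (\<lambda>y. - B' (- y))"
      by (intro continuous_intros continuous_on_compose2[OF B'_cont]) (auto simp: neg)
    show "continuous_on ?I (\<lambda>y. l (- y))"
      by (intro continuous_intros continuous_on_compose2[OF l(1)]) (auto simp: neg)
    show "set_integrable lborel ?I (\<lambda>y. - B' (- y))"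
      using set_integrable_reflect_interval_between[OF B'_int[unfolded I_def]]
      by (auto simp: set_integrable_def)
    show "set_integrable lborel ?I (\<lambda>y. B (- y) / l (- y))"
      using set_integrable_reflect_interval_between[OF Bl[unfolded I_def]] .
    show "((\<lambda>y. B (- y)) \<longlongrightarrow> 0) (at (- x) within ?I)"
    proof (rule filterlim_compose[OF B_lim])
      show "filterlim uminus (at x within I) (at (- x) within ?I)"
        unfolding filterlim_at eventually_at_filter
        by (auto intro!: tendsto_eq_intros always_eventually simp: neg)
    qed
    fix t assume t: "t \<in> ?I"
    show "\<not> set_integrable lborel (interval_between (- x0) t) (\<lambda>y. 1 / l (- y))"
    proof
      assume "set_integrable lborel (interval_between (- x0) t) (\<lambda>y. 1 / l (- y))"
      from set_integrable_reflect_interval_between[OF this]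
      show False using non_int[of "- t"] t by (simp add: neg)
    qed
  qed (use l neg in auto)
  then have "(LINT y:?I|lborel. B' (- y)) = 0"
    by (simp add: set_lebesgue_integral_def)
  then show ?thesis unfolding I_def using set_integral_reflect_interval_between[of x0 x B'] by simp
qed

text \<open>Serves to refute integrability: the integral of a nonnegative derivative bounds every
  increment of its primitive, which is absurd for a primitive as unbounded as the logarithm.\<close>

lemma derivative_integrable_imp_bounded_diff:
  fixes F d :: "real \<Rightarrow> real"
  assumes "\<And>y. y \<in> S \<Longrightarrow> (F has_real_derivative d y) (at y)"
    and "continuous_on S d" "\<And>y. y \<in> S \<Longrightarrow> 0 \<le> d y" "set_integrable lborel S d"
    and "{u..v} \<subseteq> S" "u \<le> v"
  shows "F v - F u \<le> (LINT y:S|lborel. d y)"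
proof -
  have "(LINT y:{u..v}|lborel. d y) = F v - F u"
    unfolding set_lebesgue_integral_def
  proof (rule integral_FTC_atLeastAtMost[OF assms(6)])
    show "continuous_on {u..v} d" by (rule continuous_on_subset[OF assms(2,5)])
    fix y assume "u \<le> y" "y \<le> v"
    then have "y \<in> S" using assms(5) by auto
    from assms(1)[OF this] show "(F has_vector_derivative d y) (at y within {u..v})"
      unfolding has_real_derivative_iff_has_vector_derivative by (rule has_vector_derivative_at_within)
  qed
  moreover have "(LINT y:{u..v}|lborel. d y) \<le> (LINT y:S|lborel. d y)"
    unfolding set_lebesgue_integral_def
  proof (rule integral_mono)
    show "integrable lborel (\<lambda>x. indicator {u..v} x *\<^sub>R d x)"
      using set_integrable_subset[OF assms(4), of "{u..v}"] assms by (simp add: set_integrable_def)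
    show "integrable lborel (\<lambda>x. indicator S x *\<^sub>R d x)"
      using assms by (simp add: set_integrable_def)
    show "indicator {u..v} x *\<^sub>R d x \<le> indicator S x *\<^sub>R d x" for x
      using assms by (auto simp: indicator_def)
  qed
  ultimately show ?thesis by simp
qed

section \<open>Divergence of the integral of 1 / l at 0, at 1 and at minus infinity\<close>

lemma not_integrable_inverse_at_0:
  assumes "t \<noteq> 0"
  shows "\<not> set_integrable lborel (interval_between 0 t) (\<lambda>y. 1 / \<bar>y\<bar>)"
proof -
  have pos: "\<not> set_integrable lborel (interval_between 0 t) (\<lambda>y. 1 / \<bar>y\<bar>)" if t: "t > 0" for t
  proof
    assume A: "set_integrable lborel (interval_between 0 t) (\<lambda>y. 1 / \<bar>y\<bar>)"
    have I: "interval_between 0 t = {0<..<t}" using t by (auto simp: in_interval_between)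
    define Q where "Q = (LINT y:{0<..<t}|lborel. 1 / \<bar>y\<bar>)"
    \<comment> \<open>Chosen so that ln (t / 2) - ln u = |Q| + 1, which exceeds the supposed bound
      Q.\<close>
    define u where "u = t / 2 * exp (- (\<bar>Q\<bar> + 1))"
    have u: "0 < u" "u \<le> t / 2" using t by (auto simp: u_def)
    have "ln (t/2) - ln u \<le> Q"
      unfolding Q_def
    proof (rule derivative_integrable_imp_bounded_diff[where F = ln])
      show "continuous_on {0<..<t} (\<lambda>y. 1 / \<bar>y\<bar>)" by (intro continuous_intros) auto
      show "(ln has_real_derivative 1 / \<bar>y\<bar>) (at y)" if "y \<in> {0<..<t}" for y
        using that DERIV_ln_divide[of y] by simp
      show "set_integrable lborel {0<..<t} (\<lambda>y. 1 / \<bar>y\<bar>)" using A by (simp only: I)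
      show "{u..t/2} \<subseteq> {0<..<t}" using u t by auto
    qed (use u in auto)
    moreover have "ln u = ln (t/2) - (\<bar>Q\<bar> + 1)"
      unfolding u_def by (subst ln_mult_pos) (simp_all add: t del: ln_div)
    ultimately show False by linarith
  qed
  show ?thesis
  proof (cases "t > 0")
    case False
    show ?thesis
    proof
      assume "set_integrable lborel (interval_between 0 t) (\<lambda>y. 1 / \<bar>y\<bar>)"
      from set_integrable_reflect_interval_between[OF this] show False
        using pos[of "- t"] False assms by simp
    qed
  qed (rule pos)
qed

lemma not_integrable_inverse_at_1:
  assumes "t < 1"
  shows "\<not> set_integrable lborel (interval_between 1 t) (\<lambda>y. 1 / (1 - y))"
proof
  assume A: "set_integrable lborel (interval_between 1 t) (\<lambda>y. 1 / (1 - y))"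
  have I: "interval_between 1 t = {t<..<1}" using assms by (auto simp: in_interval_between one_ereal_def)
  define Q where "Q = (LINT y:{t<..<1}|lborel. 1 / (1 - y))"
  \<comment> \<open>The point 1 - h is the midpoint of (t, 1). The increment of -ln (1 - y) from 1 -
    h to 1 - u is ln h - ln u = |Q| + 1.\<close>
  define h where "h = (1 - t) / 2"
  define u where "u = h * exp (- (\<bar>Q\<bar> + 1))"
  have h: "h > 0" "t = 1 - 2 * h" using assms by (auto simp: h_def field_simps)
  have u: "0 < u" "u \<le> h" using h by (auto simp: u_def)
  have "- ln (1 - (1 - u)) - (- ln (1 - (1 - h))) \<le> Q"
    unfolding Q_def
  proof (rule derivative_integrable_imp_bounded_diff[where F = "\<lambda>y. - ln (1 - y)"])
    show "continuous_on {t<..<1} (\<lambda>y. 1 / (1 - y))" using assms by (intro continuous_intros) auto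
    show "((\<lambda>y. - ln (1 - y)) has_real_derivative 1 / (1 - y)) (at y)" if "y \<in> {t<..<1}" for y
      using that assms by (auto intro!: derivative_eq_intros)
    show "set_integrable lborel {t<..<1} (\<lambda>y. 1 / (1 - y))" using A by (simp only: I)
    show "{1 - h..1 - u} \<subseteq> {t<..<1}" using u h by auto
    show "1 - h \<le> 1 - u" using u by simp
  qed auto
  then have "ln h - ln u \<le> Q" by simp
  moreover have "ln u = ln h - (\<bar>Q\<bar> + 1)" unfolding u_def by (subst ln_mult_pos) (simp_all add: h(1))
  ultimately show False by linarith
qed

lemma not_integrable_inverse_at_minus_infinity:
  assumes "t < 1"
  shows "\<not> set_integrable lborel (interval_between (-\<infinity>) t) (\<lambda>y. 1 / (1 - y))"
proof
  assume A: "set_integrable lborel (interval_between (-\<infinity>) t) (\<lambda>y. 1 / (1 - y))"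
  have I: "interval_between (-\<infinity>) t = {..<t}" using assms by (auto simp: in_interval_between)
  define Q where "Q = (LINT y:{..<t}|lborel. 1 / (1 - y))"
  \<comment> \<open>Now 1 - h = t - 1 lies below t, and moving down to 1 - u changes the logarithm
    by ln u - ln h = |Q| + 1.\<close>
  define h where "h = 2 - t"
  define u where "u = h * exp (\<bar>Q\<bar> + 1)"
  have h: "h > 1" "t = 2 - h" using assms by (auto simp: h_def)
  have u: "h \<le> u" using h by (simp add: u_def)
  have "- ln (1 - (1 - h)) - (- ln (1 - (1 - u))) \<le> Q"
    unfolding Q_def
  proof (rule derivative_integrable_imp_bounded_diff[where F = "\<lambda>y. - ln (1 - y)"])
    show "continuous_on {..<t} (\<lambda>y. 1 / (1 - y))" using assms by (intro continuous_intros) auto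
    show "((\<lambda>y. - ln (1 - y)) has_real_derivative 1 / (1 - y)) (at y)" if "y \<in> {..<t}" for y
      using that assms by (auto intro!: derivative_eq_intros)
    show "{1 - u..1 - h} \<subseteq> {..<t}" using h by auto
    show "1 - u \<le> 1 - h" using u by simp
    show "set_integrable lborel {..<t} (\<lambda>y. 1 / (1 - y))" using A by (simp only: I)
    show "0 \<le> 1 / (1 - y)" if "y \<in> {..<t}" for y using that assms by simp
  qed
  then have "ln u - ln h \<le> Q" by simp
  moreover have "ln u = ln h + (\<bar>Q\<bar> + 1)" unfolding u_def using h(1) by (subst ln_mult_pos) simp_all
  ultimately show False by linarith
qed

section \<open>The transmutation identity\<close>

text \<open>The theorem speaks of Lebesgue measure, whereas Fubini and the substitutions are carried
  out for Borel measure. For integrands continuous on a Borel set the two agree.\<close>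

lemma lebesgue_lborel_continuous:
  fixes h :: "real \<Rightarrow> complex"
  assumes "S \<in> sets borel" "continuous_on S h"
  shows "set_integrable lebesgue S h \<longleftrightarrow> set_integrable lborel S h"
    and "(LINT y:S|lebesgue. h y) = (LINT y:S|lborel. h y)"
proof -
  have "(\<lambda>y. indicator S y *\<^sub>R h y) \<in> borel_measurable lborel"
    using borel_measurable_continuous_on_indicator[OF assms] by simp
  then show "set_integrable lebesgue S h \<longleftrightarrow> set_integrable lborel S h"
    "(LINT y:S|lebesgue. h y) = (LINT y:S|lborel. h y)"
    unfolding set_integrable_def set_lebesgue_integral_def
    by (simp_all only: integrable_completion integral_completion)
qed

lemma set_integrable_dominated:
  fixes h1 h2 :: "real \<Rightarrow> complex"
  assumes "set_integrable lborel S h1" "S \<in> sets borel" "continuous_on S h2"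
    and "\<And>y. y \<in> S \<Longrightarrow> norm (h2 y) \<le> C * norm (h1 y)"
  shows "set_integrable lborel S h2"
proof (rule set_integrable_bound)
  show "set_integrable lborel S (\<lambda>y. of_real C * h1 y)"
    using assms(1) by (intro set_integrable_mult_right) auto
  show "set_borel_measurable lborel S h2"
    using assms(2,3) by (rule set_borel_measurable_continuous)
  have "C * norm (h1 y) \<le> norm (of_real C * h1 y)" for y
    by (simp add: norm_mult mult_right_mono)
  then show "AE y in lborel. y \<in> S \<longrightarrow> norm (h2 y) \<le> norm (of_real C * h1 y)"
    using assms(4) by (intro AE_I2 impI) (meson order_trans)
qed

text \<open>The hypothesis controls h only near x0. Pick t inside the interval so close to x0 that
  the part between x0 and t lies in the neighbourhood; the remaining part lies in a compact
  subinterval of J, where h is continuous.\<close>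

lemma L1_at_imp_set_integrable:
  fixes h :: "real \<Rightarrow> complex"
  assumes L1: "L1_at x0 J h" and J: "open J" "s \<in> J" "interval_between x0 s \<subseteq> J" and s: "x0 \<noteq> ereal s"
    and h: "continuous_on J h"
  shows "set_integrable lborel (interval_between x0 s) h"
proof -
  obtain U where U: "open U" "x0 \<in> U" "set_integrable lebesgue (J \<inter> {y. ereal y \<in> U}) h"
    using L1 by (auto simp: L1_at_def)
  let ?V = "J \<inter> {y. ereal y \<in> U}"
  have Vo: "open ?V"
  proof -
    have "open (ereal -` U)" using U(1) by (rule open_ereal_vimage)
    then show ?thesis using J by (auto simp: vimage_def)
  qed
  then have V: "set_integrable lborel ?V h"
    using U(3) lebesgue_lborel_continuous(1)[of ?V h] h by (auto intro: continuous_on_subset)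
  obtain t where t: "t \<in> interval_between x0 s" "\<And>y. y \<in> interval_between x0 t \<Longrightarrow> ereal y \<in> U"
  proof (cases "x0 < ereal s")
    case True
    obtain b where b: "x0 < b" "{x0..<b} \<subseteq> U" using open_right[OF U(1,2) True] by blast
    then have "x0 < min b (ereal s)" using True by simp
    then obtain t where t: "x0 < ereal t" "ereal t < min b (ereal s)" using ereal_dense2 by blast
    show ?thesis
    proof (rule that[of t])
      show "t \<in> interval_between x0 s" using t by (simp add: in_interval_between)
      fix y assume "y \<in> interval_between x0 t"
      then have "x0 < ereal y" "ereal y < ereal t" using t by (cases x0; auto simp: in_interval_between)+
      moreover have "ereal t < b" using t by simp
      ultimately have "ereal y \<in> {x0..<b}" using less_trans[of "ereal y" "ereal t" b] by simp
      then show "ereal y \<in> U" using b(2) by blast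
    qed
  next
    case False
    then have s': "ereal s < x0" using s by simp
    obtain b where b: "b < x0" "{b<..x0} \<subseteq> U" using open_left[OF U(1,2) s'] by blast
    then have "max b (ereal s) < x0" using s' by simp
    then obtain t where t: "ereal t < x0" "max b (ereal s) < ereal t" using ereal_dense2 by blast
    show ?thesis
    proof (rule that[of t])
      show "t \<in> interval_between x0 s" using t by (simp add: in_interval_between)
      fix y assume "y \<in> interval_between x0 t"
      then have "ereal y < x0" "ereal t < ereal y" using t by (cases x0; auto simp: in_interval_between)+
      moreover have "b < ereal t" using t by simp
      ultimately have "ereal y \<in> {b<..x0}" using less_trans[of b "ereal t" "ereal y"] by simp
      then show "ereal y \<in> U" using b(2) by blast
    qed
  qed
  let ?K = "{min t s..max t s}"
  have K: "?K \<subseteq> J"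
  proof
    fix y assume y: "y \<in> ?K"
    then have "y = s \<or> y \<in> interval_between x0 s"
      using t(1) by (cases x0) (auto simp: in_interval_between)
    then show "y \<in> J" using J by auto
  qed
  have "set_integrable lborel ?K h"
    by (rule borel_integrable_atLeastAtMost') (rule continuous_on_subset[OF h K])
  with V have "set_integrable lborel (?V \<union> ?K) h"
    using Vo by (intro set_integrable_Un) auto
  then show ?thesis
  proof (rule set_integrable_subset)
    show "interval_between x0 s \<subseteq> ?V \<union> ?K"
    proof
      fix y assume y: "y \<in> interval_between x0 s"
      show "y \<in> ?V \<union> ?K"
      proof (cases "y \<in> interval_between x0 t")
        case True
        then show ?thesis using t(2) y J(3) by auto
      next
        case False
        then have "y \<in> ?K" using t(1) y by (cases x0) (auto simp: in_interval_between)
        then show ?thesis by blast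
      qed
    qed
  qed auto
qed

lemma C2_onD:
  assumes "C2_on J f"
  shows "y \<in> J \<Longrightarrow> (f has_vector_derivative D1 f y) (at y)"
    and "y \<in> J \<Longrightarrow> (D1 f has_vector_derivative D2 f y) (at y)"
    and "continuous_on J f" "continuous_on J (D1 f)" "continuous_on J (D2 f)"
  using assms unfolding C2_on_def C1_differentiable_on_eq D2_def
  by (auto simp: D1_def vector_derivative_works[symmetric]
      intro!: continuous_at_imp_continuous_on differentiable_imp_continuous_within)

text \<open>The case distinction repairs the convention \<open>0 powr 0 = 0\<close>: without it \<open>weight 0 \<beta>\<close> would jump
  at \<open>0\<close>, which is an interior point when \<open>J = {..<1}\<close>.\<close>

definition weight :: "complex \<Rightarrow> complex \<Rightarrow> real \<Rightarrow> complex" where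
  "weight \<alpha> \<beta> y = (if \<alpha> = 0 then 1 else cpow \<bar>y\<bar> \<alpha>) * cpow (1 - y) \<beta>"

text \<open>If \<alpha> = 0, the first term at y = 0 is 0 / 0 = 0, which is the correct value for a
  weight without a power of |y|.\<close>

definition log_deriv :: "complex \<Rightarrow> complex \<Rightarrow> real \<Rightarrow> complex" where
  "log_deriv \<alpha> \<beta> y = \<alpha> / of_real y - \<beta> / of_real (1 - y)"

section \<open>Logarithmic derivatives of the weights\<close>

lemma cpow_diff_one: "t > 0 \<Longrightarrow> cpow t (s - 1) = cpow t s / of_real t"
  by (simp add: powr_diff)

lemma has_real_derivative_abs:
  assumes "t \<noteq> (0::real)"
  shows "(abs has_real_derivative sgn t) (at t)"
proof (cases "t > 0")
  case True
  have "((\<lambda>t. t) has_real_derivative 1) (at t)" by simp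
  then have "(abs has_real_derivative 1) (at t)"
    by (rule has_field_derivative_transform_within_open[of _ _ _ "{0<..}"]) (use True in auto)
  then show ?thesis using True by simp
next
  case False
  have "((\<lambda>t. - t) has_real_derivative - 1) (at t)" by (auto intro!: derivative_eq_intros)
  then have "(abs has_real_derivative - 1) (at t)"
    by (rule has_field_derivative_transform_within_open[of _ _ _ "{..<0}"]) (use False assms in auto)
  then show ?thesis using False assms by simp
qed

text \<open>Because sgn u / |u| = 1 / u, the logarithmic derivative of a power of |u| has the same
  formula for both signs of u. Hence negative and positive y, and both orientations of x - y, share
  one computation.\<close>

lemma has_vector_derivative_cpow_abs:
  assumes "(u has_real_derivative u') (at y)" "u y \<noteq> 0"
  shows "((\<lambda>y. cpow \<bar>u y\<bar> s) has_vector_derivative cpow \<bar>u y\<bar> s * (s * of_real u' / of_real (u y))) (at y)"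
proof -
  have "((\<lambda>y. \<bar>u y\<bar>) has_real_derivative sgn (u y) * u') (at y)"
    using DERIV_chain2[OF has_real_derivative_abs[OF assms(2)] assms(1)] .
  then have "((\<lambda>y. \<bar>u y\<bar>) has_vector_derivative sgn (u y) * u') (at y)"
    by (simp add: has_real_derivative_iff_has_vector_derivative)
  from vector_diff_chain_at[OF this has_vector_derivative_cpow[of "\<bar>u y\<bar>" s]] assms(2)
  have "((\<lambda>y. cpow \<bar>u y\<bar> s) has_vector_derivative (sgn (u y) * u') *\<^sub>R (s * cpow \<bar>u y\<bar> (s - 1))) (at y)"
    by (simp add: o_def)
  moreover have "(sgn (u y) * u') *\<^sub>R (s * cpow \<bar>u y\<bar> (s - 1)) = cpow \<bar>u y\<bar> s * (s * of_real u' / of_real (u y))"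
  proof -
    have "(sgn (u y) * u') *\<^sub>R (s * cpow \<bar>u y\<bar> (s - 1)) =
        cpow \<bar>u y\<bar> s * (s * of_real u') * (of_real (sgn (u y)) / of_real \<bar>u y\<bar>)"
      using assms(2) cpow_diff_one[of "\<bar>u y\<bar>" s] by (simp add: scaleR_conv_of_real)
    also have "complex_of_real (sgn (u y)) / of_real \<bar>u y\<bar> = 1 / of_real (u y)"
      using assms(2) by (cases "u y > 0") auto
    finally show ?thesis by simp
  qed
  ultimately show ?thesis by simp
qed

lemma weight_nonzero: "y < 1 \<Longrightarrow> \<alpha> = 0 \<or> y \<noteq> 0 \<Longrightarrow> weight \<alpha> \<beta> y \<noteq> 0"
  by (auto simp: weight_def)

lemma has_vector_derivative_weight:
  assumes "y < 1" "\<alpha> = 0 \<or> y \<noteq> 0"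
  shows "(weight \<alpha> \<beta> has_vector_derivative weight \<alpha> \<beta> y * log_deriv \<alpha> \<beta> y) (at y)"
proof -
  have 0: "((\<lambda>y. 1 - y) has_real_derivative - 1) (at y)"
    by (auto intro!: derivative_eq_intros)
  have "((\<lambda>y. cpow \<bar>1 - y\<bar> \<beta>) has_vector_derivative cpow \<bar>1 - y\<bar> \<beta> * (\<beta> * of_real (- 1) / of_real (1 - y))) (at y)"
    using has_vector_derivative_cpow_abs[OF 0] assms by simp
  then have 1: "((\<lambda>y. cpow (1 - y) \<beta>) has_vector_derivative cpow \<bar>1 - y\<bar> \<beta> * (\<beta> * of_real (- 1) / of_real (1 - y))) (at y)"
    by (rule has_vector_derivative_transform_within_open[of _ _ _ "{..<1}"]) (use assms in auto)
  have 2: "((\<lambda>y. if \<alpha> = 0 then 1 else cpow \<bar>y\<bar> \<alpha>) has_vector_derivative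
     (if \<alpha> = 0 then 1 else cpow \<bar>y\<bar> \<alpha>) * (\<alpha> / of_real y)) (at y)"
    using assms has_vector_derivative_cpow_abs[of "\<lambda>y. y" 1 y \<alpha>] by auto
  show ?thesis
    unfolding weight_def[abs_def] log_deriv_def
    by (rule has_vector_derivative_eq_rhs[OF has_vector_derivative_mult[OF 2 1]])
       (use assms in \<open>simp add: algebra_simps\<close>)
qed

lemma has_vector_derivative_log_deriv:
  assumes "y < 1" "\<alpha> = 0 \<or> y \<noteq> 0"
  shows "(log_deriv \<alpha> \<beta> has_vector_derivative - \<alpha> / of_real y ^ 2 - \<beta> / of_real (1 - y) ^ 2) (at y)"
proof -
  have nz: "1 - complex_of_real y \<noteq> 0"
    using assms(1) by (metis eq_iff_diff_eq_0 less_irrefl of_real_1 of_real_eq_iff)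
  have 1: "((\<lambda>z. \<beta> / (1 - z)) has_field_derivative \<beta> / (1 - complex_of_real y) ^ 2) (at (of_real y))"
    using nz by (auto intro!: derivative_eq_intros simp: power2_eq_square)
  have 2: "((\<lambda>z. \<alpha> / z) has_field_derivative - \<alpha> / complex_of_real y ^ 2) (at (of_real y))"
  proof (cases "\<alpha> = 0")
    case False
    then have "complex_of_real y \<noteq> 0" using assms by simp
    then show ?thesis by (auto intro!: derivative_eq_intros simp: power2_eq_square)
  qed simp
  from has_vector_derivative_real_field[OF DERIV_diff[OF 2 1]] show ?thesis
    unfolding log_deriv_def[abs_def] by simp
qed

lemma set_integrable_eqI:
  "set_integrable M A h \<Longrightarrow> (\<And>y. y \<in> A \<Longrightarrow> h y = h' y) \<Longrightarrow> set_integrable M A h'"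
  unfolding set_integrable_def by (erule Bochner_Integration.integrable_cong[THEN iffD1, rotated 2]) (auto simp: indicator_def)

text \<open>The common shape of the eight cases: w w2 and v are products of powers of |y| and 1 - y.
  The factor w2 is merged into the weight because the right-hand integrand carries w w2; 0 may be a
  point of J only if the exponents \<alpha> and \<gamma> of |y| are 0.\<close>

locale transmutation_setup =
  fixes a b c \<mu> a' b' c' \<alpha> \<beta> \<gamma> \<delta> :: complex and x0 :: ereal and J :: "real set"
    and w v :: "real \<Rightarrow> complex" and w2 v2 :: "real \<Rightarrow> real" and f :: "real \<Rightarrow> complex"
  assumes mu: "Re \<mu> > 2"
    and J_open: "open J" and J_less: "J \<subseteq> {..<1}"
    and J_sub: "\<And>s. s \<in> J \<Longrightarrow> interval_between x0 s \<subseteq> J" and x0_J: "\<And>s. s \<in> J \<Longrightarrow> x0 \<noteq> ereal s"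
    and alpha: "\<alpha> = 0 \<or> 0 \<notin> J" and gamma: "\<gamma> = 0 \<or> 0 \<notin> J"
    and w_cont: "continuous_on J w" and w2_cont: "continuous_on J w2"
    and W_eq: "\<And>y. y \<in> J \<Longrightarrow> w y * of_real (w2 y) = weight \<alpha> \<beta> y"
    and v_eq: "\<And>y. y \<in> J \<Longrightarrow> v y = weight \<gamma> \<delta> y"
    and v2_nz: "\<And>y. y \<in> J \<Longrightarrow> v2 y \<noteq> 0"
    and f: "C2_on J f"
    and L1_2: "L1_at x0 J (\<lambda>y. D2 f y * of_real (y * (1 - y)) * w y * of_real (w2 y)
                 * of_real ((1 + \<bar>y\<bar>) powr (Re \<mu> - 1)))"
    and L1_1: "L1_at x0 J (\<lambda>y. D1 f y * w y * of_real (w2 y) * of_real ((1 + \<bar>y\<bar>) powr Re \<mu>))"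
    and L1_0: "L1_at x0 J (\<lambda>y. f y * w y * of_real ((1 + \<bar>y\<bar>) powr (Re \<mu> - 1)))"
begin

lemma f_deriv:
  "y \<in> J \<Longrightarrow> (f has_vector_derivative D1 f y) (at y)"
  "y \<in> J \<Longrightarrow> (D1 f has_vector_derivative D2 f y) (at y)"
  and f_cont: "continuous_on J f" "continuous_on J (D1 f)" "continuous_on J (D2 f)"
  using C2_onD[OF f] by auto

lemma weight_deriv: "y \<in> J \<Longrightarrow> (weight \<alpha> \<beta> has_vector_derivative weight \<alpha> \<beta> y * log_deriv \<alpha> \<beta> y) (at y)"
  using alpha J_less by (intro has_vector_derivative_weight) auto

lemma weight_cont: "continuous_on J (weight \<alpha> \<beta>)"
  by (intro continuous_at_imp_continuous_on ballI)
     (rule has_vector_derivative_continuous[OF weight_deriv])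

lemma v_nz: "y \<in> J \<Longrightarrow> v y \<noteq> 0"
  using v_eq[of y] weight_nonzero[of y \<gamma> \<delta>] gamma J_less by auto

lemma v_inverse_deriv:
  assumes "y \<in> J"
  shows "((\<lambda>y. 1 / v y) has_vector_derivative - log_deriv \<gamma> \<delta> y * (1 / v y)) (at y)"
proof -
  have "(weight \<gamma> \<delta> has_vector_derivative weight \<gamma> \<delta> y * log_deriv \<gamma> \<delta> y) (at y)"
    using gamma J_less assms by (intro has_vector_derivative_weight) auto
  then have "(v has_vector_derivative weight \<gamma> \<delta> y * log_deriv \<gamma> \<delta> y) (at y)"
    by (rule has_vector_derivative_transform_within_open[OF _ J_open assms]) (simp add: v_eq)
  then have "(v has_vector_derivative v y * log_deriv \<gamma> \<delta> y) (at y)" by (simp add: v_eq assms)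
  then have "((\<lambda>y. inverse (v y)) has_vector_derivative - (inverse (v y) * (v y * log_deriv \<gamma> \<delta> y) * inverse (v y))) (at y)"
    using v_nz[OF assms] unfolding has_vector_derivative_def
    by (auto intro!: derivative_eq_intros simp: algebra_simps)
  then show ?thesis using v_nz[OF assms] by (simp add: field_simps)
qed

lemma set_integrable_interval:
  assumes "L1_at x0 J h" "continuous_on J h" "s \<in> J"
  shows "set_integrable lborel (interval_between x0 s) h"
  using assms by (intro L1_at_imp_set_integrable[OF _ J_open _ J_sub x0_J]) auto

lemma integrable_2: "s \<in> J \<Longrightarrow> set_integrable lborel (interval_between x0 s)
    (\<lambda>y. D2 f y * of_real (y * (1 - y)) * w y * of_real (w2 y) * of_real ((1 + \<bar>y\<bar>) powr (Re \<mu> - 1)))"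
  by (rule set_integrable_interval[OF L1_2]) (auto intro!: continuous_intros f_cont w_cont w2_cont)

lemma integrable_1: "s \<in> J \<Longrightarrow> set_integrable lborel (interval_between x0 s)
    (\<lambda>y. D1 f y * w y * of_real (w2 y) * of_real ((1 + \<bar>y\<bar>) powr Re \<mu>))"
  by (rule set_integrable_interval[OF L1_1]) (auto intro!: continuous_intros f_cont w_cont w2_cont)

lemma integrable_0: "s \<in> J \<Longrightarrow> set_integrable lborel (interval_between x0 s)
    (\<lambda>y. f y * w y * of_real ((1 + \<bar>y\<bar>) powr (Re \<mu> - 1)))"
  by (rule set_integrable_interval[OF L1_0]) (auto intro!: continuous_intros f_cont w_cont w2_cont)

abbreviation "g \<equiv> \<lambda>y. f y * w y"

lemma g_cont: "continuous_on J g" by (intro continuous_intros f_cont w_cont)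

text \<open>The exponent Re \<mu> - 1 covers all the orders \<mu>, \<mu> - 1 and \<mu> - 2 that
  arise from two differentiations.\<close>

lemma g_integrable: "s \<in> J \<Longrightarrow>
   set_integrable lborel (interval_between x0 s) (\<lambda>y. (1 + \<bar>y\<bar>) powr (Re \<mu> - 1) *\<^sub>R g y)"
  using integrable_0[of s] by (simp add: scaleR_conv_of_real mult_ac)

lemmas rl_integrable = rl_int_integrable[OF J_open _ J_sub x0_J g_cont g_integrable]
  and rl_derivative = rl_int_derivative[OF J_open _ J_sub x0_J g_cont g_integrable]

abbreviation "F \<equiv> \<lambda>s. rl_int x0 \<mu> g s * (1 / v s)"
abbreviation "\<sigma> \<equiv> log_deriv \<gamma> \<delta>"

end

section \<open>Derivatives of the transformed function at a point x\<close>

locale transmutation_at = transmutation_setup +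
  fixes x :: real
  assumes x: "x \<in> J"
begin

abbreviation "I \<equiv> interval_between x0 x"
definition "k y = cpow \<bar>x - y\<bar> (\<mu> - 1)"
definition "r y = 1 / complex_of_real (x - y)"
definition "\<epsilon> = (if x0 < ereal x then 1 else - 1 :: complex)"
text \<open>J can lie on both sides of x0. On the part \<open>U\<close> on the side of x the sign in
  \<open>rl_derivative\<close> is the constant \<epsilon>, so the first derivative is known in a
  whole neighbourhood of x and can be differentiated again. That is why \<open>G1\<close> is a
  function while \<open>G2\<close> is a number.\<close>

definition "U = J \<inter> {s. x0 < ereal s \<longleftrightarrow> x0 < ereal x}"
definition "G1 s = \<epsilon> * ((\<mu> - 1) * rl_int x0 (\<mu> - 1) g s)"
definition "G2 = (\<mu> - 1) * (\<mu> - 2) * rl_int x0 (\<mu> - 2) g x"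

lemma U: "open U" "x \<in> U" "U \<subseteq> J"
proof -
  show "x \<in> U" "U \<subseteq> J" using x by (auto simp: U_def)
  show "open U"
  proof (cases "x0 < ereal x")
    case True
    then have "U = J \<inter> ereal -` {x0<..}" by (auto simp: U_def)
    then show ?thesis using J_open by (simp add: open_ereal_vimage open_Int)
  next
    case False
    then have "U = J \<inter> ereal -` {..<x0}" using x0_J by (force simp: U_def)
    then show ?thesis using J_open by (simp add: open_ereal_vimage open_Int)
  qed
qed

lemma G_deriv:
  assumes "s \<in> U" shows "(rl_int x0 \<mu> g has_vector_derivative G1 s) (at s)"
proof -
  have s: "s \<in> J" "x0 < ereal s \<longleftrightarrow> x0 < ereal x" using assms by (auto simp: U_def)
  show ?thesis
    using rl_derivative[OF s(1) s(1) s(1) s(1), of \<mu>] mu s(2) by (simp add: G1_def \<epsilon>_def)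
qed

lemma G1_deriv: "(G1 has_vector_derivative G2) (at x)"
proof -
  have "(rl_int x0 (\<mu> - 1) g has_vector_derivative \<epsilon> * ((\<mu> - 1 - 1) * rl_int x0 (\<mu> - 1 - 1) g x)) (at x)"
    using rl_derivative[OF x x x x, of "\<mu> - 1"] mu by (simp add: \<epsilon>_def)
  from has_vector_derivative_mult_right[OF has_vector_derivative_mult_right[OF this, of "\<mu> - 1"], of \<epsilon>]
  have "(G1 has_vector_derivative \<epsilon> * ((\<mu> - 1) * (\<epsilon> * ((\<mu> - 1 - 1) * rl_int x0 (\<mu> - 1 - 1) g x)))) (at x)"
    unfolding G1_def[abs_def] .
  moreover have "\<epsilon> * ((\<mu> - 1) * (\<epsilon> * ((\<mu> - 1 - 1) * rl_int x0 (\<mu> - 1 - 1) g x))) = G2"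
    by (auto simp: G2_def \<epsilon>_def)
  ultimately show ?thesis by simp
qed

definition "\<sigma>' = - \<gamma> / of_real x ^ 2 - \<delta> / of_real (1 - x) ^ 2"
definition "F1 s = (G1 s - \<sigma> s * rl_int x0 \<mu> g s) * (1 / v s)"
definition "F2 = (G2 - \<sigma>' * rl_int x0 \<mu> g x - \<sigma> x * G1 x - \<sigma> x * (G1 x - \<sigma> x * rl_int x0 \<mu> g x)) * (1 / v x)"

lemma F_deriv: assumes "s \<in> U" shows "(F has_vector_derivative F1 s) (at s)"
  by (rule has_vector_derivative_eq_rhs[OF has_vector_derivative_mult[OF G_deriv[OF assms]
        v_inverse_deriv[OF subsetD[OF U(3) assms]]]])
     (simp add: F1_def algebra_simps)

lemma F1_deriv: "(F1 has_vector_derivative F2) (at x)"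
proof -
  have s: "(\<sigma> has_vector_derivative \<sigma>') (at x)"
    unfolding \<sigma>'_def using gamma J_less x by (intro has_vector_derivative_log_deriv) auto
  show ?thesis unfolding F1_def[abs_def]
    by (rule has_vector_derivative_eq_rhs[OF has_vector_derivative_mult[OF
          has_vector_derivative_diff[OF G1_deriv has_vector_derivative_mult[OF s G_deriv[OF U(2)]]] v_inverse_deriv[OF x]]])
       (simp add: F2_def algebra_simps)
qed

lemma D1_F: "s \<in> U \<Longrightarrow> D1 F s = F1 s"
  unfolding D1_def by (rule vector_derivative_at[OF F_deriv])

lemma D1_F_deriv: "(D1 F has_vector_derivative F2) (at x)"
  by (rule has_vector_derivative_transform_within_open[OF F1_deriv U(1,2)]) (rule D1_F[symmetric])

lemma D2_F: "D2 F x = F2"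
  unfolding D2_def D1_def[of "D1 F"] by (rule vector_derivative_at[OF D1_F_deriv])

lemma twice_differentiable_F: "twice_differentiable_at F x"
  unfolding twice_differentiable_at_def
proof
  show "\<forall>\<^sub>F t in nhds x. F differentiable at t"
    using eventually_nhds_in_open[OF U(1,2)]
    by eventually_elim (use F_deriv differentiableI_vector in blast)
  show "D1 F differentiable at x" using D1_F_deriv by (rule differentiableI_vector)
qed

text \<open>Product rule with (1 / v)' = -\<sigma> / v, sorted by the three integrals of orders
  \<mu> - 2, \<mu> - 1 and \<mu>. Their coefficients are what the kernel identity has to
  match.\<close>

lemma hypergeom_op_F:
  "hypergeom_op a' b' c' F x = (1 / v x) * (of_real (x * (1 - x)) * G2
      + (c' - (a' + b' + 1) * of_real x - 2 * of_real (x * (1 - x)) * \<sigma> x) * G1 x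
      + (of_real (x * (1 - x)) * (\<sigma> x ^ 2 - \<sigma>') - (c' - (a' + b' + 1) * of_real x) * \<sigma> x - a' * b') * rl_int x0 \<mu> g x)"
proof -
  have "P * ((g2 - s' * g0 - s * g1 - s * (g1 - s * g0)) * i) + q * ((g1 - s * g0) * i) - ab * (g0 * i)
     = i * (P * g2 + (q - 2 * P * s) * g1 + (P * (s ^ 2 - s') - q * s - ab) * g0)"
    for P q ab i s s' g0 g1 g2 :: complex
    by (simp add: algebra_simps power2_eq_square)
  then show ?thesis
    unfolding hypergeom_op_def D2_F D1_F[OF U(2)] F1_def F2_def .
qed

lemma in_I:
  assumes "y \<in> I"
  shows "y \<in> J" "y \<noteq> x" "of_real (sgn (x - y)) = \<epsilon>"
proof -
  show "y \<in> J" using J_sub[OF x] assms by blast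
  show "y \<noteq> x" using assms by (auto simp: in_interval_between)
  show "of_real (sgn (x - y)) = \<epsilon>"
    unfolding \<epsilon>_def using assms by (cases x0) (auto simp: in_interval_between)
qed

lemma k_cont: "continuous_on I k"
proof (intro continuous_at_imp_continuous_on ballI)
  fix y assume "y \<in> I"
  then have "x - y \<noteq> 0" using in_I by auto
  then have "(k has_vector_derivative k y * ((\<mu> - 1) * of_real (- 1) / of_real (x - y))) (at y)"
    unfolding k_def[abs_def] by (intro has_vector_derivative_cpow_abs) (auto intro!: derivative_eq_intros)
  then show "isCont k y" by (rule has_vector_derivative_continuous)
qed

lemma r_cont: "continuous_on I r"
  unfolding r_def[abs_def] using in_I(2) by (intro continuous_intros) auto

lemma r_abs:
  assumes "y \<in> I" shows "\<epsilon> / of_real \<bar>x - y\<bar> = r y"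
proof -
  have "sgn (x - y) / \<bar>x - y\<bar> = 1 / (x - y)"
    using in_I(2)[OF assms] by (auto simp: sgn_if field_simps)
  then have "complex_of_real (sgn (x - y) / \<bar>x - y\<bar>) = of_real (1 / (x - y))" by (simp only:)
  then show ?thesis using in_I(3)[OF assms] by (simp add: r_def)
qed

text \<open>Since 1 / |x - y| = \<epsilon> r y, lowering the exponent multiplies k by powers of the
  signed reciprocal r. All three integrands thus become g k times a polynomial in r, and the
  comparison of kernels turns into one of rational functions.\<close>

lemma cpow_lower:
  assumes "y \<in> I"
  shows "cpow \<bar>x - y\<bar> (\<mu> - 2) = \<epsilon> * (k y * r y)"
    and "cpow \<bar>x - y\<bar> (\<mu> - 3) = k y * r y ^ 2"
proof -
  have ee: "\<epsilon> * \<epsilon> = 1" by (simp add: \<epsilon>_def)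
  have nz: "\<bar>x - y\<bar> > 0" using in_I(2)[OF assms] by simp
  have 1: "cpow \<bar>x - y\<bar> (\<mu> - 1 - 1) = k y / of_real \<bar>x - y\<bar>"
    unfolding k_def by (rule cpow_diff_one[OF nz])
  have "\<mu> - 2 - 1 = \<mu> - 1 - 1 - 1" by simp
  then have 2: "cpow \<bar>x - y\<bar> (\<mu> - 2 - 1) = k y / of_real \<bar>x - y\<bar> / of_real \<bar>x - y\<bar>"
    unfolding 1[symmetric] by (simp only: cpow_diff_one[OF nz])
  have 3: "1 / of_real \<bar>x - y\<bar> = \<epsilon> * r y"
    using r_abs[OF assms] ee by (metis mult.assoc mult_1 times_divide_eq_right)
  have "cpow \<bar>x - y\<bar> (\<mu> - 1 - 1) = k y * (1 / of_real \<bar>x - y\<bar>)" unfolding 1 by simp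
  then show "cpow \<bar>x - y\<bar> (\<mu> - 2) = \<epsilon> * (k y * r y)" unfolding 3 by (simp add: mult_ac)
  have "cpow \<bar>x - y\<bar> (\<mu> - 2 - 1) = k y * (1 / of_real \<bar>x - y\<bar>) * (1 / of_real \<bar>x - y\<bar>)" unfolding 2 by simp
  then have "cpow \<bar>x - y\<bar> (\<mu> - 2 - 1) = k y * r y ^ 2 * (\<epsilon> * \<epsilon>)"
    unfolding 3 by (simp only: power2_eq_square mult_ac)
  then show "cpow \<bar>x - y\<bar> (\<mu> - 3) = k y * r y ^ 2" by (simp add: ee)
qed

lemma set_integrable_g:
  "set_integrable lborel I (\<lambda>y. g y * k y)"
  "set_integrable lborel I (\<lambda>y. g y * (k y * r y))"
  "set_integrable lborel I (\<lambda>y. g y * (k y * r y ^ 2))"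
proof -
  show "set_integrable lborel I (\<lambda>y. g y * k y)"
    unfolding k_def using rl_integrable[OF x x x x, of \<mu>] mu by simp
  have "set_integrable lborel I (\<lambda>y. \<epsilon> * (g y * cpow \<bar>x - y\<bar> (\<mu> - 2)))"
    using rl_integrable[OF x x x x, of "\<mu> - 1"] mu by (intro set_integrable_mult_right) simp
  then show "set_integrable lborel I (\<lambda>y. g y * (k y * r y))"
  proof (rule set_integrable_eqI)
    fix y assume "y \<in> I"
    then show "\<epsilon> * (g y * cpow \<bar>x - y\<bar> (\<mu> - 2)) = g y * (k y * r y)"
      unfolding cpow_lower(1)[OF \<open>y \<in> I\<close>] by (simp add: \<epsilon>_def)
  qed
  have "set_integrable lborel I (\<lambda>y. g y * cpow \<bar>x - y\<bar> (\<mu> - 3))"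
    using rl_integrable[OF x x x x, of "\<mu> - 2"] mu by simp
  then show "set_integrable lborel I (\<lambda>y. g y * (k y * r y ^ 2))"
    by (rule set_integrable_eqI) (simp only: cpow_lower(2))
qed

lemma G_eq:
  "rl_int x0 \<mu> g x = (LINT y:I|lborel. g y * k y)"
  "G1 x = (\<mu> - 1) * (LINT y:I|lborel. g y * (k y * r y))"
  "G2 = (\<mu> - 1) * (\<mu> - 2) * (LINT y:I|lborel. g y * (k y * r y ^ 2))"
proof -
  show "rl_int x0 \<mu> g x = (LINT y:I|lborel. g y * k y)" by (simp add: rl_int_def k_def)
  have "rl_int x0 (\<mu> - 1) g x = (LINT y:I|lborel. \<epsilon> * (g y * (k y * r y)))"
    unfolding rl_int_def by (rule set_lebesgue_integral_cong) (auto simp: cpow_lower)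
  then have "rl_int x0 (\<mu> - 1) g x = \<epsilon> * (LINT y:I|lborel. g y * (k y * r y))" by simp
  then show "G1 x = (\<mu> - 1) * (LINT y:I|lborel. g y * (k y * r y))"
    by (auto simp: G1_def \<epsilon>_def)
  have "rl_int x0 (\<mu> - 2) g x = (LINT y:I|lborel. g y * (k y * r y ^ 2))"
    unfolding rl_int_def by (rule set_lebesgue_integral_cong) (auto simp: cpow_lower)
  then show "G2 = (\<mu> - 1) * (\<mu> - 2) * (LINT y:I|lborel. g y * (k y * r y ^ 2))" by (simp add: G2_def)
qed

end

lemma norm_linear_le: "norm (A + B * complex_of_real y) \<le> (norm A + norm B) * (1 + \<bar>y\<bar>)"
proof -
  have "norm (A + B * complex_of_real y) \<le> norm A + norm B * \<bar>y\<bar>"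
    using norm_triangle_ineq[of A "B * complex_of_real y"] by (simp add: norm_mult)
  also have "\<dots> \<le> (norm A + norm B) * (1 + \<bar>y\<bar>)"
    by (simp add: algebra_simps)
  finally show ?thesis .
qed

section \<open>Lagrange's identity and estimates for the bilinear concomitant\<close>

context transmutation_at
begin

lemma k_bound:
  assumes "y \<noteq> x"
  shows "norm (k y) \<le> (1 + \<bar>x\<bar>) powr (Re \<mu> - 1) * (1 + \<bar>y\<bar>) powr (Re \<mu> - 1)"
    and "norm (k y * r y) \<le> (1 + \<bar>x\<bar>) powr (Re \<mu> - 2) * (1 + \<bar>y\<bar>) powr (Re \<mu> - 2)"
    and "norm (k y * r y) = \<bar>x - y\<bar> powr (Re \<mu> - 2)"
proof -
  have nz: "\<bar>x - y\<bar> > 0" using assms by simp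
  have k: "norm (k y) = \<bar>x - y\<bar> powr (Re \<mu> - 1)"
    unfolding k_def using norm_cpow[OF nz, of "\<mu> - 1"] by simp
  show "norm (k y) \<le> (1 + \<bar>x\<bar>) powr (Re \<mu> - 1) * (1 + \<bar>y\<bar>) powr (Re \<mu> - 1)"
    unfolding k using mu by (intro powr_dist_le) simp
  have "norm (k y * r y) = \<bar>x - y\<bar> powr (Re \<mu> - 1) / \<bar>x - y\<bar> powr 1"
    unfolding norm_mult k r_def norm_divide norm_of_real using nz by simp
  also have "\<dots> = \<bar>x - y\<bar> powr (Re \<mu> - 2)"
    unfolding powr_diff[symmetric] by simp
  finally show kr: "norm (k y * r y) = \<bar>x - y\<bar> powr (Re \<mu> - 2)" .
  show "norm (k y * r y) \<le> (1 + \<bar>x\<bar>) powr (Re \<mu> - 2) * (1 + \<bar>y\<bar>) powr (Re \<mu> - 2)"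
    unfolding kr using mu by (intro powr_dist_le) simp
qed

lemma k_deriv:
  assumes "y \<noteq> x"
  shows "(k has_vector_derivative - (\<mu> - 1) * k y * r y) (at y)"
    and "(r has_vector_derivative r y ^ 2) (at y)"
proof -
  have nz: "x - y \<noteq> 0" using assms by simp
  have "(k has_vector_derivative k y * ((\<mu> - 1) * of_real (- 1) / of_real (x - y))) (at y)"
    unfolding k_def[abs_def] using nz
    by (intro has_vector_derivative_cpow_abs) (auto intro!: derivative_eq_intros)
  then show "(k has_vector_derivative - (\<mu> - 1) * k y * r y) (at y)"
    by (rule has_vector_derivative_eq_rhs) (simp add: r_def mult.commute)
  have "((\<lambda>y. 1 / (x - y)) has_real_derivative (1 / (x - y)) ^ 2) (at y)"
    using nz by (auto intro!: derivative_eq_intros simp: power2_eq_square)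
  then have "((\<lambda>y. complex_of_real (1 / (x - y))) has_vector_derivative of_real ((1 / (x - y)) ^ 2)) (at y)"
    by (rule has_vector_derivative_of_real)
  then show "(r has_vector_derivative r y ^ 2) (at y)"
    by (simp add: r_def[abs_def])
qed

definition "P y = complex_of_real (y * (1 - y))"
text \<open>This is P times the logarithmic derivative of the weight, plus P', minus the first-order
  coefficient of the operator. The zeros of P cancel the poles, so it is affine. Its constant term
  vanishes exactly for \<alpha> = c - 1, which matters for the boundary term at 0.\<close>

definition "m y = (1 + \<alpha> - c) + (a + b - 1 - \<alpha> - \<beta>) * of_real y"

lemma P_deriv: "(P has_vector_derivative of_real (1 - 2 * y)) (at y)"
proof -
  have "((\<lambda>y. y * (1 - y)) has_real_derivative 1 - 2 * y) (at y)"
    by (auto intro!: derivative_eq_intros)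
  then show ?thesis unfolding P_def[abs_def] by (rule has_vector_derivative_of_real)
qed

lemma m_deriv: "(m has_vector_derivative (a + b - 1 - \<alpha> - \<beta>)) (at y)"
proof -
  have "((\<lambda>y. complex_of_real y) has_vector_derivative of_real 1) (at y)"
    by (intro has_vector_derivative_of_real) simp
  from has_vector_derivative_add[OF has_vector_derivative_const has_vector_derivative_mult_right[OF this]]
  show ?thesis unfolding m_def[abs_def] by simp
qed

lemma m_eq:
  assumes "y \<in> J"
  shows "P y * log_deriv \<alpha> \<beta> y = m y - of_real (1 - 2 * y) + (c - (a + b + 1) * of_real y)"
proof -
  have "1 - complex_of_real y \<noteq> 0"
    using assms J_less by (metis eq_iff_diff_eq_0 lessThan_iff less_irrefl of_real_1 of_real_eq_iff subsetD)
  moreover have "\<alpha> = 0 \<or> complex_of_real y \<noteq> 0" using alpha assms by auto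
  ultimately have "P y * log_deriv \<alpha> \<beta> y = \<alpha> * (1 - of_real y) - \<beta> * of_real y"
    unfolding P_def log_deriv_def by (auto simp: field_simps)
  then show ?thesis by (simp add: m_def algebra_simps)
qed

text \<open>The bilinear concomitant in Lagrange's identity for the hypergeometric operator, \<open>f\<close> and
  the kernel \<open>weight \<alpha> \<beta> y * k y\<close>; the adjoint operator maps that kernel to
  \<open>weight \<alpha> \<beta> y * k y * adj y\<close>.\<close>

definition "concomitant y = weight \<alpha> \<beta> y * k y *
   (P y * D1 f y - f y * (m y - (\<mu> - 1) * P y * r y))"

definition "adj y = log_deriv \<alpha> \<beta> y * m y + (a + b - 1 - \<alpha> - \<beta>) - a * b
     - (\<mu> - 1) * r y * (m y + P y * log_deriv \<alpha> \<beta> y + of_real (1 - 2 * y))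
     + P y * (\<mu> - 1) * (\<mu> - 2) * r y ^ 2"

lemma concomitant_deriv:
  assumes y: "y \<in> J" "y \<noteq> x"
  shows "(concomitant has_vector_derivative
     weight \<alpha> \<beta> y * k y * hypergeom_op a b c f y - f y * k y * (weight \<alpha> \<beta> y * adj y)) (at y)"
proof -
  note D = has_vector_derivative_mult has_vector_derivative_diff has_vector_derivative_mult_right
  have 1: "((\<lambda>y. m y - (\<mu> - 1) * (P y * r y)) has_vector_derivative
      (a + b - 1 - \<alpha> - \<beta>) - (\<mu> - 1) * (P y * r y ^ 2 + of_real (1 - 2 * y) * r y)) (at y)"
    by (intro D m_deriv P_deriv k_deriv y)
  have 2: "((\<lambda>y. weight \<alpha> \<beta> y * k y *
      (P y * D1 f y - f y * (m y - (\<mu> - 1) * (P y * r y)))) has_vector_derivative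
      weight \<alpha> \<beta> y * k y * ((P y * D2 f y + of_real (1 - 2 * y) * D1 f y)
        - (f y * ((a + b - 1 - \<alpha> - \<beta>) - (\<mu> - 1) * (P y * r y ^ 2 + of_real (1 - 2 * y) * r y))
           + D1 f y * (m y - (\<mu> - 1) * (P y * r y))))
      + (weight \<alpha> \<beta> y * (- (\<mu> - 1) * k y * r y) + weight \<alpha> \<beta> y * log_deriv \<alpha> \<beta> y * k y)
         * (P y * D1 f y - f y * (m y - (\<mu> - 1) * (P y * r y)))) (at y)"
    by (intro has_vector_derivative_mult has_vector_derivative_diff 1 P_deriv k_deriv f_deriv weight_deriv y)
  \<comment> \<open>The relation \<open>m_eq\<close> eliminates the first-order coefficient q; what
    remains is a polynomial identity in independent variables.\<close>
  have alg: "W * K * ((p * f2 + p1 * f1) - (f0 * (m1 - (u - 1) * (p * R ^ 2 + p1 * R)) + f1 * (M - (u - 1) * (p * R))))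
      + (W * (- (u - 1) * K * R) + W * L * K) * (p * f1 - f0 * (M - (u - 1) * (p * R)))
    = W * K * (p * f2 + q * f1 - ab * f0) - f0 * K * (W * (L * M + m1 - ab
         - (u - 1) * R * (M + p * L + p1) + p * (u - 1) * (u - 2) * R ^ 2))"
    if "p * L = M - p1 + q" for W K p f2 p1 f1 f0 m1 u R M L q ab :: complex
  proof -
    have q: "q = p * L - M + p1" using that by simp
    show ?thesis unfolding q by (simp add: algebra_simps power2_eq_square)
  qed
  show ?thesis
    unfolding concomitant_def[abs_def] hypergeom_op_def adj_def
    using 2 alg[OF m_eq[OF y(1)]]
    by (simp only: P_def[symmetric] mult.assoc[of "\<mu> - 1", symmetric]) (simp only: mult.assoc)?
qed


lemma norm_weight: "y \<in> J \<Longrightarrow> norm (weight \<alpha> \<beta> y) = norm (w y) * \<bar>w2 y\<bar>"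
  by (simp add: norm_mult flip: W_eq)

lemma I_cont:
  "continuous_on I f" "continuous_on I (D1 f)" "continuous_on I (D2 f)"
  "continuous_on I (weight \<alpha> \<beta>)" "continuous_on I w" "continuous_on I w2"
  using f_cont weight_cont w_cont w2_cont J_sub[OF x] by (auto intro: continuous_on_subset)

lemma P_cont: "continuous_on S P" and m_cont: "continuous_on S m"
  unfolding P_def[abs_def] m_def[abs_def] by (intro continuous_intros)+

lemma hypergeom_op_cont: "continuous_on J (hypergeom_op a b c f)"
  unfolding hypergeom_op_def[abs_def] by (intro continuous_intros f_cont)

text \<open>The three terms of the operator match the three integrability hypotheses: k costs Re
  \<mu> - 1 powers of 1 + |y|, and the affine coefficient of f' one more. The hypothesis on f
  carries no w2, so there w2 is estimated by C.\<close>

lemma rhs_integrable: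
  assumes C: "C \<ge> 0" "\<And>y. y \<in> I \<Longrightarrow> \<bar>w2 y\<bar> \<le> C"
  shows "set_integrable lborel I (\<lambda>y. weight \<alpha> \<beta> y * k y * hypergeom_op a b c f y)"
proof -
  define R where "R = (1 + \<bar>x\<bar>) powr (Re \<mu> - 1)"
  have R0: "R \<ge> 0" by (simp add: R_def)
  have kb: "norm (k y) \<le> R * (1 + \<bar>y\<bar>) powr (Re \<mu> - 1)" if "y \<in> I" for y
    unfolding R_def using k_bound(1)[OF in_I(2)[OF that]] .
  have 2: "set_integrable lborel I (\<lambda>y. weight \<alpha> \<beta> y * k y * (P y * D2 f y))"
  proof (rule set_integrable_dominated[OF integrable_2[OF x], where C = R])
    fix y assume y: "y \<in> I"
    have "norm (weight \<alpha> \<beta> y * k y * (P y * D2 f y)) =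
       norm (w y) * \<bar>w2 y\<bar> * norm (P y) * norm (D2 f y) * norm (k y)"
      using norm_weight[OF in_I(1)[OF y]] by (simp add: norm_mult mult_ac)
    also have "\<dots> \<le> norm (w y) * \<bar>w2 y\<bar> * norm (P y) * norm (D2 f y) * (R * (1 + \<bar>y\<bar>) powr (Re \<mu> - 1))"
      using kb[OF y] by (intro mult_left_mono) auto
    also have "\<dots> = R * norm (D2 f y * of_real (y * (1 - y)) * w y * of_real (w2 y) * of_real ((1 + \<bar>y\<bar>) powr (Re \<mu> - 1)))"
      by (simp add: norm_mult P_def mult_ac del: of_real_mult)
    finally show "norm (weight \<alpha> \<beta> y * k y * (P y * D2 f y)) \<le> R * norm (D2 f y * of_real (y * (1 - y)) * w y * of_real (w2 y) * of_real ((1 + \<bar>y\<bar>) powr (Re \<mu> - 1)))" .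
  qed (auto intro!: continuous_intros I_cont k_cont P_cont)
  define q where "q = (\<lambda>y. c + - (a + b + 1) * complex_of_real y)"
  define Q where "Q = norm c + norm (- (a + b + 1))"
  have qb: "norm (q y) \<le> Q * (1 + \<bar>y\<bar>)" for y
    unfolding q_def Q_def by (rule norm_linear_le)
  have Q0: "Q \<ge> 0" by (simp add: Q_def)
  have q_cont: "continuous_on I q" unfolding q_def by (intro continuous_intros)
  have 1: "set_integrable lborel I (\<lambda>y. weight \<alpha> \<beta> y * k y * (q y * D1 f y))"
  proof (rule set_integrable_dominated[OF integrable_1[OF x], where C = "R * Q"])
    fix y assume y: "y \<in> I"
    have "norm (weight \<alpha> \<beta> y * k y * (q y * D1 f y)) =
       norm (w y) * \<bar>w2 y\<bar> * norm (D1 f y) * (norm (k y) * norm (q y))"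
      using norm_weight[OF in_I(1)[OF y]] by (simp add: norm_mult mult_ac)
    also have "\<dots> \<le> norm (w y) * \<bar>w2 y\<bar> * norm (D1 f y) * ((R * (1 + \<bar>y\<bar>) powr (Re \<mu> - 1)) * (Q * (1 + \<bar>y\<bar>)))"
      using kb[OF y] qb[of y] R0 by (intro mult_left_mono mult_mono) auto
    also have "(R * (1 + \<bar>y\<bar>) powr (Re \<mu> - 1)) * (Q * (1 + \<bar>y\<bar>)) = R * Q * (1 + \<bar>y\<bar>) powr Re \<mu>"
      by (simp add: powr_diff)
    also have "norm (w y) * \<bar>w2 y\<bar> * norm (D1 f y) * (R * Q * (1 + \<bar>y\<bar>) powr Re \<mu>) =
       R * Q * norm (D1 f y * w y * of_real (w2 y) * of_real ((1 + \<bar>y\<bar>) powr Re \<mu>))"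
      by (simp add: norm_mult mult_ac)
    finally show "norm (weight \<alpha> \<beta> y * k y * (q y * D1 f y)) \<le> R * Q * norm (D1 f y * w y * of_real (w2 y) * of_real ((1 + \<bar>y\<bar>) powr Re \<mu>))" .
  qed (auto intro!: continuous_intros I_cont k_cont q_cont)
  have 0: "set_integrable lborel I (\<lambda>y. weight \<alpha> \<beta> y * k y * (a * b * f y))"
  proof (rule set_integrable_dominated[OF integrable_0[OF x], where C = "norm (a * b) * C * R"])
    fix y assume y: "y \<in> I"
    have "norm (weight \<alpha> \<beta> y * k y * (a * b * f y)) =
       norm (a * b) * norm (f y) * norm (w y) * (\<bar>w2 y\<bar> * norm (k y))"
      using norm_weight[OF in_I(1)[OF y]] by (simp add: norm_mult mult_ac)
    also have "\<dots> \<le> norm (a * b) * norm (f y) * norm (w y) * (C * (R * (1 + \<bar>y\<bar>) powr (Re \<mu> - 1)))"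
      using kb[OF y] C(2)[OF y] C(1) by (intro mult_left_mono mult_mono) auto
    also have "\<dots> = norm (a * b) * C * R * norm (f y * w y * of_real ((1 + \<bar>y\<bar>) powr (Re \<mu> - 1)))"
      by (simp add: norm_mult mult_ac)
    finally show "norm (weight \<alpha> \<beta> y * k y * (a * b * f y)) \<le> norm (a * b) * C * R * norm (f y * w y * of_real ((1 + \<bar>y\<bar>) powr (Re \<mu> - 1)))" .
  qed (auto intro!: continuous_intros I_cont k_cont)
  show ?thesis
    using set_integral_diff(1)[OF set_integral_add(1)[OF 2 1] 0]
    by (rule set_integrable_eqI) (simp add: hypergeom_op_def P_def q_def algebra_simps)
qed

text \<open>After division by l, the bound on P / l costs one power of 1 + |y|. In the f' term this
  gives Re \<mu>. In the term with k r, of growth Re \<mu> - 2, it gives Re \<mu> - 1, with w2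
  bounded by C. In the term with m the product w2 m is absorbed by l itself.\<close>

lemma concomitant_div_integrable:
  assumes C: "C \<ge> 0" "\<And>y. y \<in> I \<Longrightarrow> \<bar>w2 y\<bar> \<le> C"
    and l: "continuous_on I l" "\<And>y. y \<in> I \<Longrightarrow> l y > 0"
    and Pl: "\<And>y. y \<in> I \<Longrightarrow> \<bar>y * (1 - y)\<bar> \<le> C * (1 + \<bar>y\<bar>) * l y"
    and ml: "\<And>y. y \<in> I \<Longrightarrow> \<bar>w2 y\<bar> * norm (m y) \<le> C * l y"
  shows "set_integrable lborel I (\<lambda>y. concomitant y / l y)"
proof -
  define R where "R = (1 + \<bar>x\<bar>) powr (Re \<mu> - 1)"
  define R' where "R' = (1 + \<bar>x\<bar>) powr (Re \<mu> - 2)"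
  have R0: "R \<ge> 0" "R' \<ge> 0" by (simp_all add: R_def R'_def)
  have kb: "norm (k y) \<le> R * (1 + \<bar>y\<bar>) powr (Re \<mu> - 1)" if "y \<in> I" for y
    unfolding R_def using k_bound(1)[OF in_I(2)[OF that]] .
  have krb: "norm (k y * r y) \<le> R' * (1 + \<bar>y\<bar>) powr (Re \<mu> - 2)" if "y \<in> I" for y
    unfolding R'_def using k_bound(2)[OF in_I(2)[OF that]] .
  have Plb: "norm (P y) / l y \<le> C * (1 + \<bar>y\<bar>)" and mlb: "\<bar>w2 y\<bar> * norm (m y) / l y \<le> C" if "y \<in> I" for y
    using Pl[OF that] ml[OF that] l(2)[OF that] by (simp_all add: P_def divide_le_eq abs_mult del: of_real_mult)
  have lnz: "\<And>y. y \<in> I \<Longrightarrow> l y \<noteq> 0" using l(2) by force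
  have norml: "norm (complex_of_real (l y)) = l y" if "y \<in> I" for y using l(2)[OF that] by simp
  have 1: "set_integrable lborel I (\<lambda>y. weight \<alpha> \<beta> y * k y * (P y * D1 f y) / l y)"
  proof (rule set_integrable_dominated[OF integrable_1[OF x], where C = "R * C"])
    fix y assume y: "y \<in> I"
    have "norm (weight \<alpha> \<beta> y * k y * (P y * D1 f y) / l y) =
       norm (w y) * \<bar>w2 y\<bar> * norm (D1 f y) * (norm (k y) * (norm (P y) / l y))"
      unfolding norm_divide norml[OF y] using norm_weight[OF in_I(1)[OF y]] by (simp add: norm_mult mult_ac)
    also have "\<dots> \<le> norm (w y) * \<bar>w2 y\<bar> * norm (D1 f y) * ((R * (1 + \<bar>y\<bar>) powr (Re \<mu> - 1)) * (C * (1 + \<bar>y\<bar>)))"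
      using kb[OF y] Plb[OF y] R0 l(2)[OF y] by (intro mult_left_mono mult_mono) auto
    also have "(R * (1 + \<bar>y\<bar>) powr (Re \<mu> - 1)) * (C * (1 + \<bar>y\<bar>)) = R * C * (1 + \<bar>y\<bar>) powr Re \<mu>"
      by (simp add: powr_diff)
    also have "norm (w y) * \<bar>w2 y\<bar> * norm (D1 f y) * (R * C * (1 + \<bar>y\<bar>) powr Re \<mu>) =
       R * C * norm (D1 f y * w y * of_real (w2 y) * of_real ((1 + \<bar>y\<bar>) powr Re \<mu>))"
      by (simp add: norm_mult mult_ac)
    finally show "norm (weight \<alpha> \<beta> y * k y * (P y * D1 f y) / l y) \<le> R * C * norm (D1 f y * w y * of_real (w2 y) * of_real ((1 + \<bar>y\<bar>) powr Re \<mu>))" .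
  qed (use lnz in \<open>auto intro!: continuous_intros I_cont k_cont P_cont l\<close>)
  have 2: "set_integrable lborel I (\<lambda>y. weight \<alpha> \<beta> y * k y * (f y * m y) / l y)"
  proof (rule set_integrable_dominated[OF integrable_0[OF x], where C = "R * C"])
    fix y assume y: "y \<in> I"
    have "norm (weight \<alpha> \<beta> y * k y * (f y * m y) / l y) =
       norm (w y) * norm (f y) * (norm (k y) * (\<bar>w2 y\<bar> * norm (m y) / l y))"
      unfolding norm_divide norml[OF y] using norm_weight[OF in_I(1)[OF y]] by (simp add: norm_mult mult_ac)
    also have "\<dots> \<le> norm (w y) * norm (f y) * ((R * (1 + \<bar>y\<bar>) powr (Re \<mu> - 1)) * C)"
      using kb[OF y] mlb[OF y] R0 l(2)[OF y] by (intro mult_left_mono mult_mono) auto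
    also have "\<dots> = R * C * norm (f y * w y * of_real ((1 + \<bar>y\<bar>) powr (Re \<mu> - 1)))"
      by (simp add: norm_mult mult_ac)
    finally show "norm (weight \<alpha> \<beta> y * k y * (f y * m y) / l y) \<le> R * C * norm (f y * w y * of_real ((1 + \<bar>y\<bar>) powr (Re \<mu> - 1)))" .
  qed (use lnz in \<open>auto intro!: continuous_intros I_cont k_cont m_cont l\<close>)
  have 3: "set_integrable lborel I (\<lambda>y. weight \<alpha> \<beta> y * (k y * r y) * ((\<mu> - 1) * f y * P y) / l y)"
  proof (rule set_integrable_dominated[OF integrable_0[OF x], where C = "norm (\<mu> - 1) * C * R' * C"])
    fix y assume y: "y \<in> I"
    have "norm (weight \<alpha> \<beta> y * (k y * r y) * ((\<mu> - 1) * f y * P y) / l y) =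
       norm (\<mu> - 1) * (norm (w y) * norm (f y) * (\<bar>w2 y\<bar> * (norm (k y * r y) * (norm (P y) / l y))))"
      unfolding norm_divide norml[OF y] norm_mult[of "weight \<alpha> \<beta> y * (k y * r y)"] norm_mult[of "weight \<alpha> \<beta> y"]
      using norm_weight[OF in_I(1)[OF y]] by (simp add: norm_mult mult_ac)
    also have "\<dots> \<le> norm (\<mu> - 1) * (norm (w y) * norm (f y) * (C * ((R' * (1 + \<bar>y\<bar>) powr (Re \<mu> - 2)) * (C * (1 + \<bar>y\<bar>)))))"
      using krb[OF y] Plb[OF y] C(2)[OF y] C(1) R0 l(2)[OF y] by (intro mult_left_mono mult_mono) auto
    also have "(R' * (1 + \<bar>y\<bar>) powr (Re \<mu> - 2)) * (C * (1 + \<bar>y\<bar>)) = R' * C * (1 + \<bar>y\<bar>) powr (Re \<mu> - 1)"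
    proof -
      have "(1 + \<bar>y\<bar>) powr (Re \<mu> - 1) = (1 + \<bar>y\<bar>) powr ((Re \<mu> - 2) + 1)" by simp
      also have "\<dots> = (1 + \<bar>y\<bar>) powr (Re \<mu> - 2) * (1 + \<bar>y\<bar>)" unfolding powr_add by simp
      finally show ?thesis by (simp add: mult_ac)
    qed
    also have "norm (\<mu> - 1) * (norm (w y) * norm (f y) * (C * (R' * C * (1 + \<bar>y\<bar>) powr (Re \<mu> - 1)))) =
       norm (\<mu> - 1) * C * R' * C * norm (f y * w y * of_real ((1 + \<bar>y\<bar>) powr (Re \<mu> - 1)))"
      by (simp add: norm_mult mult_ac)
    finally show "norm (weight \<alpha> \<beta> y * (k y * r y) * ((\<mu> - 1) * f y * P y) / l y)
       \<le> norm (\<mu> - 1) * C * R' * C * norm (f y * w y * of_real ((1 + \<bar>y\<bar>) powr (Re \<mu> - 1)))" .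
  qed (use lnz in \<open>auto intro!: continuous_intros I_cont k_cont r_cont P_cont l\<close>)
  show ?thesis
    using set_integral_add(1)[OF set_integral_diff(1)[OF 1 2] 3]
    by (rule set_integrable_eqI) (simp add: concomitant_def add_divide_distrib diff_divide_distrib algebra_simps)
qed

text \<open>The worst factor is k r, of norm |x - y| to the positive power Re \<mu> - 2; k is k r
  times x - y.\<close>

lemma concomitant_tendsto: "(concomitant \<longlongrightarrow> 0) (at x within I)"
proof -
  have kr0: "((\<lambda>y. k y * r y) \<longlongrightarrow> 0) (at x within I)"
  proof (rule Lim_null_comparison)
    show "\<forall>\<^sub>F y in at x within I. norm (k y * r y) \<le> \<bar>x - y\<bar> powr (Re \<mu> - 2)"
      unfolding eventually_at_filter using k_bound(3) by (intro always_eventually) auto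
    show "((\<lambda>y. \<bar>x - y\<bar> powr (Re \<mu> - 2)) \<longlongrightarrow> 0) (at x within I)"
      using mu by (auto intro!: tendsto_eq_intros)
  qed
  have k0: "(k \<longlongrightarrow> 0) (at x within I)"
  proof (rule Lim_transform_eventually)
    have "((\<lambda>y. k y * r y * of_real (x - y)) \<longlongrightarrow> 0 * of_real (x - x)) (at x within I)"
      by (intro tendsto_intros kr0)
    then show "((\<lambda>y. k y * r y * of_real (x - y)) \<longlongrightarrow> 0) (at x within I)" by simp
    show "\<forall>\<^sub>F y in at x within I. k y * r y * of_real (x - y) = k y"
      unfolding eventually_at_filter by (intro always_eventually) (auto simp: r_def)
  qed
  have lim: "(h \<longlongrightarrow> h x) (at x within I)" if "continuous_on J h" for h :: "real \<Rightarrow> complex"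
    using that x J_open by (meson continuous_at_imp_continuous_at_within continuous_on_eq_continuous_at continuous_within)
  have "((\<lambda>y. weight \<alpha> \<beta> y * k y * (P y * D1 f y - f y * m y) + weight \<alpha> \<beta> y * f y * (\<mu> - 1) * P y * (k y * r y))
      \<longlongrightarrow> weight \<alpha> \<beta> x * 0 * (P x * D1 f x - f x * m x) + weight \<alpha> \<beta> x * f x * (\<mu> - 1) * P x * 0) (at x within I)"
    by (intro tendsto_intros k0 kr0 lim weight_cont f_cont P_cont m_cont)
  moreover have "(\<lambda>y. weight \<alpha> \<beta> y * k y * (P y * D1 f y - f y * m y) + weight \<alpha> \<beta> y * f y * (\<mu> - 1) * P y * (k y * r y)) = concomitant"
    by (auto simp: concomitant_def algebra_simps)
  ultimately show ?thesis by simp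
qed

end

text \<open>Valid even where no derivative exists: \<open>vector_derivative\<close> is a choice from
  the predicate of being a derivative, and this predicate is the same for f and g.\<close>

lemma D1_cong:
  assumes "open S" "z \<in> S" "\<And>s. s \<in> S \<Longrightarrow> f s = g s"
  shows "D1 f z = D1 g z" "f differentiable (at z) \<longleftrightarrow> g differentiable (at z)"
proof -
  have hd: "(f has_vector_derivative d) (at z) \<longleftrightarrow> (g has_vector_derivative d) (at z)" for d
  proof
    show "(g has_vector_derivative d) (at z)" if "(f has_vector_derivative d) (at z)"
      by (rule has_vector_derivative_transform_within_open[OF that assms])
    show "(f has_vector_derivative d) (at z)" if "(g has_vector_derivative d) (at z)"
      by (rule has_vector_derivative_transform_within_open[OF that assms(1,2)]) (rule assms(3)[symmetric])
  qed
  show "D1 f z = D1 g z" by (simp add: D1_def vector_derivative_def hd)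
  show "f differentiable (at z) \<longleftrightarrow> g differentiable (at z)"
  proof
    show "g differentiable (at z)" if "f differentiable (at z)"
      using that unfolding vector_derivative_works hd by (rule differentiableI_vector[unfolded vector_derivative_works])
    show "f differentiable (at z)" if "g differentiable (at z)"
      using that unfolding vector_derivative_works hd[symmetric] by (rule differentiableI_vector[unfolded vector_derivative_works])
  qed
qed

lemma hypergeom_op_cong:
  assumes S: "open S" "z \<in> S" "\<And>s. s \<in> S \<Longrightarrow> f s = g s"
  shows "hypergeom_op a b c f z = hypergeom_op a b c g z"
proof -
  have d: "D1 f s = D1 g s" if "s \<in> S" for s by (rule D1_cong(1)[OF S(1) that S(3)])
  have "D1 (D1 f) z = D1 (D1 g) z" by (rule D1_cong(1)[OF S(1,2) d])
  then show ?thesis unfolding hypergeom_op_def D2_def by (simp only: d[OF S(2)] S(3)[OF S(2)])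
qed

lemma twice_differentiable_at_cong:
  assumes S: "open S" "z \<in> S" "\<And>s. s \<in> S \<Longrightarrow> f s = g s" and g: "twice_differentiable_at g z"
  shows "twice_differentiable_at f z"
  unfolding twice_differentiable_at_def
proof
  have "\<forall>\<^sub>F t in nhds z. g differentiable at t" using g by (simp add: twice_differentiable_at_def)
  then show "\<forall>\<^sub>F t in nhds z. f differentiable at t"
    using eventually_nhds_in_open[OF S(1,2)]
  proof eventually_elim
    case (elim t)
    then show ?case using D1_cong(2)[OF S(1) elim(2) S(3)] by simp
  qed
  have "D1 g differentiable at z" using g by (simp add: twice_differentiable_at_def)
  then show "D1 f differentiable at z"
    using D1_cong(2)[OF S(1,2) D1_cong(1)[OF S(1) _ S(3)]] by simp
qed

section \<open>Integration of Lagrange's identity\<close>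

context transmutation_at
begin

lemma lhs_integral_eq:
  assumes s: "s \<in> J"
  shows "set_integrable lebesgue (interval_between x0 s) (\<lambda>y. f y * (w y / v s) * cpow \<bar>s - y\<bar> (\<mu> - 1))"
    and "(LINT y:interval_between x0 s|lebesgue. f y * (w y / v s) * cpow \<bar>s - y\<bar> (\<mu> - 1)) = F s"
proof -
  \<comment> \<open>Derivatives at x see a neighbourhood, so the identification with F is needed at
    every s in J; the results at x are reused with s as the fixed point.\<close>
  interpret at_s: transmutation_at a b c \<mu> a' b' c' \<alpha> \<beta> \<gamma> \<delta> x0 J w v w2 v2 f s
    by unfold_locales (rule s)
  let ?h = "\<lambda>y. f y * (w y / v s) * cpow \<bar>s - y\<bar> (\<mu> - 1)"
  have eq: "?h = (\<lambda>y. (g y * at_s.k y) * (1 / v s))" by (simp add: at_s.k_def)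
  have "continuous_on (interval_between x0 s) ?h"
    unfolding eq using at_s.I_cont at_s.k_cont by (intro continuous_intros) auto
  note L = lebesgue_lborel_continuous[OF open_interval_between(2) this]
  show "set_integrable lebesgue (interval_between x0 s) ?h"
    unfolding L(1) unfolding eq by (intro set_integrable_mult_left at_s.set_integrable_g)
  show "(LINT y:interval_between x0 s|lebesgue. ?h y) = F s"
    unfolding L(2) unfolding eq at_s.G_eq(1) by (rule set_integral_mult_left)
qed

lemma transmutation_identity:
  assumes C: "C \<ge> 0" "\<And>y. y \<in> I \<Longrightarrow> \<bar>w2 y\<bar> \<le> C"
    and l: "continuous_on I l" "\<And>y. y \<in> I \<Longrightarrow> l y > 0"
    and Pl: "\<And>y. y \<in> I \<Longrightarrow> \<bar>y * (1 - y)\<bar> \<le> C * (1 + \<bar>y\<bar>) * l y"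
    and ml: "\<And>y. y \<in> I \<Longrightarrow> \<bar>w2 y\<bar> * norm (m y) \<le> C * l y"
    and non_int: "\<And>t. t \<in> I \<Longrightarrow> \<not> set_integrable lborel (interval_between x0 t) (\<lambda>y. 1 / l y)"
    and ident: "\<And>y. y \<in> I \<Longrightarrow> of_real (w2 y) * adj y = of_real (v2 x) * (P x * (\<mu> - 1) * (\<mu> - 2) * r y ^ 2
        + (c' - (a' + b' + 1) * of_real x - 2 * P x * \<sigma> x) * (\<mu> - 1) * r y
        + (P x * (\<sigma> x ^ 2 - \<sigma>') - (c' - (a' + b' + 1) * of_real x) * \<sigma> x - a' * b'))"
  shows "set_integrable lebesgue I (\<lambda>y. f y * (w y / v x) * cpow \<bar>x - y\<bar> (\<mu> - 1))
    \<and> set_integrable lebesgue I (\<lambda>y. hypergeom_op a b c f y * (w y * of_real (w2 y) / (v x * of_real (v2 x))) * cpow \<bar>x - y\<bar> (\<mu> - 1))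
    \<and> twice_differentiable_at (\<lambda>s. LINT y:interval_between x0 s|lebesgue. f y * (w y / v s) * cpow \<bar>s - y\<bar> (\<mu> - 1)) x
    \<and> hypergeom_op a' b' c' (\<lambda>s. LINT y:interval_between x0 s|lebesgue. f y * (w y / v s) * cpow \<bar>s - y\<bar> (\<mu> - 1)) x
      = (LINT y:I|lebesgue. hypergeom_op a b c f y * (w y * of_real (w2 y) / (v x * of_real (v2 x))) * cpow \<bar>x - y\<bar> (\<mu> - 1))"
proof -
  define A2 where "A2 = P x"
  define A1 where "A1 = c' - (a' + b' + 1) * of_real x - 2 * P x * \<sigma> x"
  define A0 where "A0 = P x * (\<sigma> x ^ 2 - \<sigma>') - (c' - (a' + b' + 1) * of_real x) * \<sigma> x - a' * b'"
  define Lf where "Lf = (\<lambda>y. weight \<alpha> \<beta> y * k y * hypergeom_op a b c f y)"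
  \<comment> \<open>Up to the factor 1 / v x, this is the result of applying the target operator in
    x under the integral sign.\<close>
  define T where "T = (\<lambda>y. A2 * (\<mu> - 1) * (\<mu> - 2) * (g y * (k y * r y ^ 2)) + A1 * (\<mu> - 1) * (g y * (k y * r y)) + A0 * (g y * k y))"
  have ident': "of_real (w2 y) * adj y = of_real (v2 x) * (A2 * (\<mu> - 1) * (\<mu> - 2) * r y ^ 2 + A1 * (\<mu> - 1) * r y + A0)"
    if "y \<in> I" for y
    unfolding A2_def A1_def A0_def by (rule ident[OF that])
  have Lf_int: "set_integrable lborel I Lf" unfolding Lf_def by (rule rhs_integrable[OF C])
  have T_int: "set_integrable lborel I T"
    unfolding T_def by (intro set_integral_add set_integrable_mult_right set_integrable_g)
  have T_eq: "(LINT y:I|lborel. T y) = A2 * G2 + A1 * G1 x + A0 * rl_int x0 \<mu> g x"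
  proof -
    have "(LINT y:I|lborel. T y) = A2 * (\<mu> - 1) * (\<mu> - 2) * (LINT y:I|lborel. g y * (k y * r y ^ 2))
        + A1 * (\<mu> - 1) * (LINT y:I|lborel. g y * (k y * r y)) + A0 * (LINT y:I|lborel. g y * k y)"
      unfolding T_def set_integral_mult_right[symmetric]
      by (simp only: set_integral_add set_integrable_mult_right set_integrable_g)
    then show ?thesis unfolding G_eq by (simp only: mult.assoc)
  qed
  \<comment> \<open>By Lagrange's identity and the kernel identity the integrand is the derivative
    of the concomitant, so its integral consists of boundary terms.\<close>
  have "(LINT y:I|lborel. Lf y - of_real (v2 x) * T y) = 0"
  proof (rule integral_derivative_eq_0[where B = concomitant and l = l])
    show "x0 \<noteq> ereal x" by (rule x0_J[OF x])
    show "set_integrable lborel I (\<lambda>y. Lf y - of_real (v2 x) * T y)"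
      by (intro set_integral_diff Lf_int set_integrable_mult_right T_int)
    show "(concomitant has_vector_derivative Lf y - of_real (v2 x) * T y) (at y)" if y: "y \<in> I" for y
    proof -
      have "f y * k y * (weight \<alpha> \<beta> y * adj y) = f y * k y * w y * (of_real (w2 y) * adj y)"
        by (simp add: W_eq[OF in_I(1)[OF y], symmetric] mult_ac)
      also have "\<dots> = of_real (v2 x) * T y"
        unfolding ident'[OF y] T_def by (simp add: algebra_simps)
      finally show ?thesis
        using concomitant_deriv[OF in_I(1,2)[OF y]] by (simp add: Lf_def)
    qed
    show "continuous_on I (\<lambda>y. Lf y - of_real (v2 x) * T y)"
      unfolding Lf_def T_def
      by (intro continuous_intros I_cont k_cont r_cont continuous_on_subset[OF hypergeom_op_cont J_sub[OF x]])
    show "set_integrable lborel I (\<lambda>y. concomitant y / l y)"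
      by (rule concomitant_div_integrable[OF C l Pl ml])
    show "\<not> set_integrable lborel (interval_between x0 t) (\<lambda>y. 1 / l y)" if "t \<in> I" for t
      using that by (rule non_int)
  qed (fact l concomitant_tendsto)+
  then have main: "(LINT y:I|lborel. Lf y) = of_real (v2 x) * (A2 * G2 + A1 * G1 x + A0 * rl_int x0 \<mu> g x)"
    using Lf_int T_int by (simp add: set_integral_diff T_eq)
  have v2: "complex_of_real (v2 x) \<noteq> 0" using v2_nz[OF x] by simp
  let ?R = "\<lambda>y. hypergeom_op a b c f y * (w y * of_real (w2 y) / (v x * of_real (v2 x))) * cpow \<bar>x - y\<bar> (\<mu> - 1)"
  have R_eq: "1 / (v x * of_real (v2 x)) * Lf y = ?R y" if "y \<in> I" for y
    unfolding Lf_def k_def W_eq[OF in_I(1)[OF that], symmetric] by simp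
  have R_cont: "continuous_on I ?R"
  proof -
    have "continuous_on I (\<lambda>y. 1 / (v x * of_real (v2 x)) * Lf y)" unfolding Lf_def
      by (intro continuous_on_mult continuous_on_const I_cont k_cont continuous_on_subset[OF hypergeom_op_cont J_sub[OF x]])
    then show ?thesis by (rule continuous_on_eq) (rule R_eq)
  qed
  note R = lebesgue_lborel_continuous[OF open_interval_between(2) R_cont]
  have R_int: "set_integrable lborel I ?R"
    by (rule set_integrable_eqI[OF set_integrable_mult_right[OF Lf_int] R_eq])
  have "(LINT y:I|lborel. ?R y) = (LINT y:I|lborel. 1 / (v x * of_real (v2 x)) * Lf y)"
    by (rule set_lebesgue_integral_cong) (simp, intro allI impI, rule R_eq[symmetric])
  also have "\<dots> = 1 / (v x * of_real (v2 x)) * (LINT y:I|lborel. Lf y)" by (rule set_integral_mult_right)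
  also have "\<dots> = (1 / v x) * (A2 * G2 + A1 * G1 x + A0 * rl_int x0 \<mu> g x)"
    unfolding main using v2 by simp
  also have "\<dots> = hypergeom_op a' b' c' F x"
    unfolding hypergeom_op_F A2_def A1_def A0_def P_def by simp
  finally have "(LINT y:I|lborel. ?R y) = hypergeom_op a' b' c' F x" .
  moreover have "hypergeom_op a' b' c' (\<lambda>s. LINT y:interval_between x0 s|lebesgue. f y * (w y / v s) * cpow \<bar>s - y\<bar> (\<mu> - 1)) x
     = hypergeom_op a' b' c' F x"
    by (rule hypergeom_op_cong[OF J_open x]) (rule lhs_integral_eq(2))
  moreover have "twice_differentiable_at (\<lambda>s. LINT y:interval_between x0 s|lebesgue. f y * (w y / v s) * cpow \<bar>s - y\<bar> (\<mu> - 1)) x"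
    by (rule twice_differentiable_at_cong[OF J_open x _ twice_differentiable_F]) (rule lhs_integral_eq(2))
  ultimately show ?thesis
    using lhs_integral_eq(1)[OF x] R_int unfolding R by (intro conjI) simp_all
qed

end

section \<open>The eight cases\<close>

text \<open>\<open>adj_symbol\<close> is the adjoint hypergeometric operator in \<open>Y\<close> applied to
  \<open>Y\<^sup>\<alpha> (1 - Y)\<^sup>\<beta> (X - Y)\<^bsup>\<mu> - 1\<^esup>\<close>, divided by that function; \<open>op_symbol\<close> is the hypergeometric operator
  in \<open>X\<close> applied to \<open>X\<^bsup>-\<gamma>\<^esup> (1 - X)\<^bsup>-\<delta>\<^esup> (X - Y)\<^bsup>\<mu> - 1\<^esup>\<close>, divided likewise.\<close>

definition adj_symbol :: "complex \<Rightarrow> complex \<Rightarrow> complex \<Rightarrow> complex \<Rightarrow> complex \<Rightarrow> complex \<Rightarrow> complex \<Rightarrow> complex \<Rightarrow> complex" where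
  "adj_symbol a b c \<mu> \<alpha> \<beta> X Y =
     (\<alpha> / Y - \<beta> / (1 - Y)) * ((1 + \<alpha> - c) + (a + b - 1 - \<alpha> - \<beta>) * Y) + (a + b - 1 - \<alpha> - \<beta>) - a * b
     - (\<mu> - 1) * (1 / (X - Y)) * ((1 + \<alpha> - c) + (a + b - 1 - \<alpha> - \<beta>) * Y + Y * (1 - Y) * (\<alpha> / Y - \<beta> / (1 - Y)) + (1 - 2 * Y))
     + Y * (1 - Y) * (\<mu> - 1) * (\<mu> - 2) * (1 / (X - Y)) ^ 2"

definition op_symbol :: "complex \<Rightarrow> complex \<Rightarrow> complex \<Rightarrow> complex \<Rightarrow> complex \<Rightarrow> complex \<Rightarrow> complex \<Rightarrow> complex \<Rightarrow> complex" where
  "op_symbol a b c \<mu> \<gamma> \<delta> X Y =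
     X * (1 - X) * (\<mu> - 1) * (\<mu> - 2) * (1 / (X - Y)) ^ 2
     + (c - (a + b + 1) * X - 2 * (X * (1 - X)) * (\<gamma> / X - \<delta> / (1 - X))) * (\<mu> - 1) * (1 / (X - Y))
     + (X * (1 - X) * ((\<gamma> / X - \<delta> / (1 - X)) ^ 2 - (- \<gamma> / X ^ 2 - \<delta> / (1 - X) ^ 2))
        - (c - (a + b + 1) * X) * (\<gamma> / X - \<delta> / (1 - X)) - a * b)"

text \<open>Division by the kernel has removed all complex powers and absolute values, so each of
  the eight identities concerns rational functions and is proved by clearing denominators.\<close>

lemma symbol_eq_1:
  assumes "X \<noteq> 0" "Y \<noteq> 0" "X \<noteq> Y"
  shows "adj_symbol a b c \<mu> (c - 1) 0 X Y = op_symbol a b (c + \<mu>) \<mu> (c + \<mu> - 1) 0 X Y"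
  unfolding adj_symbol_def op_symbol_def using assms by (simp add: divide_simps) algebra

lemma symbol_eq_2:
  assumes "X \<noteq> 0" "Y \<noteq> 0" "1 - X \<noteq> 0" "1 - Y \<noteq> 0" "X \<noteq> Y"
  shows "(1 - Y) * adj_symbol a b c \<mu> (c - 1) (b - c - \<mu> + 1) X Y = (1 - X) * op_symbol (a + \<mu>) b (c + \<mu>) \<mu> (c + \<mu> - 1) (b - c) X Y"
  unfolding adj_symbol_def op_symbol_def using assms by (simp add: divide_simps) algebra

lemma symbol_eq_3:
  assumes "X \<noteq> 0" "Y \<noteq> 0" "1 - X \<noteq> 0" "1 - Y \<noteq> 0" "X \<noteq> Y"
  shows "adj_symbol a b c \<mu> (c - 1) (a + b - c) X Y = op_symbol (a + \<mu>) (b + \<mu>) (c + \<mu>) \<mu> (c + \<mu> - 1) (a + b - c + \<mu>) X Y"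
  unfolding adj_symbol_def op_symbol_def using assms by (simp add: divide_simps) algebra

lemma symbol_eq_4:
  assumes "X \<noteq> 0" "Y \<noteq> 0" "X \<noteq> Y"
  shows "Y * adj_symbol a b c \<mu> (a - \<mu>) 0 X Y = X * op_symbol (a - \<mu>) b c \<mu> (a - 1) 0 X Y"
  unfolding adj_symbol_def op_symbol_def using assms by (simp add: divide_simps) algebra

lemma symbol_eq_5:
  assumes "X \<noteq> 0" "Y \<noteq> 0" "1 - X \<noteq> 0" "1 - Y \<noteq> 0" "X \<noteq> Y"
  shows "Y * adj_symbol a b c \<mu> (c - a - \<mu>) (a + b - c) X Y = X * op_symbol (a + \<mu>) b c \<mu> (c - a - 1) (a + b - c + \<mu>) X Y"
  unfolding adj_symbol_def op_symbol_def using assms by (simp add: divide_simps) algebra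

lemma symbol_eq_6:
  assumes "X \<noteq> Y"
  shows "adj_symbol a b c \<mu> 0 0 X Y = op_symbol (a - \<mu>) (b - \<mu>) (c - \<mu>) \<mu> 0 0 X Y"
  unfolding adj_symbol_def op_symbol_def by (simp add: divide_simps assms) (simp add: algebra_simps power2_eq_square)

lemma symbol_eq_7:
  assumes "1 - X \<noteq> 0" "1 - Y \<noteq> 0" "X \<noteq> Y"
  shows "(1 - Y) * adj_symbol a b c \<mu> 0 (a - \<mu>) X Y = (1 - X) * op_symbol (a - \<mu>) b (c - \<mu>) \<mu> 0 (a - 1) X Y"
  unfolding adj_symbol_def op_symbol_def using assms by (simp add: divide_simps) algebra

lemma symbol_eq_8:
  assumes "1 - X \<noteq> 0" "1 - Y \<noteq> 0" "X \<noteq> Y"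
  shows "adj_symbol a b c \<mu> 0 (a + b - c) X Y = op_symbol a b (c - \<mu>) \<mu> 0 (a + b - c + \<mu>) X Y"
  unfolding adj_symbol_def op_symbol_def using assms by (simp add: divide_simps) algebra

text \<open>The reciprocal of \<open>l\<close> is not integrable at \<open>x0\<close>, while the bounds make the concomitant divided
  by \<open>l\<close> integrable. So the concomitant, which has a limit at \<open>x0\<close>, tends to \<open>0\<close> there.\<close>

definition boundary_control :: "ereal \<Rightarrow> real \<Rightarrow> (real \<Rightarrow> real) \<Rightarrow> (real \<Rightarrow> complex) \<Rightarrow> bool" where
  "boundary_control x0 x w2 m \<longleftrightarrow> (\<exists>l C. C \<ge> 0 \<and> continuous_on (interval_between x0 x) l
     \<and> (\<forall>t\<in>interval_between x0 x. \<not> set_integrable lborel (interval_between x0 t) (\<lambda>y. 1 / l y))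
     \<and> (\<forall>y\<in>interval_between x0 x. \<bar>w2 y\<bar> \<le> C \<and> l y > 0 \<and> \<bar>y * (1 - y)\<bar> \<le> C * (1 + \<bar>y\<bar>) * l y
          \<and> \<bar>w2 y\<bar> * norm (m y) \<le> C * l y))"

text \<open>Take l = |y|. The factor P vanishes at 0 anyway. For w2 m a factor |y| is also required:
  it comes from m if the constant term A is 0, and from w2 otherwise.\<close>

lemma boundary_control_0:
  assumes x: "x < 1" "x \<noteq> 0" and w2: "\<And>y. y \<in> interval_between 0 x \<Longrightarrow> \<bar>w2 y\<bar> \<le> 1 + \<bar>x\<bar>"
    and A: "A = 0 \<or> w2 = abs"
  shows "boundary_control 0 x w2 (\<lambda>y. A + B * complex_of_real y)"
proof -
  define N where "N = norm A + norm B"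
  define C where "C = (1 + \<bar>x\<bar>) * (1 + N)"
  have N0: "N \<ge> 0" by (simp add: N_def)
  have C1: "1 + \<bar>x\<bar> \<le> C" using N0 by (simp add: C_def algebra_simps)
  have I: "y \<noteq> 0 \<and> \<bar>y\<bar> \<le> \<bar>x\<bar>" if "y \<in> interval_between 0 x" for y
    using that by (auto simp: in_interval_between)
  show ?thesis
    unfolding boundary_control_def
  proof (intro exI[of _ "\<lambda>y. \<bar>y\<bar>"] exI[of _ C] conjI ballI)
    show "0 \<le> C" using C1 by simp
    show "continuous_on (interval_between 0 x) (\<lambda>y. \<bar>y\<bar>)" by (intro continuous_intros)
    fix y assume y: "y \<in> interval_between 0 x"
    show "\<not> set_integrable lborel (interval_between 0 y) (\<lambda>y. 1 / \<bar>y\<bar>)"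
      using I[OF y] by (intro not_integrable_inverse_at_0) auto
    show "\<bar>w2 y\<bar> \<le> C" using w2[OF y] C1 by simp
    show "0 < \<bar>y\<bar>" using I[OF y] by simp
    have "\<bar>1 - y\<bar> \<le> 1 + \<bar>y\<bar>" by simp
    also have "\<dots> \<le> C * (1 + \<bar>y\<bar>)" using C1 mult_right_mono[of 1 C "1 + \<bar>y\<bar>"] by simp
    finally have "\<bar>1 - y\<bar> * \<bar>y\<bar> \<le> C * (1 + \<bar>y\<bar>) * \<bar>y\<bar>" by (rule mult_right_mono) simp
    then show "\<bar>y * (1 - y)\<bar> \<le> C * (1 + \<bar>y\<bar>) * \<bar>y\<bar>" by (simp add: abs_mult mult.commute)
    show "\<bar>w2 y\<bar> * norm (A + B * complex_of_real y) \<le> C * \<bar>y\<bar>"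
      using A
    proof
      assume A0: "A = 0"
      have "\<bar>w2 y\<bar> * norm B \<le> (1 + \<bar>x\<bar>) * (1 + N)"
        using w2[OF y] by (intro mult_mono) (auto simp: N_def)
      then have "\<bar>w2 y\<bar> * norm B * \<bar>y\<bar> \<le> C * \<bar>y\<bar>"
        unfolding C_def by (rule mult_right_mono) simp
      then show ?thesis by (simp add: A0 norm_mult mult_ac)
    next
      assume w2': "w2 = abs"
      have "norm (A + B * complex_of_real y) \<le> N * (1 + \<bar>y\<bar>)" unfolding N_def by (rule norm_linear_le)
      also have "\<dots> \<le> (1 + N) * (1 + \<bar>x\<bar>)" using I[OF y] N0 by (intro mult_mono) auto
      also have "\<dots> = C" by (simp add: C_def mult.commute)
      finally have "\<bar>y\<bar> * norm (A + B * complex_of_real y) \<le> \<bar>y\<bar> * C" by (rule mult_left_mono) simp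
      then show ?thesis by (simp add: w2' mult.commute)
    qed
  qed
qed

text \<open>Take l = 1 - y: P contains this factor, and w2 supplies it for w2 m, whatever the affine
  function m is.\<close>

lemma boundary_control_1:
  assumes x: "x < 1"
  shows "boundary_control 1 x (\<lambda>y. 1 - y) (\<lambda>y. A + B * complex_of_real y)"
proof -
  define N where "N = norm A + norm B"
  define C where "C = (2 + \<bar>x\<bar>) * (1 + N)"
  have N0: "N \<ge> 0" by (simp add: N_def)
  have C1: "2 + \<bar>x\<bar> \<le> C" using N0 by (simp add: C_def algebra_simps)
  have I: "x < y \<and> y < 1" if "y \<in> interval_between 1 x" for y
    using that x by (auto simp: in_interval_between one_ereal_def)
  show ?thesis
    unfolding boundary_control_def
  proof (intro exI[of _ "\<lambda>y. 1 - y"] exI[of _ C] conjI ballI)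
    show "0 \<le> C" using C1 by simp
    show "continuous_on (interval_between 1 x) (\<lambda>y. 1 - y)" by (intro continuous_intros)
    fix y assume y: "y \<in> interval_between 1 x"
    show "\<not> set_integrable lborel (interval_between 1 y) (\<lambda>y. 1 / (1 - y))"
      using I[OF y] by (intro not_integrable_inverse_at_1) auto
    show "\<bar>1 - y\<bar> \<le> C" using I[OF y] C1 by linarith
    show y1: "0 < 1 - y" using I[OF y] by simp
    have "\<bar>y\<bar> \<le> 1 + \<bar>y\<bar>" by simp
    also have "\<dots> \<le> C * (1 + \<bar>y\<bar>)" using C1 mult_right_mono[of 1 C "1 + \<bar>y\<bar>"] by simp
    finally have "\<bar>y\<bar> * (1 - y) \<le> C * (1 + \<bar>y\<bar>) * (1 - y)" by (rule mult_right_mono) (use y1 in simp)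
    then show "\<bar>y * (1 - y)\<bar> \<le> C * (1 + \<bar>y\<bar>) * (1 - y)" using y1 by (simp add: abs_mult)
    have "norm (A + B * complex_of_real y) \<le> N * (1 + \<bar>y\<bar>)" unfolding N_def by (rule norm_linear_le)
    also have "\<dots> \<le> (1 + N) * (2 + \<bar>x\<bar>)" using I[OF y] N0 by (intro mult_mono) auto
    also have "\<dots> = C" by (simp add: C_def mult.commute)
    finally have "(1 - y) * norm (A + B * complex_of_real y) \<le> (1 - y) * C"
      by (rule mult_left_mono) (use y1 in simp)
    then show "\<bar>1 - y\<bar> * norm (A + B * complex_of_real y) \<le> C * (1 - y)"
      using y1 by (simp add: mult.commute)
  qed
qed

text \<open>Here l = 1 - y grows linearly, which suffices to absorb the affine function m, while 1 /
  l still has a divergent integral at minus infinity.\<close>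

lemma boundary_control_minus_infinity:
  assumes x: "x < 1"
  shows "boundary_control (-\<infinity>) x (\<lambda>y. 1) (\<lambda>y. A + B * complex_of_real y)"
proof -
  define N where "N = norm A + norm B"
  \<comment> \<open>For y < 0 one has 1 + |y| = 1 - y, so the constant 1 would do. For 0 \<le> y < x
    the left side is below 2 and 1 - y > 1 - x, whence 2 / (1 - x).\<close>
  define K where "K = 1 + 2 / (1 - x)"
  define C where "C = (1 + N) * K"
  have N0: "N \<ge> 0" by (simp add: N_def)
  have K1: "1 \<le> K" using x by (simp add: K_def)
  have C1: "1 \<le> C" using N0 K1 mult_mono[of 1 "1 + N" 1 K] by (simp add: C_def)
  have I: "y < x" if "y \<in> interval_between (-\<infinity>) x" for y
    using that x by (auto simp: in_interval_between)
  have K: "1 + \<bar>y\<bar> \<le> K * (1 - y)" if "y < x" for y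
  proof (cases "y \<ge> 0")
    case True
    have "2 / (1 - x) * (1 - x) \<le> K * (1 - y)"
      using x that K1 by (intro mult_mono) (auto simp: K_def)
    moreover have "2 / (1 - x) * (1 - x) = 2" using x by (metis diff_gt_0_iff_gt less_irrefl nonzero_divide_eq_eq)
    ultimately have "2 \<le> K * (1 - y)" by (simp only:)
    moreover have "1 + \<bar>y\<bar> \<le> 2" using True x that by simp
    ultimately show ?thesis by linarith
  next
    case False
    then show ?thesis using mult_right_mono[OF K1, of "1 - y"] by simp
  qed
  show ?thesis
    unfolding boundary_control_def
  proof (intro exI[of _ "\<lambda>y. 1 - y"] exI[of _ C] conjI ballI)
    show "0 \<le> C" using C1 by simp
    show "continuous_on (interval_between (-\<infinity>) x) (\<lambda>y. 1 - y)" by (intro continuous_intros)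
    fix y assume y: "y \<in> interval_between (-\<infinity>) x"
    show "\<not> set_integrable lborel (interval_between (-\<infinity>) y) (\<lambda>y. 1 / (1 - y))"
      using I[OF y] x by (intro not_integrable_inverse_at_minus_infinity) auto
    show "\<bar>1\<bar> \<le> C" using C1 by simp
    show y1: "0 < 1 - y" using I[OF y] x by simp
    have "\<bar>y\<bar> \<le> 1 + \<bar>y\<bar>" by simp
    also have "\<dots> \<le> C * (1 + \<bar>y\<bar>)" using C1 mult_right_mono[of 1 C "1 + \<bar>y\<bar>"] by simp
    finally have "\<bar>y\<bar> * (1 - y) \<le> C * (1 + \<bar>y\<bar>) * (1 - y)" by (rule mult_right_mono) (use y1 in simp)
    then show "\<bar>y * (1 - y)\<bar> \<le> C * (1 + \<bar>y\<bar>) * (1 - y)" using y1 by (simp add: abs_mult)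
    have "norm (A + B * complex_of_real y) \<le> N * (1 + \<bar>y\<bar>)" unfolding N_def by (rule norm_linear_le)
    also have "\<dots> \<le> (1 + N) * (K * (1 - y))" using K[OF I[OF y]] N0 by (intro mult_mono) auto
    finally show "\<bar>1\<bar> * norm (A + B * complex_of_real y) \<le> C * (1 - y)" by (simp add: C_def mult_ac)
  qed
qed

section \<open>Verification of the hypotheses case by case\<close>

lemma weight_eq_cpow:
  "y \<noteq> 0 \<Longrightarrow> weight \<alpha> \<beta> y = cpow \<bar>y\<bar> \<alpha> * cpow (1 - y) \<beta>"
  "weight 0 \<beta> y = cpow (1 - y) \<beta>"
  by (auto simp: weight_def)

lemma cpow_mult_base: "t > 0 \<Longrightarrow> cpow t s * of_real t = cpow t (s + 1)"
  using cpow_diff_one[of t "s + 1"] by simp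

definition transmutes ::
    "complex \<Rightarrow> complex \<Rightarrow> complex \<Rightarrow> complex \<Rightarrow> transmutation \<Rightarrow> (real \<Rightarrow> complex) \<Rightarrow> real \<Rightarrow> bool" where
  "transmutes a b c \<mu> T f x \<longleftrightarrow>
     set_integrable lebesgue (interval_between (tr_x0 T) x) (lhs_integrand T \<mu> f x)
     \<and> set_integrable lebesgue (interval_between (tr_x0 T) x)
         (rhs_integrand T \<mu> (hypergeom_op a b c f) x)
     \<and> twice_differentiable_at
         (\<lambda>s. LINT y:interval_between (tr_x0 T) s|lebesgue. lhs_integrand T \<mu> f s y) x
     \<and> hypergeom_op (tr_a T) (tr_b T) (tr_c T)
         (\<lambda>s. LINT y:interval_between (tr_x0 T) s|lebesgue. lhs_integrand T \<mu> f s y) x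
       = (LINT y:interval_between (tr_x0 T) x|lebesgue.
            rhs_integrand T \<mu> (hypergeom_op a b c f) x y)"

locale admissible_function =
  fixes \<mu> :: complex and T :: transmutation and f :: "real \<Rightarrow> complex"
  assumes mu: "Re \<mu> > 2"
    and f: "C2_on (tr_J T) f"
    and L1_2: "L1_at (tr_x0 T) (tr_J T)
           (\<lambda>y. D2 f y * of_real (y * (1 - y)) * tr_w T y * of_real (tr_w2 T y)
                 * of_real ((1 + \<bar>y\<bar>) powr (Re \<mu> - 1)))"
    and L1_1: "L1_at (tr_x0 T) (tr_J T)
           (\<lambda>y. D1 f y * tr_w T y * of_real (tr_w2 T y) * of_real ((1 + \<bar>y\<bar>) powr Re \<mu>))"
    and L1_0: "L1_at (tr_x0 T) (tr_J T)
           (\<lambda>y. f y * tr_w T y * of_real ((1 + \<bar>y\<bar>) powr (Re \<mu> - 1)))"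
begin

lemma transmutation_case:
  assumes J: "open (tr_J T)" "\<And>s. s \<in> tr_J T \<Longrightarrow> s < 1"
    and J_sub: "\<And>s. s \<in> tr_J T \<Longrightarrow> interval_between (tr_x0 T) s \<subseteq> tr_J T"
    and x0_J: "\<And>s. s \<in> tr_J T \<Longrightarrow> tr_x0 T \<noteq> ereal s"
    and \<alpha>\<gamma>: "\<alpha> = 0 \<or> 0 \<notin> tr_J T" "\<gamma> = 0 \<or> 0 \<notin> tr_J T"
    and w2: "continuous_on (tr_J T) (tr_w2 T)" "\<And>y. y \<in> tr_J T \<Longrightarrow> tr_w2 T y \<noteq> 0"
    and v2: "\<And>y. y \<in> tr_J T \<Longrightarrow> tr_v2 T y \<noteq> 0"
    and W: "\<And>y. y \<in> tr_J T \<Longrightarrow> tr_w T y * of_real (tr_w2 T y) = weight \<alpha> \<beta> y"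
    and v: "\<And>y. y \<in> tr_J T \<Longrightarrow> tr_v T y = weight \<gamma> \<delta> y"
    and bc: "\<And>x. x \<in> tr_J T \<Longrightarrow> boundary_control (tr_x0 T) x (tr_w2 T)
        (\<lambda>y. (1 + \<alpha> - c) + (a + b - 1 - \<alpha> - \<beta>) * complex_of_real y)"
    and symbol: "\<And>x y. x \<in> tr_J T \<Longrightarrow> y \<in> interval_between (tr_x0 T) x \<Longrightarrow>
        of_real (tr_w2 T y) * adj_symbol a b c \<mu> \<alpha> \<beta> (of_real x) (of_real y)
        = of_real (tr_v2 T x) * op_symbol (tr_a T) (tr_b T) (tr_c T) \<mu> \<gamma> \<delta> (of_real x) (of_real y)"
  shows "\<forall>x\<in>tr_J T. transmutes a b c \<mu> T f x"
proof
  fix x assume x: "x \<in> tr_J T"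
  have "continuous_on (tr_J T) (weight \<alpha> \<beta>)"
  proof (intro continuous_at_imp_continuous_on ballI)
    fix y assume "y \<in> tr_J T"
    then show "isCont (weight \<alpha> \<beta>) y"
      using \<alpha>\<gamma>(1) J(2) by (intro has_vector_derivative_continuous[OF has_vector_derivative_weight]) auto
  qed
  then have "continuous_on (tr_J T) (\<lambda>y. weight \<alpha> \<beta> y / of_real (tr_w2 T y))"
    using w2 by (intro continuous_intros) auto
  then have w_cont: "continuous_on (tr_J T) (tr_w T)"
  proof (rule continuous_on_eq)
    fix y assume y: "y \<in> tr_J T"
    show "weight \<alpha> \<beta> y / of_real (tr_w2 T y) = tr_w T y"
      using w2(2)[OF y] unfolding W[OF y, symmetric] by simp
  qed
  interpret transmutation_at a b c \<mu> "tr_a T" "tr_b T" "tr_c T" \<alpha> \<beta> \<gamma> \<delta> "tr_x0 T" "tr_J T"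
    "tr_w T" "tr_v T" "tr_w2 T" "tr_v2 T" f x
  proof unfold_locales
    show "tr_J T \<subseteq> {..<1}" using J(2) by auto
  qed (fact mu f L1_2 L1_1 L1_0 J J_sub x0_J \<alpha>\<gamma> w2 v2 W v w_cont x)+
  have m: "m = (\<lambda>y. (1 + \<alpha> - c) + (a + b - 1 - \<alpha> - \<beta>) * complex_of_real y)"
    by (simp add: m_def fun_eq_iff)
  obtain l C where lC: "C \<ge> 0" "continuous_on I l"
     "\<And>t. t \<in> I \<Longrightarrow> \<not> set_integrable lborel (interval_between (tr_x0 T) t) (\<lambda>y. 1 / l y)"
     "\<And>y. y \<in> I \<Longrightarrow> \<bar>tr_w2 T y\<bar> \<le> C \<and> l y > 0 \<and> \<bar>y * (1 - y)\<bar> \<le> C * (1 + \<bar>y\<bar>) * l y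
          \<and> \<bar>tr_w2 T y\<bar> * norm (m y) \<le> C * l y"
    using bc[OF x] unfolding boundary_control_def m[symmetric] by blast
  have adj_eq: "adj y = adj_symbol a b c \<mu> \<alpha> \<beta> (of_real x) (of_real y)" for y
    by (simp add: adj_def adj_symbol_def m_def P_def r_def log_deriv_def)
  show "transmutes a b c \<mu> T f x"
    unfolding transmutes_def lhs_integrand_def[abs_def] rhs_integrand_def[abs_def]
  proof (rule transmutation_identity[of C l])
    fix y assume y: "y \<in> I"
    have "op_symbol (tr_a T) (tr_b T) (tr_c T) \<mu> \<gamma> \<delta> (of_real x) (of_real y) =
       P x * (\<mu> - 1) * (\<mu> - 2) * r y ^ 2
        + (tr_c T - (tr_a T + tr_b T + 1) * of_real x - 2 * P x * \<sigma> x) * (\<mu> - 1) * r y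
        + (P x * (\<sigma> x ^ 2 - \<sigma>') - (tr_c T - (tr_a T + tr_b T + 1) * of_real x) * \<sigma> x - tr_a T * tr_b T)"
      by (simp add: op_symbol_def P_def r_def log_deriv_def \<sigma>'_def)
    then show "of_real (tr_w2 T y) * adj y = of_real (tr_v2 T x) * (P x * (\<mu> - 1) * (\<mu> - 2) * r y ^ 2
        + (tr_c T - (tr_a T + tr_b T + 1) * of_real x - 2 * P x * \<sigma> x) * (\<mu> - 1) * r y
        + (P x * (\<sigma> x ^ 2 - \<sigma>') - (tr_c T - (tr_a T + tr_b T + 1) * of_real x) * \<sigma> x - tr_a T * tr_b T))"
      using symbol[OF x y] by (simp only: adj_eq)
  qed (use lC in auto)
qed

text \<open>\<omega> is the polynomial counterpart of w2 in the rational identity. The condition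
  \<alpha> = c - 1 in the first two alternatives makes m vanish at 0; in the third, w2 = |y| does
  this work.\<close>

lemma transmutation_case_0:
  assumes T: "tr_J T = {..<0} \<union> {0<..<1}" "tr_x0 T = 0" "tr_v2 T = tr_w2 T"
    and w2: "tr_w2 T = (\<lambda>y. 1) \<and> \<omega> = (\<lambda>Y. 1) \<and> \<alpha> = c - 1
      \<or> tr_w2 T = (\<lambda>y. 1 - y) \<and> \<omega> = (\<lambda>Y. 1 - Y) \<and> \<alpha> = c - 1
      \<or> tr_w2 T = abs \<and> \<omega> = (\<lambda>Y. Y)"
    and W: "\<And>y. y \<noteq> 0 \<Longrightarrow> y < 1 \<Longrightarrow> tr_w T y * of_real (tr_w2 T y) = weight \<alpha> \<beta> y"
    and v: "\<And>y. y \<noteq> 0 \<Longrightarrow> y < 1 \<Longrightarrow> tr_v T y = weight \<gamma> \<delta> y"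
    and symbol: "\<And>X Y. X \<noteq> 0 \<Longrightarrow> Y \<noteq> 0 \<Longrightarrow> 1 - X \<noteq> 0 \<Longrightarrow> 1 - Y \<noteq> 0 \<Longrightarrow> X \<noteq> Y \<Longrightarrow>
        \<omega> Y * adj_symbol a b c \<mu> \<alpha> \<beta> X Y = \<omega> X * op_symbol (tr_a T) (tr_b T) (tr_c T) \<mu> \<gamma> \<delta> X Y"
  shows "\<forall>x\<in>tr_J T. transmutes a b c \<mu> T f x"
proof (rule transmutation_case[of \<alpha> \<gamma> \<beta> \<delta>])
  have J: "s \<noteq> 0 \<and> s < 1" if "s \<in> tr_J T" for s using that T(1) by auto
  show "open (tr_J T)" by (simp add: T open_Un)
  show "continuous_on (tr_J T) (tr_w2 T)"
    using w2 continuous_on_op_minus[of "tr_J T" "1::real"] continuous_on_rabs[OF continuous_on_id, of "tr_J T"] by auto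
  fix x assume x: "x \<in> tr_J T"
  have w2_nz: "tr_w2 T x \<noteq> 0" using w2 J[OF x] by auto
  then show "tr_w2 T x \<noteq> 0" "tr_v2 T x \<noteq> 0" by (simp_all add: T)
  show "x < 1" "tr_w T x * of_real (tr_w2 T x) = weight \<alpha> \<beta> x" "tr_v T x = weight \<gamma> \<delta> x"
    using J[OF x] W v by auto
  show "interval_between (tr_x0 T) x \<subseteq> tr_J T" "tr_x0 T \<noteq> ereal x"
    using J[OF x] by (auto simp: T in_interval_between)
  have I: "y \<noteq> 0 \<and> y < 1 \<and> x \<noteq> y \<and> \<bar>y\<bar> \<le> 1 + \<bar>x\<bar> \<and> \<bar>1 - y\<bar> \<le> 1 + \<bar>x\<bar> \<and> (y > 0 \<longleftrightarrow> x > 0)"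
    if "y \<in> interval_between (tr_x0 T) x" for y
    using that J[OF x] by (auto simp: T in_interval_between)
  show "boundary_control (tr_x0 T) x (tr_w2 T) (\<lambda>y. (1 + \<alpha> - c) + (a + b - 1 - \<alpha> - \<beta>) * complex_of_real y)"
    unfolding T(2)
  proof (rule boundary_control_0)
    show "\<bar>tr_w2 T y\<bar> \<le> 1 + \<bar>x\<bar>" if "y \<in> interval_between 0 x" for y
      using w2 I[of y] that by (auto simp: T)
  qed (use w2 J[OF x] in auto)
  fix y assume y: "y \<in> interval_between (tr_x0 T) x"
  note xy = J[OF x] I[OF y]
  have "1 - complex_of_real x \<noteq> 0" "1 - complex_of_real y \<noteq> 0" using xy by auto
  then have sym: "\<omega> (of_real y) * adj_symbol a b c \<mu> \<alpha> \<beta> (of_real x) (of_real y)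
      = \<omega> (of_real x) * op_symbol (tr_a T) (tr_b T) (tr_c T) \<mu> \<gamma> \<delta> (of_real x) (of_real y)"
    using xy by (intro symbol) auto
  \<comment> \<open>For w2 = |y| the identity is available with Y and X in place of |Y| and |X|. As
    x and y lie on the same side of 0, the two forms differ by a common sign.\<close>
  have "tr_w2 T = abs \<and> \<omega> = (\<lambda>Y. Y) \<or> (\<forall>t. of_real (tr_w2 T t) = \<omega> (of_real t))"
    using w2 by auto
  then show "of_real (tr_w2 T y) * adj_symbol a b c \<mu> \<alpha> \<beta> (of_real x) (of_real y)
        = of_real (tr_v2 T x) * op_symbol (tr_a T) (tr_b T) (tr_c T) \<mu> \<gamma> \<delta> (of_real x) (of_real y)"
  proof
    assume "tr_w2 T = abs \<and> \<omega> = (\<lambda>Y. Y)"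
    then show ?thesis using sym xy by (cases "x > 0") (auto simp: T)
  next
    assume "\<forall>t. of_real (tr_w2 T t) = \<omega> (of_real t)"
    then show ?thesis using sym by (simp add: T)
  qed
qed (auto simp: T)

text \<open>J contains 0, so the powers of |y| must be absent and the identity must hold also for X
  = 0 or Y = 0. There the quotients 0 / X and 0 / Y are 0, in agreement with
  \<open>log_deriv\<close>.\<close>

lemma transmutation_case_halfline:
  assumes T: "tr_J T = {..<1}" "tr_v2 T = tr_w2 T"
    and w2: "tr_w2 T = (\<lambda>y. 1) \<and> \<omega> = (\<lambda>Y. 1) \<and> tr_x0 T = -\<infinity>
      \<or> tr_w2 T = (\<lambda>y. 1 - y) \<and> \<omega> = (\<lambda>Y. 1 - Y) \<and> tr_x0 T = 1"
    and W: "\<And>y. y < 1 \<Longrightarrow> tr_w T y * of_real (tr_w2 T y) = weight 0 \<beta> y"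
    and v: "\<And>y. y < 1 \<Longrightarrow> tr_v T y = weight 0 \<delta> y"
    and symbol: "\<And>X Y. 1 - X \<noteq> 0 \<Longrightarrow> 1 - Y \<noteq> 0 \<Longrightarrow> X \<noteq> Y \<Longrightarrow>
        \<omega> Y * adj_symbol a b c \<mu> 0 \<beta> X Y = \<omega> X * op_symbol (tr_a T) (tr_b T) (tr_c T) \<mu> 0 \<delta> X Y"
  shows "\<forall>x\<in>tr_J T. transmutes a b c \<mu> T f x"
proof (rule transmutation_case[of 0 0 \<beta> \<delta>])
  have J: "s < 1" if "s \<in> tr_J T" for s using that T(1) by auto
  show "open (tr_J T)" by (simp add: T)
  show "continuous_on (tr_J T) (tr_w2 T)"
    using w2 continuous_on_op_minus[of "tr_J T" "1::real"] continuous_on_rabs[OF continuous_on_id, of "tr_J T"] by auto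
  fix x assume x: "x \<in> tr_J T"
  have w2_nz: "tr_w2 T x \<noteq> 0" using w2 J[OF x] by auto
  then show "tr_w2 T x \<noteq> 0" "tr_v2 T x \<noteq> 0" by (simp_all add: T)
  show "x < 1" "tr_w T x * of_real (tr_w2 T x) = weight 0 \<beta> x" "tr_v T x = weight 0 \<delta> x"
    using J[OF x] W v by auto
  show "interval_between (tr_x0 T) x \<subseteq> tr_J T" "tr_x0 T \<noteq> ereal x"
    using w2 J[OF x] by (auto simp: T in_interval_between one_ereal_def)
  have I: "y < 1 \<and> x \<noteq> y" if "y \<in> interval_between (tr_x0 T) x" for y
    using that w2 J[OF x] by (auto simp: in_interval_between one_ereal_def)
  show "boundary_control (tr_x0 T) x (tr_w2 T) (\<lambda>y. (1 + 0 - c) + (a + b - 1 - 0 - \<beta>) * complex_of_real y)"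
    using w2 boundary_control_1[OF J[OF x]] boundary_control_minus_infinity[OF J[OF x]] by auto
  fix y assume y: "y \<in> interval_between (tr_x0 T) x"
  note xy = J[OF x] I[OF y]
  have "1 - complex_of_real x \<noteq> 0" "1 - complex_of_real y \<noteq> 0" using xy by auto
  then have sym: "\<omega> (of_real y) * adj_symbol a b c \<mu> 0 \<beta> (of_real x) (of_real y)
      = \<omega> (of_real x) * op_symbol (tr_a T) (tr_b T) (tr_c T) \<mu> 0 \<delta> (of_real x) (of_real y)"
    using xy by (intro symbol) auto
  have "of_real (tr_w2 T t) = \<omega> (of_real t)" for t using w2 by auto
  then show "of_real (tr_w2 T y) * adj_symbol a b c \<mu> 0 \<beta> (of_real x) (of_real y)
        = of_real (tr_v2 T x) * op_symbol (tr_a T) (tr_b T) (tr_c T) \<mu> 0 \<delta> (of_real x) (of_real y)"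
    using sym by (simp add: T)
qed auto

end

theorem mainTheorem7:
  fixes a b c \<mu> :: complex and T :: transmutation and f :: "real \<Rightarrow> complex"
  assumes "Re \<mu> > 2"
    and "T \<in> transmutations a b c \<mu>"
    and "C2_on (tr_J T) f"
    and "L1_at (tr_x0 T) (tr_J T)
           (\<lambda>y. D2 f y * of_real (y * (1 - y)) * tr_w T y * of_real (tr_w2 T y)
                 * of_real ((1 + \<bar>y\<bar>) powr (Re \<mu> - 1)))"
    and "L1_at (tr_x0 T) (tr_J T)
           (\<lambda>y. D1 f y * tr_w T y * of_real (tr_w2 T y) * of_real ((1 + \<bar>y\<bar>) powr Re \<mu>))"
    and "L1_at (tr_x0 T) (tr_J T)
           (\<lambda>y. f y * tr_w T y * of_real ((1 + \<bar>y\<bar>) powr (Re \<mu> - 1)))"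
  shows "\<forall>x\<in>tr_J T.
           set_integrable lebesgue (interval_between (tr_x0 T) x) (lhs_integrand T \<mu> f x)
         \<and> set_integrable lebesgue (interval_between (tr_x0 T) x)
             (rhs_integrand T \<mu> (hypergeom_op a b c f) x)
         \<and> twice_differentiable_at
             (\<lambda>s. LINT y:interval_between (tr_x0 T) s|lebesgue. lhs_integrand T \<mu> f s y) x
         \<and> hypergeom_op (tr_a T) (tr_b T) (tr_c T)
             (\<lambda>s. LINT y:interval_between (tr_x0 T) s|lebesgue. lhs_integrand T \<mu> f s y) x
           = (LINT y:interval_between (tr_x0 T) x|lebesgue.
                rhs_integrand T \<mu> (hypergeom_op a b c f) x y)"
proof -
  interpret admissible_function \<mu> T f
    by unfold_locales (fact assms)+
  have "\<forall>x\<in>tr_J T. transmutes a b c \<mu> T f x"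
    using assms(2) unfolding transmutations_def
  proof (elim insertE emptyE, goal_cases)
    case T: 1
    show ?case
      by (rule transmutation_case_0[where \<omega> = "\<lambda>Y. 1" and \<alpha> = "c - 1" and \<beta> = 0 and \<gamma> = "c + \<mu> - 1" and \<delta> = 0])
         (auto simp: T weight_eq_cpow symbol_eq_1)
  next
    case T: 2
    show ?case
    \<comment> \<open>\<beta> is the exponent of w w2, so the factor w2 = 1 - y adds 1 to the
      exponent of w. The exponents of w in cases 4, 5 and 7 are shifted in the same way.\<close>
    proof (rule transmutation_case_0[where \<omega> = "\<lambda>Y. 1 - Y" and \<alpha> = "c - 1" and \<beta> = "b - c - \<mu> + 1" and \<gamma> = "c + \<mu> - 1" and \<delta> = "b - c"])
      fix y :: real assume "y \<noteq> 0" "y < 1"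
      then show "tr_w T y * of_real (tr_w2 T y) = weight (c - 1) (b - c - \<mu> + 1) y"
        using cpow_mult_base[of "1 - y" "b - c - \<mu>"] by (simp add: T weight_eq_cpow)
    qed (auto simp: T weight_eq_cpow symbol_eq_2)
  next
    case T: 3
    show ?case
      by (rule transmutation_case_0[where \<omega> = "\<lambda>Y. 1" and \<alpha> = "c - 1" and \<beta> = "a + b - c" and \<gamma> = "c + \<mu> - 1" and \<delta> = "a + b - c + \<mu>"])
         (auto simp: T weight_eq_cpow symbol_eq_3)
  next
    case T: 4
    show ?case
    proof (rule transmutation_case_0[where \<omega> = "\<lambda>Y. Y" and \<alpha> = "a - \<mu>" and \<beta> = 0 and \<gamma> = "a - 1" and \<delta> = 0])
      fix y :: real assume "y \<noteq> 0" "y < 1"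
      then show "tr_w T y * of_real (tr_w2 T y) = weight (a - \<mu>) 0 y"
        using cpow_mult_base[of "\<bar>y\<bar>" "a - \<mu> - 1"] by (simp add: T weight_eq_cpow)
    qed (auto simp: T weight_eq_cpow symbol_eq_4)
  next
    case T: 5
    show ?case
    proof (rule transmutation_case_0[where \<omega> = "\<lambda>Y. Y" and \<alpha> = "c - a - \<mu>" and \<beta> = "a + b - c" and \<gamma> = "c - a - 1" and \<delta> = "a + b - c + \<mu>"])
      fix y :: real assume "y \<noteq> 0" "y < 1"
      then show "tr_w T y * of_real (tr_w2 T y) = weight (c - a - \<mu>) (a + b - c) y"
        using cpow_mult_base[of "\<bar>y\<bar>" "c - a - \<mu> - 1"] by (simp add: T weight_eq_cpow)
    qed (auto simp: T weight_eq_cpow symbol_eq_5)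
  next
    case T: 6
    show ?case
      by (rule transmutation_case_halfline[where \<omega> = "\<lambda>Y. 1" and \<beta> = 0 and \<delta> = 0])
         (auto simp: T weight_eq_cpow symbol_eq_6)
  next
    case T: 7
    show ?case
    proof (rule transmutation_case_halfline[where \<omega> = "\<lambda>Y. 1 - Y" and \<beta> = "a - \<mu>" and \<delta> = "a - 1"])
      fix y :: real assume "y < 1"
      then show "tr_w T y * of_real (tr_w2 T y) = weight 0 (a - \<mu>) y"
        using cpow_mult_base[of "1 - y" "a - \<mu> - 1"] by (simp add: T weight_eq_cpow)
    qed (auto simp: T weight_eq_cpow symbol_eq_7)
  next
    case T: 8
    show ?case
      by (rule transmutation_case_halfline[where \<omega> = "\<lambda>Y. 1" and \<beta> = "a + b - c" and \<delta> = "a + b - c + \<mu>"])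
         (auto simp: T weight_eq_cpow symbol_eq_8)
  qed
  then show ?thesis unfolding transmutes_def .
qed

end
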